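(* Let $\gamma=\{t+iy(t):t\in[a,b]\}$, $-\infty<a<b<\infty$, be the graph of a Lipschitz function $y:[a,b]\to\mathbb{R}$, and let $\varphi\not\equiv-\infty$ be a subharmonic function on $\mathbb{C}$. Then for a point $\gamma(t)\in\gamma$, $\nu(\varphi)(\gamma(t))<1$ if and only if $e^{-\varphi}$ is locally integrable (with respect to arc length $ds$ on $\gamma$) in a neighborhood of $\gamma(t)$ on $\gamma$.
   Context: The Lelong number of a subharmonic function $\varphi\not\equiv-\infty$ at $z\in\mathbb{C}$ is $\nu(\varphi)(z)=\lim_{r\to0^+}\frac{\max_{|\zeta-z|=r}\varphi(\zeta)}{\log r}$; equivalently it is the mass at the point $z$ of the measure $\frac{1}{2\pi}\Delta\varphi$. $\gamma(t)=t+iy(t)$. *)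

theory Defs
  imports "HOL-Analysis.Analysis"
begin

definition usc_ereal :: "(complex \<Rightarrow> ereal) \<Rightarrow> bool" where
  "usc_ereal \<phi> \<longleftrightarrow> (\<forall>z c. \<phi> z < c \<longrightarrow> eventually (\<lambda>w. \<phi> w < c) (at z))"

text \<open>Mean value of \<phi> over the circle of radius r centred at z,
  (1/2pi) times the integral over [0,2pi] of \<phi>(z + r e^{i theta}),
  computed as (positive part) minus (negative part).\<close>
definition circle_mean :: "(complex \<Rightarrow> ereal) \<Rightarrow> complex \<Rightarrow> real \<Rightarrow> ereal" where
  "circle_mean \<phi> z r =
     (enn2ereal (\<integral>\<^sup>+\<theta>\<in>{0..2*pi}. e2ennreal (\<phi> (z + of_real r * cis \<theta>)) \<partial>lborel)
      - enn2ereal (\<integral>\<^sup>+\<theta>\<in>{0..2*pi}. e2ennreal (- \<phi> (z + of_real r * cis \<theta>)) \<partial>lborel))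
     / ereal (2 * pi)"

definition subharmonic :: "(complex \<Rightarrow> ereal) \<Rightarrow> bool" where
  "subharmonic \<phi> \<longleftrightarrow>
     (\<forall>z. \<phi> z < \<infinity>) \<and> usc_ereal \<phi> \<and>
     (\<forall>z. \<exists>R>0. \<forall>r. 0 < r \<and> r < R \<longrightarrow> \<phi> z \<le> circle_mean \<phi> z r)"

definition lelong :: "(complex \<Rightarrow> ereal) \<Rightarrow> complex \<Rightarrow> ereal" where
  "lelong \<phi> z = Lim (at_right 0) (\<lambda>r. (SUP \<zeta>\<in>sphere z r. \<phi> \<zeta>) / ereal (ln r))"

definition exp_neg :: "ereal \<Rightarrow> ennreal" where
  "exp_neg x = (case x of ereal v \<Rightarrow> ennreal (exp (- v)) | PInfty \<Rightarrow> 0 | MInfty \<Rightarrow> \<infinity>)"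

definition arclength_integral ::
    "(real \<Rightarrow> complex) \<Rightarrow> real set \<Rightarrow> (complex \<Rightarrow> ennreal) \<Rightarrow> ennreal" where
  "arclength_integral \<gamma> S f =
     (\<integral>\<^sup>+s\<in>S. f (\<gamma> s) * ennreal (norm (vector_derivative \<gamma> (at s))) \<partial>lborel)"

end

theory Submission
  imports Defs "HOL-Complex_Analysis.Complex_Analysis" "HOL-Real_Asymp.Real_Asymp"
begin

text \<open>
  The Riesz measure of \<open>\<phi>\<close> is replaced by an explicit approximation built from means over discs.
  Let \<open>a r\<close> be the normalised indicator of the disc of radius \<open>r\<close>, let \<open>L = ln |\<cdot>|\<close> and
  \<open>g r = L * a r - L\<close>, which is nonnegative and supported in that disc. Commutativity of convolution gives
  \<open>(u * g h) * (a r - \<delta>) = (u * (a h - \<delta>)) * g r\<close>. For \<open>u = \<phi> * a h\<close> and up to normalisation, \<open>u * g h\<close> is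
  a smoothing of \<open>\<phi>\<close> and \<open>u * (a h - \<delta>)\<close>, which is nonnegative, is the density of its Riesz measure.
  Since \<open>g r\<close> is convex in \<open>ln r\<close>, so are the means of \<open>\<phi>\<close> over discs, and their asymptotic slope
  at a point is the Lelong number there.

  If the slope is less than 1, some disc carries Riesz mass \<open>m < 1\<close>, and Jensen's inequality bounds \<open>exp (- \<phi>)\<close>
  on the graph by an average over \<open>\<zeta>\<close> of \<open>|s - Re \<zeta>| powr (- m)\<close>, which is uniformly integrable in \<open>s\<close>.
  If the slope is at least 1, then \<open>\<phi> \<le> C + ln r + ln (ln (1/r))\<close> at distance \<open>r\<close> from the point,
  and \<open>1 / (r ln (1/r))\<close> is not integrable at 0.
\<close>

section \<open>Lipschitz functions are differentiable almost everywhere\<close>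

definition straddle :: "real \<Rightarrow> (real \<times> real) filter" where
  "straddle x = (INF d\<in>{0<..}. principal {(u, v). u \<le> x \<and> x \<le> v \<and> u < v \<and> v - u < d})"

definition secant_slope :: "(real \<Rightarrow> real) \<Rightarrow> real \<times> real \<Rightarrow> real" where
  "secant_slope F = (\<lambda>(u, v). (F v - F u) / (v - u))"

definition slope_below :: "(real \<Rightarrow> real) \<Rightarrow> real \<Rightarrow> real set" where
  "slope_below F p = {x. \<exists>\<^sub>F i in straddle x. secant_slope F i < p}"

definition slope_above :: "(real \<Rightarrow> real) \<Rightarrow> real \<Rightarrow> real set" where
  "slope_above F q = {x. \<exists>\<^sub>F i in straddle x. q < secant_slope F i}"

lemma eventually_straddle:
  "eventually P (straddle x) \<longleftrightarrow>
    (\<exists>d>0. \<forall>u v. u \<le> x \<and> x \<le> v \<and> u < v \<and> v - u < d \<longrightarrow> P (u, v))"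
  unfolding straddle_def
proof (subst eventually_INF_base)
  fix d e :: real assume "d \<in> {0<..}" "e \<in> {0<..}"
  then show "\<exists>c\<in>{0<..}. principal {(u, v). u \<le> x \<and> x \<le> v \<and> u < v \<and> v - u < c}
    \<le> inf (principal {(u, v). u \<le> x \<and> x \<le> v \<and> u < v \<and> v - u < d})
          (principal {(u, v). u \<le> x \<and> x \<le> v \<and> u < v \<and> v - u < e})"
    by (intro bexI[of _ "min d e"]) auto
qed (auto simp: eventually_principal)

lemma frequently_straddle:
  "frequently P (straddle x) \<longleftrightarrow>
    (\<forall>d>0. \<exists>u v. u \<le> x \<and> x \<le> v \<and> u < v \<and> v - u < d \<and> P (u, v))"
  unfolding frequently_def eventually_straddle by blast

lemma straddle_neq_bot: "straddle x \<noteq> bot"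
proof -
  have "\<exists>u v. u \<le> x \<and> x \<le> v \<and> u < v \<and> v - u < d" if "0 < d" for d
    using that by (intro exI[of _ x] exI[of _ "x + d/2"]) auto
  then show ?thesis
    unfolding trivial_limit_def eventually_straddle by blast
qed

lemma has_real_derivative_if_secant_slope_tendsto:
  assumes "(secant_slope F \<longlongrightarrow> D) (straddle x)"
  shows "(F has_real_derivative D) (at x)"
proof -
  have "filterlim (\<lambda>y. (min x y, max x y)) (straddle x) (at x)"
    unfolding filterlim_iff eventually_straddle
  proof (intro allI impI, elim exE conjE)
    fix P d assume d: "0 < d"
      and P: "\<forall>u v. u \<le> x \<and> x \<le> v \<and> u < v \<and> v - u < d \<longrightarrow> P (u, v)"
    have "P (min x y, max x y)" if "y \<noteq> x" "dist y x < d" for y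
      using that P by (auto simp: min_def max_def dist_real_def)
    then show "\<forall>\<^sub>F y in at x. P (min x y, max x y)"
      using d unfolding eventually_at by blast
  qed
  then have "((\<lambda>y. secant_slope F (min x y, max x y)) \<longlongrightarrow> D) (at x)"
    by (rule filterlim_compose[OF assms])
  moreover have "secant_slope F (min x y, max x y) = (F y - F x) / (y - x)" for y
    using minus_divide_divide[of "F y - F x" "y - x"]
    by (auto simp: secant_slope_def min_def max_def)
  ultimately show ?thesis unfolding has_field_derivative_iff by simp
qed

lemma convergent_if_no_rational_gap:
  fixes g :: "'a \<Rightarrow> real"
  assumes nontriv: "F \<noteq> bot" and bounds: "\<forall>\<^sub>F i in F. a \<le> g i \<and> g i \<le> b"
    and no_gap: "\<And>p q. p \<in> \<rat> \<Longrightarrow> q \<in> \<rat> \<Longrightarrow> p < q \<Longrightarrow> \<exists>\<^sub>F i in F. g i < p \<Longrightarrow> \<not> (\<exists>\<^sub>F i in F. q < g i)"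
  shows "\<exists>l. (g \<longlongrightarrow> l) F"
proof -
  let ?I = "Liminf F (\<lambda>i. ereal (g i))" and ?S = "Limsup F (\<lambda>i. ereal (g i))"
  have "?I = ?S"
  proof (rule antisym[OF Liminf_le_Limsup[OF nontriv]], rule ccontr)
    assume "\<not> ?S \<le> ?I"
    then have "?I < ?S" by simp
    then obtain q where q: "?I < ereal (of_rat q)" "ereal (of_rat q) < ?S"
      using ereal_dense3 by blast
    then obtain p where p: "?I < ereal (of_rat p)" "ereal (of_rat p) < ereal (of_rat q)"
      using ereal_dense3 by blast
    have "\<exists>\<^sub>F i in F. g i < of_rat p"
      using p(1) Liminf_bounded[of "ereal (of_rat p)" "\<lambda>i. ereal (g i)" F]
      by (auto simp: frequently_def not_less)
    moreover have "\<exists>\<^sub>F i in F. of_rat q < g i"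
      using q(2) Limsup_bounded[of "\<lambda>i. ereal (g i)" "ereal (of_rat q)" F]
      by (auto simp: frequently_def not_less)
    ultimately show False using no_gap[of "of_rat p" "of_rat q"] p(2) by auto
  qed
  moreover have "ereal a \<le> ?I" "?S \<le> ereal b"
    using bounds by (auto intro!: Liminf_bounded Limsup_bounded elim: eventually_mono)
  ultimately obtain l where "?I = ereal l" "?S = ereal l"
    by (cases ?S) auto
  then have "((\<lambda>i. ereal (g i)) \<longlongrightarrow> ereal l) F"
    by (rule Liminf_eq_Limsup[OF nontriv])
  then show ?thesis by auto
qed

lemma slope_above_eq_slope_below: "slope_above F q = slope_below (\<lambda>x. - F x) (- q)"
proof -
  have "secant_slope (\<lambda>x. - F x) i = - secant_slope F i" for i
    by (cases i) (simp add: secant_slope_def minus_divide_left)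
  then show ?thesis by (simp add: slope_above_def slope_below_def)
qed

lemma slope_below_open_interval:
  assumes F: "continuous_on UNIV F" and x: "x \<in> slope_below F p" and d: "0 < d"
  obtains u v where "u < x" "x < v" "v - u < d" "secant_slope F (u, v) < p"
proof -
  obtain u v where uv: "u \<le> x" "x \<le> v" "u < v" "v - u < d" "secant_slope F (u, v) < p"
    using x d unfolding slope_below_def frequently_straddle by blast
  have F_at: "isCont F y" for y using F by (simp add: continuous_on_eq_continuous_at)
  have left: "((\<lambda>h. u - h) \<longlongrightarrow> u) (at_right 0)" and right: "((\<lambda>h. v + h) \<longlongrightarrow> v) (at_right 0)"
    by (auto intro!: tendsto_eq_intros)
  have "((\<lambda>h. secant_slope F (u - h, v + h)) \<longlongrightarrow> secant_slope F (u, v)) (at_right 0)"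
    unfolding secant_slope_def prod.case using uv(3)
    by (intro tendsto_intros left right isCont_tendsto_compose[OF F_at]) auto
  then have "\<forall>\<^sub>F h in at_right 0. secant_slope F (u - h, v + h) < p"
    using uv(5) by (rule order_tendstoD)
  moreover have "\<forall>\<^sub>F h in at_right 0. (v + h) - (u - h) < d"
    using tendsto_diff[OF right left] uv(4) by (rule order_tendstoD)
  moreover have "\<forall>\<^sub>F h in at_right 0. (0::real) < h" by (rule eventually_at_right_less)
  ultimately have "\<forall>\<^sub>F h in at_right 0. secant_slope F (u - h, v + h) < p \<and> (v + h) - (u - h) < d \<and> 0 < h"
    by eventually_elim simp
  then obtain h where "secant_slope F (u - h, v + h) < p" "(v + h) - (u - h) < d" "0 < h"
    using eventually_happens'[OF trivial_limit_at_right_real] by blast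
  then show ?thesis using that[of "u - h" "v + h"] uv by simp
qed

lemma slope_below_borel:
  assumes F: "continuous_on UNIV F"
  shows "slope_below F p \<in> sets borel"
proof -
  let ?J = "\<lambda>d. {(u, v). u < v \<and> v - u < d \<and> secant_slope F (u, v) < p}"
  have "slope_below F p = (\<Inter>n. \<Union>i\<in>?J (1 / real (Suc n)). {fst i<..<snd i})" (is "_ = ?G")
  proof (intro set_eqI iffI)
    fix x assume x: "x \<in> slope_below F p"
    have "\<exists>i\<in>?J d. x \<in> {fst i<..<snd i}" if d: "0 < d" for d
    proof -
      obtain u v where "u < x" "x < v" "v - u < d" "secant_slope F (u, v) < p"
        by (rule slope_below_open_interval[OF F x d])
      then show ?thesis by (intro bexI[of _ "(u, v)"]) auto
    qed
    then show "x \<in> ?G" by simp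
  next
    fix x assume x: "x \<in> ?G"
    show "x \<in> slope_below F p"
      unfolding slope_below_def mem_Collect_eq frequently_straddle
    proof (intro allI impI)
      fix d :: real assume "0 < d"
      then obtain n where "1 / real (Suc n) < d" by (rule nat_approx_posE)
      moreover have "x \<in> (\<Union>i\<in>?J (1 / real (Suc n)). {fst i<..<snd i})" using x by blast
      then obtain u v where "(u, v) \<in> ?J (1 / real (Suc n))" "x \<in> {u<..<v}" by auto
      ultimately show "\<exists>u v. u \<le> x \<and> x \<le> v \<and> u < v \<and> v - u < d \<and> secant_slope F (u, v) < p"
        by (intro exI[of _ u] exI[of _ v]) auto
    qed
  qed
  then show ?thesis
    by (simp only:) (intro sets.countable_INT'' borel_open open_UN
        ballI open_greaterThanLessThan open_UNIV countableI_type)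
qed

lemma Vitali_covering_straddle:
  assumes U: "open U" "E \<subseteq> U" and fine: "\<And>x. x \<in> E \<Longrightarrow> frequently P (straddle x)"
  obtains C where "countable C" "disjoint_family_on (\<lambda>i. {fst i..snd i}) C"
    "\<And>i. i \<in> C \<Longrightarrow> fst i < snd i \<and> {fst i..snd i} \<subseteq> U \<and> P i" "negligible (E - (\<Union>i\<in>C. {fst i..snd i}))"
proof -
  let ?K = "{i. fst i < snd i \<and> {fst i..snd i} \<subseteq> U \<and> P i}"
  let ?mid = "\<lambda>i::real\<times>real. (fst i + snd i) / 2" and ?rad = "\<lambda>i::real\<times>real. (snd i - fst i) / 2"
  have cball: "cball (?mid i) (?rad i) = {fst i..snd i}" for i
    by (simp add: cball_eq_atLeastAtMost field_simps)
  have cballs: "\<exists>i. i \<in> ?K \<and> x \<in> cball (?mid i) (?rad i) \<and> ?rad i < d" if x: "x \<in> E" and d: "0 < d" for x d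
  proof -
    obtain e where e: "0 < e" "ball x e \<subseteq> U" using U x by (meson openE subsetD)
    obtain u v where uv: "u \<le> x" "x \<le> v" "u < v" "v - u < min d e" "P (u, v)"
      using fine[OF x, unfolded frequently_straddle, rule_format, of "min d e"] d e(1) by auto
    then have "{u..v} \<subseteq> ball x e" by (auto simp: dist_real_def)
    then show ?thesis
      unfolding cball using uv e by (intro exI[of _ "(u, v)"]) auto
  qed
  obtain C where "countable C" "C \<subseteq> ?K"
     "pairwise (\<lambda>i j. disjnt (cball (?mid i) (?rad i)) (cball (?mid j) (?rad j))) C"
     "negligible (E - (\<Union>i\<in>C. cball (?mid i) (?rad i)))"
    by (rule Vitali_covering_theorem_cballs[of ?K ?rad E ?mid, OF _ cballs]) auto
  then show ?thesis
    unfolding cball by (intro that[of C]) (auto simp: disjoint_family_on_def pairwise_def disjnt_def)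
qed

lemma emeasure_UN_mono_cmult:
  assumes "countable C" "disjoint_family_on A C"
    and "\<And>i. i \<in> C \<Longrightarrow> A i \<in> sets M" "\<And>i. i \<in> C \<Longrightarrow> A i \<in> sets N"
    and "\<And>i. i \<in> C \<Longrightarrow> c * emeasure M (A i) \<le> d * emeasure N (A i)"
  shows "c * emeasure M (\<Union>i\<in>C. A i) \<le> d * emeasure N (\<Union>i\<in>C. A i)"
proof -
  have "c * emeasure M (\<Union>i\<in>C. A i) = (\<integral>\<^sup>+i. c * emeasure M (A i) \<partial>count_space C)"
    using assms by (subst emeasure_UN_countable) (auto simp: nn_integral_cmult)
  also have "\<dots> \<le> (\<integral>\<^sup>+i. d * emeasure N (A i) \<partial>count_space C)"
    using assms(5) by (intro nn_integral_mono) auto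
  also have "\<dots> = d * emeasure N (\<Union>i\<in>C. A i)"
    using assms by (subst emeasure_UN_countable) (auto simp: nn_integral_cmult)
  finally show ?thesis .
qed

context
  fixes F :: "real \<Rightarrow> real"
  assumes mono: "mono F" and cont: "continuous_on UNIV F"
begin

lemma emeasure_interval_measure_secant:
  assumes "u < v"
  shows "emeasure (interval_measure F) {u..v} = ennreal (secant_slope F (u, v)) * emeasure lborel {u..v}"
proof -
  have "emeasure (interval_measure F) {u..v} = ennreal (F v - F u)"
    using assms mono cont by (intro emeasure_interval_measure_Icc) (auto simp: mono_def)
  also have "F v - F u = secant_slope F (u, v) * (v - u)"
    using assms by (simp add: secant_slope_def)
  also have "ennreal \<dots> = ennreal (secant_slope F (u, v)) * emeasure lborel {u..v}"
    using assms by (simp add: ennreal_mult'')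
  finally show ?thesis .
qed

lemma slope_below_cover:
  assumes U: "open U" "E \<subseteq> U" and E: "E \<subseteq> slope_below F p"
  obtains V where "open V" "negligible (E - V)"
    "emeasure (interval_measure F) V \<le> ennreal p * emeasure lborel U"
proof -
  have fine: "\<exists>\<^sub>F i in straddle x. secant_slope F i < p" if "x \<in> E" for x
    using E that by (auto simp: slope_below_def)
  obtain C where C: "countable C" "disjoint_family_on (\<lambda>i. {fst i..snd i}) C"
    and ivl: "\<And>i. i \<in> C \<Longrightarrow> fst i < snd i \<and> {fst i..snd i} \<subseteq> U \<and> secant_slope F i < p"
    and neg: "negligible (E - (\<Union>i\<in>C. {fst i..snd i}))"
    by (rule Vitali_covering_straddle[OF U fine], assumption) (rule that)
  let ?W = "\<Union>i\<in>C. {fst i..snd i}"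
  define V where "V = (\<Union>i\<in>C. {fst i<..<snd i})"
  show ?thesis
  proof
    show "open V" unfolding V_def by auto
    have "negligible (\<Union>i\<in>C. {fst i, snd i})"
      using C(1) by (intro negligible_countable_Union) (auto intro!: negligible_finite)
    with neg have "negligible ((E - ?W) \<union> (\<Union>i\<in>C. {fst i, snd i}))" by (rule negligible_Un)
    then show "negligible (E - V)" by (rule negligible_subset) (force simp: V_def)
    have "emeasure (interval_measure F) V \<le> 1 * emeasure (interval_measure F) ?W"
      using C(1) by (auto simp: V_def intro!: emeasure_mono)
    also have "\<dots> \<le> ennreal p * emeasure lborel ?W"
    proof (rule emeasure_UN_mono_cmult[OF C])
      fix i assume "i \<in> C"
      then show "1 * emeasure (interval_measure F) {fst i..snd i} \<le> ennreal p * emeasure lborel {fst i..snd i}"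
        using ivl[of i] emeasure_interval_measure_secant[of "fst i" "snd i"]
        by (auto intro!: mult_right_mono ennreal_leI)
    qed auto
    also have "\<dots> \<le> ennreal p * emeasure lborel U"
      using ivl U by (intro mult_left_mono emeasure_mono) auto
    finally show "emeasure (interval_measure F) V \<le> ennreal p * emeasure lborel U" .
  qed
qed

lemma emeasure_slope_above_le:
  assumes V: "open V" and E: "E \<subseteq> slope_above F q" "E \<in> sets borel"
  shows "ennreal q * emeasure lborel (E \<inter> V) \<le> emeasure (interval_measure F) V"
proof -
  have fine: "\<exists>\<^sub>F i in straddle x. q < secant_slope F i" if "x \<in> E \<inter> V" for x
    using E that by (auto simp: slope_above_def)
  obtain D where D: "countable D" "disjoint_family_on (\<lambda>i. {fst i..snd i}) D"
    and ivl: "\<And>i. i \<in> D \<Longrightarrow> fst i < snd i \<and> {fst i..snd i} \<subseteq> V \<and> q < secant_slope F i"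
    and neg: "negligible (E \<inter> V - (\<Union>i\<in>D. {fst i..snd i}))"
    by (rule Vitali_covering_straddle[OF V Int_lower2 fine], assumption) (rule that)
  let ?W = "\<Union>i\<in>D. {fst i..snd i}"
  have W: "?W \<in> sets borel" using D(1) by auto
  have "AE x in lborel. x \<notin> E \<inter> V - ?W"
    using neg E(2) V W by (intro AE_not_in) (auto simp: negligible_iff_null_sets null_sets_completion_iff)
  then have "emeasure lborel (E \<inter> V) \<le> emeasure lborel ?W"
    using W by (intro emeasure_mono_AE) (auto elim: eventually_mono)
  then have "ennreal q * emeasure lborel (E \<inter> V) \<le> ennreal q * emeasure lborel ?W"
    by (rule mult_left_mono) simp
  also have "\<dots> \<le> 1 * emeasure (interval_measure F) ?W"
  proof (rule emeasure_UN_mono_cmult[OF D])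
    fix i assume "i \<in> D"
    then show "ennreal q * emeasure lborel {fst i..snd i} \<le> 1 * emeasure (interval_measure F) {fst i..snd i}"
      using ivl[of i] emeasure_interval_measure_secant[of "fst i" "snd i"]
      by (auto intro!: mult_right_mono ennreal_leI)
  qed auto
  also have "\<dots> \<le> emeasure (interval_measure F) V"
    using ivl V by (auto intro!: emeasure_mono)
  finally show ?thesis .
qed

lemma emeasure_slope_gap_le:
  assumes E: "E \<in> sets borel" "E \<subseteq> slope_below F p \<inter> slope_above F q" and e: "0 < e"
  shows "ennreal q * emeasure lborel E \<le> ennreal p * (emeasure lborel E + ennreal e)"
proof -
  obtain U where U: "open U" "E \<subseteq> U" "emeasure lborel (U - E) < ennreal e"
    using outer_regular_lborel[OF E(1) e] by blast
  obtain V where V: "open V" "negligible (E - V)"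
    "emeasure (interval_measure F) V \<le> ennreal p * emeasure lborel U"
    using slope_below_cover[OF U(1,2), of p] E(2) by blast
  have "AE x in lborel. x \<notin> E - V"
    using V E(1) by (intro AE_not_in) (auto simp: negligible_iff_null_sets null_sets_completion_iff)
  then have "emeasure lborel E = emeasure lborel (E \<inter> V)"
    using V(1) E(1) by (intro emeasure_eq_AE) (auto elim: eventually_mono)
  then have "ennreal q * emeasure lborel E \<le> emeasure (interval_measure F) V"
    using emeasure_slope_above_le[OF V(1) _ E(1)] E(2) by auto
  also have "\<dots> \<le> ennreal p * emeasure lborel U" by (rule V(3))
  also have "emeasure lborel U = emeasure lborel E + emeasure lborel (U - E)"
    using U(1,2) E(1) by (subst plus_emeasure) (auto simp: Un_absorb1)
  also have "ennreal p * \<dots> \<le> ennreal p * (emeasure lborel E + ennreal e)"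
    using U(3) by (intro mult_left_mono add_left_mono) auto
  finally show ?thesis .
qed

lemma negligible_slope_gap:
  assumes p: "0 \<le> p" and pq: "p < q"
  shows "negligible (slope_below F p \<inter> slope_above F q)"
proof (subst negligible_on_intervals, intro allI)
  fix a b :: real
  define E where "E = slope_below F p \<inter> slope_above F q \<inter> cbox a b"
  have E: "E \<in> sets borel"
    unfolding E_def slope_above_eq_slope_below
    by (intro sets.Int slope_below_borel cont continuous_on_minus borel_closed closed_cbox)
  have E_sub: "E \<subseteq> slope_below F p \<inter> slope_above F q" unfolding E_def by blast
  have "emeasure lborel E \<le> emeasure lborel (cbox a b)"
    unfolding E_def by (intro emeasure_mono) auto
  then obtain k where k: "emeasure lborel E = ennreal k" "0 \<le> k"
    using emeasure_lborel_cbox_finite[of a b] by (cases "emeasure lborel E") (auto simp: top_unique)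
  have "q * k \<le> p * k + e" if e: "0 < e" for e
  proof -
    have "q * k \<le> p * (k + e / (p + 1))"
      using emeasure_slope_gap_le[OF E E_sub, of "e / (p + 1)"] k p pq e
      by (simp add: ennreal_mult'[symmetric] ennreal_plus[symmetric] del: ennreal_plus)
    moreover have "p * (e / (p + 1)) \<le> e" using e p by (simp add: field_simps)
    ultimately show ?thesis by (simp add: distrib_left)
  qed
  then have "q * k \<le> p * k" by (rule field_le_epsilon)
  then have "k = 0" using pq k(2) by (simp add: mult_le_cancel_right)
  then show "negligible (slope_below F p \<inter> slope_above F q \<inter> cbox a b)"
    using k E unfolding E_def[symmetric]
    by (auto simp: negligible_iff_null_sets null_sets_completion_iff null_sets_def)
qed

end

lemma differentiable_if_no_slope_gap:
  assumes bounds: "\<And>u v. u < v \<Longrightarrow> 0 \<le> secant_slope F (u, v) \<and> secant_slope F (u, v) \<le> K"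
    and no_gap: "\<And>p q. p \<in> \<rat> \<Longrightarrow> q \<in> \<rat> \<Longrightarrow> 0 \<le> p \<Longrightarrow> p < q \<Longrightarrow> x \<notin> slope_below F p \<inter> slope_above F q"
  shows "F differentiable (at x)"
proof -
  have "\<exists>D. (secant_slope F \<longlongrightarrow> D) (straddle x)"
  proof (rule convergent_if_no_rational_gap[OF straddle_neq_bot])
    show "\<forall>\<^sub>F i in straddle x. 0 \<le> secant_slope F i \<and> secant_slope F i \<le> K"
      unfolding eventually_straddle using bounds by (auto intro!: exI[of _ 1])
    fix p q :: real assume pq: "p \<in> \<rat>" "q \<in> \<rat>" "p < q" and below: "\<exists>\<^sub>F i in straddle x. secant_slope F i < p"
    obtain u v where "u < v" "secant_slope F (u, v) < p"
      using below[unfolded frequently_straddle, rule_format, of 1] by auto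
    with bounds have "0 \<le> p" by force
    then show "\<not> (\<exists>\<^sub>F i in straddle x. q < secant_slope F i)"
      using no_gap pq below by (auto simp: slope_below_def slope_above_def)
  qed
  then show ?thesis
    using has_real_derivative_if_secant_slope_tendsto real_differentiable_def by blast
qed

theorem lipschitz_differentiable_AE:
  fixes f :: "real \<Rightarrow> real"
  assumes "L-lipschitz_on UNIV f"
  shows "negligible {x. \<not> f differentiable (at x)}"
proof -
  define F where "F x = f x + L * x" for x
  have "\<bar>f v - f u\<bar> \<le> L * (v - u)" if "u \<le> v" for u v
    using lipschitz_onD[OF assms, of v u] that by (simp add: dist_real_def)
  then have bounds: "0 \<le> F v - F u \<and> F v - F u \<le> (2 * L) * (v - u)" if "u \<le> v" for u v
    using that unfolding F_def by (fastforce simp: algebra_simps abs_le_iff)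
  then have mono: "mono F" by (auto simp: mono_def)
  have cont: "continuous_on UNIV F"
    unfolding F_def using lipschitz_on_continuous_on[OF assms] by (intro continuous_intros)
  have secant: "0 \<le> secant_slope F (u, v) \<and> secant_slope F (u, v) \<le> 2 * L" if "u < v" for u v
    using bounds[of u v] that by (simp add: secant_slope_def pos_divide_le_eq)
  let ?I = "{(p, q). p \<in> \<rat> \<and> q \<in> \<rat> \<and> 0 \<le> p \<and> p < (q::real)}"
  let ?gap = "\<lambda>(p, q). slope_below F p \<inter> slope_above F q"
  have "f differentiable (at x)" if "x \<notin> (\<Union>i\<in>?I. ?gap i)" for x
  proof -
    have "F differentiable (at x)"
      by (rule differentiable_if_no_slope_gap[OF secant]) (use that in auto)
    then have "(\<lambda>y. F y - L * y) differentiable (at x)" by (intro derivative_intros)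
    then show ?thesis by (simp add: F_def)
  qed
  then have "{x. \<not> f differentiable (at x)} \<subseteq> (\<Union>i\<in>?I. ?gap i)" by blast
  moreover have "negligible (\<Union>i\<in>?I. ?gap i)"
  proof (intro negligible_countable_Union countable_image)
    show "countable ?I"
      by (rule countable_subset[OF _ countable_SIGMA[OF countable_rat countable_rat]]) auto
  qed (use negligible_slope_gap[OF mono cont] in auto)
  ultimately show ?thesis by (rule negligible_subset[rotated])
qed

section \<open>Lebesgue measure on the complex plane\<close>

lemma lborel_complex_eq_pair:
  "(lborel :: complex measure) = distr (lborel \<Otimes>\<^sub>M lborel) borel (\<lambda>(x, y). Complex x y)"
proof (rule lborel_eqI)
  have [measurable]: "(\<lambda>(x, y). Complex x y) \<in> borel \<Otimes>\<^sub>M borel \<rightarrow>\<^sub>M borel"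
    unfolding borel_prod
    by (rule borel_measurable_continuous_onI) (auto simp: case_prod_unfold intro!: continuous_intros)
  fix l u :: complex
  assume le: "\<And>b. b \<in> Basis \<Longrightarrow> l \<bullet> b \<le> u \<bullet> b"
  have le': "Re l \<le> Re u" "Im l \<le> Im u" using le[of 1] le[of \<i>] by (auto simp: Basis_complex_def)
  have "(\<lambda>(x, y). Complex x y) -` box l u \<inter> space (lborel \<Otimes>\<^sub>M lborel) = {Re l<..<Re u} \<times> {Im l<..<Im u}"
    by (auto simp: in_box_complex_iff space_pair_measure)
  then have "emeasure (distr (lborel \<Otimes>\<^sub>M lborel) borel (\<lambda>(x, y). Complex x y)) (box l u)
     = emeasure (lborel \<Otimes>\<^sub>M lborel) ({Re l<..<Re u} \<times> {Im l<..<Im u})"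
    by (subst emeasure_distr) auto
  also have "\<dots> = emeasure lborel {Re l<..<Re u} * emeasure lborel {Im l<..<Im u}"
    by (rule lborel.emeasure_pair_measure_Times) auto
  also have "\<dots> = ennreal (Re u - Re l) * ennreal (Im u - Im l)" using le' by simp
  also have "\<dots> = (\<Prod>b\<in>Basis. (u - l) \<bullet> b)"
    using le' by (simp add: Basis_complex_def complex_i_not_one ennreal_mult')
  finally show "emeasure (distr (lborel \<Otimes>\<^sub>M lborel) borel (\<lambda>(x, y). Complex x y)) (box l u)
      = (\<Prod>b\<in>Basis. (u - l) \<bullet> b)" .
qed simp

lemma measurable_Complex [measurable (raw)]:
  assumes "f \<in> borel_measurable M" "g \<in> borel_measurable M"
  shows "(\<lambda>x. Complex (f x) (g x)) \<in> borel_measurable M"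
  unfolding Complex_eq using assms by measurable

lemma borel_measurable_cis [measurable]: "cis \<in> borel_measurable borel"
  by (intro borel_measurable_continuous_onI continuous_intros)

lemmas [measurable] = borel_open[OF open_ball] borel_closed[OF closed_cball]

lemma nn_integral_lborel_complex:
  fixes f :: "complex \<Rightarrow> ennreal"
  assumes [measurable]: "f \<in> borel_measurable borel"
  shows "(\<integral>\<^sup>+z. f z \<partial>lborel) = (\<integral>\<^sup>+x. \<integral>\<^sup>+y. f (Complex x y) \<partial>lborel \<partial>lborel)"
  by (subst lborel_complex_eq_pair, subst nn_integral_distr)
     (auto simp: lborel.nn_integral_fst[symmetric] case_prod_unfold)

lemma nn_integral_lborel_complex_swap:
  fixes f :: "complex \<Rightarrow> ennreal"
  assumes [measurable]: "f \<in> borel_measurable borel"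
  shows "(\<integral>\<^sup>+z. f z \<partial>lborel) = (\<integral>\<^sup>+y. \<integral>\<^sup>+x. f (Complex x y) \<partial>lborel \<partial>lborel)"
  unfolding nn_integral_lborel_complex[OF assms]
  by (rule lborel_pair.Fubini') measurable

lemma nn_integral_lborel_translation:
  fixes f :: "'a::euclidean_space \<Rightarrow> ennreal"
  assumes "f \<in> borel_measurable borel"
  shows "(\<integral>\<^sup>+z. f (w + z) \<partial>lborel) = (\<integral>\<^sup>+z. f z \<partial>lborel)"
  by (subst (2) lborel_distr_plus[of w, symmetric], subst nn_integral_distr) (use assms in auto)

lemma nn_integral_shear_Im:
  fixes f :: "complex \<Rightarrow> ennreal"
  assumes [measurable]: "f \<in> borel_measurable borel"
  shows "(\<integral>\<^sup>+z. f (Complex (Re z) (s * Re z + Im z)) \<partial>lborel) = (\<integral>\<^sup>+z. f z \<partial>lborel)"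
proof -
  have "(\<integral>\<^sup>+z. f (Complex (Re z) (s * Re z + Im z)) \<partial>lborel)
      = (\<integral>\<^sup>+x. \<integral>\<^sup>+y. f (Complex x (s * x + y)) \<partial>lborel \<partial>lborel)"
    by (subst nn_integral_lborel_complex) simp_all
  also have "\<dots> = (\<integral>\<^sup>+x. \<integral>\<^sup>+y. f (Complex x y) \<partial>lborel \<partial>lborel)"
    by (intro nn_integral_cong nn_integral_lborel_translation[where f="\<lambda>y. f (Complex x y)" for x]) measurable
  also have "\<dots> = (\<integral>\<^sup>+z. f z \<partial>lborel)" by (rule nn_integral_lborel_complex[symmetric]) fact
  finally show ?thesis .
qed

lemma nn_integral_shear_Re:
  fixes f :: "complex \<Rightarrow> ennreal"
  assumes [measurable]: "f \<in> borel_measurable borel"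
  shows "(\<integral>\<^sup>+z. f (Complex (t * Im z + Re z) (Im z)) \<partial>lborel) = (\<integral>\<^sup>+z. f z \<partial>lborel)"
proof -
  have "(\<integral>\<^sup>+z. f (Complex (t * Im z + Re z) (Im z)) \<partial>lborel)
      = (\<integral>\<^sup>+y. \<integral>\<^sup>+x. f (Complex (t * y + x) y) \<partial>lborel \<partial>lborel)"
    by (subst nn_integral_lborel_complex_swap) simp_all
  also have "\<dots> = (\<integral>\<^sup>+y. \<integral>\<^sup>+x. f (Complex x y) \<partial>lborel \<partial>lborel)"
    by (intro nn_integral_cong nn_integral_lborel_translation[where f="\<lambda>x. f (Complex x y)" for y]) measurable
  also have "\<dots> = (\<integral>\<^sup>+z. f z \<partial>lborel)" by (rule nn_integral_lborel_complex_swap[symmetric]) fact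
  finally show ?thesis .
qed

text \<open>A rotation by an angle other than \<open>\<pi>\<close> is a product of three shears.\<close>
lemma nn_integral_rotation_neq_minus_one:
  fixes f :: "complex \<Rightarrow> ennreal"
  assumes f [measurable]: "f \<in> borel_measurable borel" and c: "cmod c = 1" "c \<noteq> -1"
  shows "(\<integral>\<^sup>+z. f (c * z) \<partial>lborel) = (\<integral>\<^sup>+z. f z \<partial>lborel)"
proof -
  define a b t where "a = Re c" and "b = Im c" and "t = - b / (1 + a)"
  have ab: "a^2 + b^2 = 1" using c(1) unfolding a_def b_def cmod_def by simp
  have a: "1 + a \<noteq> 0"
  proof
    assume "1 + a = 0"
    then have "a = -1" by simp
    then have "b = 0" using ab by simp
    with \<open>a = -1\<close> c(2) show False unfolding a_def b_def by (simp add: complex_eq_iff)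
  qed
  have t1: "1 + b * t = a" using ab a unfolding t_def by (simp add: field_simps power2_eq_square)
  have t2: "t * (1 + a) = - b" using a unfolding t_def by simp
  let ?T = "\<lambda>z. Complex (t * Im z + Re z) (Im z)" and ?S = "\<lambda>z. Complex (Re z) (b * Re z + Im z)"
  have "c * z = ?T (?S (?T z))" for z
  proof (rule complex_eqI)
    have "Re (?T (?S (?T z))) = (1 + b * t) * Re z + (t + t * (1 + b * t)) * Im z"
      by (simp add: algebra_simps)
    also have "\<dots> = a * Re z - b * Im z" using t1 t2 by (simp add: algebra_simps)
    finally show "Re (c * z) = Re (?T (?S (?T z)))" by (simp add: a_def b_def)
    have "Im (?T (?S (?T z))) = (1 + b * t) * Im z + b * Re z" by (simp add: algebra_simps)
    then show "Im (c * z) = Im (?T (?S (?T z)))" unfolding t1 by (simp add: a_def b_def)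
  qed
  then have "(\<integral>\<^sup>+z. f (c * z) \<partial>lborel) = (\<integral>\<^sup>+z. f (?T (?S (?T z))) \<partial>lborel)" by simp
  also have "\<dots> = (\<integral>\<^sup>+z. f (?T (?S z)) \<partial>lborel)"
    by (rule nn_integral_shear_Re[where f="\<lambda>z. f (?T (?S z))"]) measurable
  also have "\<dots> = (\<integral>\<^sup>+z. f (?T z) \<partial>lborel)"
    by (rule nn_integral_shear_Im[where f="\<lambda>z. f (?T z)"]) measurable
  also have "\<dots> = (\<integral>\<^sup>+z. f z \<partial>lborel)" by (rule nn_integral_shear_Re) fact
  finally show ?thesis .
qed

lemma nn_integral_rotation:
  fixes f :: "complex \<Rightarrow> ennreal"
  assumes [measurable]: "f \<in> borel_measurable borel" and c: "cmod c = 1"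
  shows "(\<integral>\<^sup>+z. f (c * z) \<partial>lborel) = (\<integral>\<^sup>+z. f z \<partial>lborel)"
proof -
  define d where "d = csqrt c"
  have dd: "d * d = c" by (metis power2_csqrt d_def power2_eq_square)
  have nd: "cmod d = 1" using c by (simp add: d_def norm_csqrt)
  have "Re d \<ge> 0" unfolding d_def using Re_csqrt by simp
  then have "d \<noteq> -1" by auto
  have "(\<integral>\<^sup>+z. f (c * z) \<partial>lborel) = (\<integral>\<^sup>+z. f (d * (d * z)) \<partial>lborel)"
    by (simp add: mult.assoc[symmetric] dd)
  also have "\<dots> = (\<integral>\<^sup>+z. f (d * z) \<partial>lborel)"
    by (rule nn_integral_rotation_neq_minus_one[where f="\<lambda>z. f (d * z)"]) (use nd \<open>d \<noteq> -1\<close> in auto)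
  also have "\<dots> = (\<integral>\<^sup>+z. f z \<partial>lborel)"
    by (rule nn_integral_rotation_neq_minus_one) (use nd \<open>d \<noteq> -1\<close> in auto)
  finally show ?thesis .
qed

lemma lborel_distr_rotation:
  assumes "cmod c = 1"
  shows "distr lborel borel (\<lambda>z. c * z) = lborel"
proof (rule measure_eqI)
  fix A :: "complex set" assume "A \<in> sets (distr lborel borel (\<lambda>z. c * z))"
  then have [measurable]: "A \<in> sets borel" by simp
  have "emeasure (distr lborel borel (\<lambda>z. c * z)) A = (\<integral>\<^sup>+z. indicator A z \<partial>distr lborel borel (\<lambda>z. c * z))"
    by (rule nn_integral_indicator[symmetric]) simp
  also have "\<dots> = (\<integral>\<^sup>+z. indicator A (c * z) \<partial>lborel)"
    by (rule nn_integral_distr) auto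
  also have "\<dots> = (\<integral>\<^sup>+z. indicator A z \<partial>lborel)" by (rule nn_integral_rotation) (use assms in auto)
  finally show "emeasure (distr lborel borel (\<lambda>z. c * z)) A = emeasure lborel A" by simp
qed simp

lemma integral_rotation:
  fixes f :: "complex \<Rightarrow> real"
  assumes "f \<in> borel_measurable borel" "cmod c = 1"
  shows "(\<integral>z. f (c * z) \<partial>lborel) = (\<integral>z. f z \<partial>lborel)"
  by (subst (2) lborel_distr_rotation[OF assms(2), symmetric], subst integral_distr) (use assms in auto)

lemma integral_lborel_translation:
  fixes f :: "'a::euclidean_space \<Rightarrow> real"
  assumes "f \<in> borel_measurable borel"
  shows "(\<integral>z. f (w + z) \<partial>lborel) = (\<integral>z. f z \<partial>lborel)"
  by (subst (2) lborel_distr_plus[of w, symmetric], subst integral_distr) (use assms in auto)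

lemma integrable_lborel_translation_iff:
  fixes f :: "'a::euclidean_space \<Rightarrow> real"
  assumes "f \<in> borel_measurable borel"
  shows "integrable lborel (\<lambda>z. f (w + z)) \<longleftrightarrow> integrable lborel f"
  by (subst (2) lborel_distr_plus[of w, symmetric], subst integrable_distr_eq) (use assms in auto)

lemma lborel_distr_reflection: "distr lborel borel (\<lambda>z. w - z) = (lborel :: 'a::euclidean_space measure)"
  by (rule sym)
     (use lborel_affine_euclidean[where c="\<lambda>_. -1" and t=w] in
       \<open>simp add: density_1 euclidean_representation sum_negf\<close>)

lemma integral_lborel_reflection:
  fixes f :: "'a::euclidean_space \<Rightarrow> real"
  assumes "f \<in> borel_measurable borel"
  shows "(\<integral>z. f (w - z) \<partial>lborel) = (\<integral>z. f z \<partial>lborel)"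
  by (subst (2) lborel_distr_reflection[of w, symmetric], subst integral_distr) (use assms in auto)

lemma integrable_lborel_reflection_iff:
  fixes f :: "'a::euclidean_space \<Rightarrow> real"
  assumes "f \<in> borel_measurable borel"
  shows "integrable lborel (\<lambda>z. f (w - z)) \<longleftrightarrow> integrable lborel f"
  by (subst (2) lborel_distr_reflection[of w, symmetric], subst integrable_distr_eq) (use assms in auto)

lemma AE_lborel_reflection:
  fixes P :: "'a::euclidean_space \<Rightarrow> bool"
  assumes "AE z in lborel. P z"
  shows "AE z in lborel. P (w - z)"
proof -
  have "AE z in distr lborel borel (\<lambda>z. w - z). P z"
    using assms unfolding lborel_distr_reflection .
  then show ?thesis
    by (rule AE_distrD[rotated]) simp
qed

lemma integral_lborel_scaleR:
  fixes f :: "'a::euclidean_space \<Rightarrow> real"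
  assumes "f \<in> borel_measurable borel" "r > 0"
  shows "(\<integral>z. f z \<partial>lborel) = r ^ DIM('a) * (\<integral>z. f (r *\<^sub>R z) \<partial>lborel)"
proof -
  have "(\<integral>z. f z \<partial>lborel)
      = (\<integral>z. f z \<partial>density (distr lborel borel (\<lambda>x. 0 + r *\<^sub>R x)) (\<lambda>_. ennreal (r ^ DIM('a))))"
    using assms by (subst lborel_affine[of r 0]) (auto simp: ennreal_power[symmetric])
  also have "\<dots> = r ^ DIM('a) * (\<integral>z. f (r *\<^sub>R z) \<partial>lborel)"
    using assms by (subst integral_density) (auto simp: integral_distr)
  finally show ?thesis .
qed

lemma nn_integral_circle_average:
  fixes f :: "complex \<Rightarrow> ennreal"
  assumes [measurable]: "f \<in> borel_measurable borel"
  shows "(\<integral>\<^sup>+x. (\<integral>\<^sup>+t\<in>{0..2*pi}. f (cis t * x) \<partial>lborel) \<partial>lborel) = ennreal (2 * pi) * (\<integral>\<^sup>+x. f x \<partial>lborel)"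
proof -
  have "(\<integral>\<^sup>+x. (\<integral>\<^sup>+t\<in>{0..2*pi}. f (cis t * x) \<partial>lborel) \<partial>lborel) =
      (\<integral>\<^sup>+t. (\<integral>\<^sup>+x. f (cis t * x) * indicator {0..2*pi} t \<partial>lborel) \<partial>lborel)"
    by (rule lborel_pair.Fubini') measurable
  also have "\<dots> = (\<integral>\<^sup>+t\<in>{0..2*pi}. (\<integral>\<^sup>+x. f x \<partial>lborel) \<partial>lborel)"
    by (intro nn_integral_cong) (simp add: nn_integral_multc nn_integral_rotation)
  also have "\<dots> = ennreal (2 * pi) * (\<integral>\<^sup>+x. f x \<partial>lborel)"
    by (simp add: nn_integral_cmult_indicator mult.commute)
  finally show ?thesis .
qed

lemma integral_circle_average:
  fixes f :: "complex \<Rightarrow> real"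
  assumes f: "integrable lborel f"
  shows "(\<integral>x. (LBINT t:{0..2*pi}. f (cis t * x)) \<partial>lborel) = 2 * pi * (\<integral>x. f x \<partial>lborel)"
proof -
  have [measurable]: "f \<in> borel_measurable borel" using f by (simp add: integrable_iff_bounded)
  let ?J = "indicator {0..2*pi} :: real \<Rightarrow> real"
  have rotation: "integrable lborel (\<lambda>x. f (cis t * x))" for t
  proof -
    have "integrable (distr lborel borel (\<lambda>x. cis t * x)) f" using f by (simp add: lborel_distr_rotation)
    then show ?thesis by (subst (asm) integrable_distr_eq) auto
  qed
  have product: "integrable (lborel \<Otimes>\<^sub>M lborel) (\<lambda>(t, x). ?J t * f (cis t * x))"
  proof (rule lborel_pair.Fubini_integrable)
    have "(\<integral>x. norm (?J t * f (cis t * x)) \<partial>lborel) = ?J t * (\<integral>x. \<bar>f x\<bar> \<partial>lborel)" for t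
      using integral_rotation[of "\<lambda>x. \<bar>f x\<bar>" "cis t"] by (simp add: abs_mult)
    then show "integrable lborel (\<lambda>t. \<integral>x. norm (case (t, x) of (t, x) \<Rightarrow> ?J t * f (cis t * x)) \<partial>lborel)"
      by (simp add: integrable_real_indicator)
    show "AE t in lborel. integrable lborel (\<lambda>x. case (t, x) of (t, x) \<Rightarrow> ?J t * f (cis t * x))"
      using rotation by (auto intro!: AE_I2)
  qed measurable
  have "(\<integral>x. (LBINT t:{0..2*pi}. f (cis t * x)) \<partial>lborel) = (\<integral>x. (\<integral>t. ?J t * f (cis t * x) \<partial>lborel) \<partial>lborel)"
    by (simp add: set_lebesgue_integral_def)
  also have "\<dots> = (\<integral>t. (\<integral>x. ?J t * f (cis t * x) \<partial>lborel) \<partial>lborel)"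
    by (rule lborel_pair.Fubini_integral) (rule product)
  also have "\<dots> = 2 * pi * (\<integral>x. f x \<partial>lborel)"
    by (simp add: integral_rotation)
  finally show ?thesis .
qed

lemma AE_lborel_norm_neq: "AE x in lborel. norm (x::'a::euclidean_space) \<noteq> r"
proof -
  have "AE x in lborel. x \<notin> sphere (0::'a) r"
    using negligible_sphere[of "0::'a" r]
    by (intro AE_not_in) (simp add: negligible_iff_null_sets null_sets_completion_iff)
  then show ?thesis by simp
qed

lemma integrable_indicator_ball: "integrable lborel (indicator (ball c r) :: 'a::euclidean_space \<Rightarrow> real)"
  by (intro integrable_real_indicator emeasure_bounded_finite bounded_ball) auto

lemma set_nn_integral_has_integral:
  fixes f :: "'a::euclidean_space \<Rightarrow> real"
  assumes "\<And>x. x \<in> S \<Longrightarrow> 0 \<le> f x" "(f has_integral I) S"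
  shows "(\<integral>\<^sup>+x\<in>S. ennreal (f x) \<partial>lborel) = ennreal I"
proof -
  have "(\<integral>\<^sup>+x\<in>S. ennreal (f x) \<partial>lborel) = (\<integral>\<^sup>+x. ennreal (indicator S x * f x) \<partial>lborel)"
    by (intro nn_integral_cong) (auto simp: indicator_def)
  then show ?thesis using nn_integral_has_integral_lebesgue[OF assms] by simp
qed

lemma nn_integral_abs_powr_finite:
  assumes "- 1 < m" "0 \<le> R"
  shows "(\<integral>\<^sup>+s\<in>{-R..R}. ennreal (\<bar>s\<bar> powr m) \<partial>lborel) < \<infinity>"
proof -
  let ?f = "\<lambda>s. ennreal (s powr m) * indicator {0..R} s"
  have "(\<integral>\<^sup>+s. ?f s \<partial>lborel) = ennreal (R powr (m + 1) / (m + 1))"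
    by (rule set_nn_integral_has_integral[OF _ has_integral_powr_from_0[OF assms]]) simp
  then have right: "(\<integral>\<^sup>+s. ?f s \<partial>lborel) < \<infinity>" by simp
  have left: "(\<integral>\<^sup>+s. ?f (- s) \<partial>lborel) = (\<integral>\<^sup>+s. ?f s \<partial>lborel)"
    using nn_integral_real_affine[of ?f "-1" 0] by simp
  have "(\<integral>\<^sup>+s\<in>{-R..R}. ennreal (\<bar>s\<bar> powr m) \<partial>lborel) \<le> (\<integral>\<^sup>+s. ?f s + ?f (- s) \<partial>lborel)"
    by (intro nn_integral_mono) (auto simp: indicator_def abs_if)
  also have "\<dots> = (\<integral>\<^sup>+s. ?f s \<partial>lborel) + (\<integral>\<^sup>+s. ?f s \<partial>lborel)"
    by (subst nn_integral_add) (auto simp only: left, auto)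
  also have "\<dots> < \<infinity>" using right by simp
  finally show ?thesis .
qed

lemma max_0_ln_divide_le_powr:
  assumes "0 < b" "b \<le> a" "0 < R"
  shows "max 0 (ln (R / a)) \<le> 2 * sqrt R * b powr (- 1/2)"
proof -
  have "ln (R / a) \<le> ln (R / b)" using assms by (subst ln_le_cancel_iff) (auto intro: divide_left_mono)
  also have "ln (R / b) = 2 * ln (sqrt (R / b))" using assms by (simp add: ln_sqrt)
  also have "\<dots> \<le> 2 * sqrt (R / b)" using ln_le_minus_one[of "sqrt (R / b)"] assms by simp
  also have "sqrt (R / b) = sqrt R * b powr (- 1/2)"
    using assms by (simp add: real_sqrt_divide powr_minus_divide powr_half_sqrt)
  finally show ?thesis using assms by simp
qed

lemma integrable_max_0_ln_divide_cmod:
  assumes R: "R > 0"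
  shows "integrable lborel (\<lambda>z. max 0 (ln (R / cmod z)))"
proof (rule integrableI_nonneg)
  let ?h = "\<lambda>x. ennreal (2 * sqrt R) * (ennreal (\<bar>x\<bar> powr (- 1/2)) * indicator {-R..R} x)"
  have bound: "ennreal (max 0 (ln (R / cmod z))) \<le> ?h (Re z) * indicator {-R..R} (Im z)" if "Re z \<noteq> 0" for z
  proof (cases "cmod z \<le> R")
    case True
    have "max 0 (ln (R / cmod z)) \<le> 2 * sqrt R * \<bar>Re z\<bar> powr (- 1/2)"
      using that R by (intro max_0_ln_divide_le_powr abs_Re_le_cmod) auto
    moreover have "\<bar>Re z\<bar> \<le> R" "\<bar>Im z\<bar> \<le> R" using abs_Re_le_cmod[of z] abs_Im_le_cmod[of z] True by auto
    ultimately show ?thesis using R by (auto simp: abs_le_iff ennreal_mult'[symmetric] intro!: ennreal_leI)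
  next
    case False
    then have "0 < R / cmod z" "R / cmod z \<le> 1" using R by (auto simp: divide_simps)
    then have "ln (R / cmod z) \<le> 0" by simp
    then show ?thesis by simp
  qed
  have "(\<integral>\<^sup>+z. ennreal (max 0 (ln (R / cmod z))) \<partial>lborel)
      = (\<integral>\<^sup>+x. \<integral>\<^sup>+y. ennreal (max 0 (ln (R / cmod (Complex x y)))) \<partial>lborel \<partial>lborel)"
    by (rule nn_integral_lborel_complex) measurable
  also have "\<dots> \<le> (\<integral>\<^sup>+x. \<integral>\<^sup>+y. ?h x * indicator {-R..R} y \<partial>lborel \<partial>lborel)"
    using AE_lborel_singleton[of "0::real"]
    by (intro nn_integral_mono_AE, eventually_elim)
       (use bound[of "Complex x y" for x y] in \<open>auto intro: nn_integral_mono\<close>)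
  also have "\<dots> = (\<integral>\<^sup>+x. ?h x * ennreal (2 * R) \<partial>lborel)"
    using R by (intro nn_integral_cong) (simp add: nn_integral_cmult_indicator)
  also have "\<dots> = ennreal (2 * sqrt R) * (\<integral>\<^sup>+s\<in>{-R..R}. ennreal (\<bar>s\<bar> powr (- 1/2)) \<partial>lborel) * ennreal (2 * R)"
    by (simp add: nn_integral_multc nn_integral_cmult)
  also have "\<dots> < \<infinity>"
    using nn_integral_abs_powr_finite[of "- 1/2" R] R by (auto simp: ennreal_mult_less_top)
  finally show "(\<integral>\<^sup>+z. ennreal (max 0 (ln (R / cmod z))) \<partial>lborel) < \<infinity>" .
qed auto

section \<open>Harmonic functions and the maximum principle\<close>

lemma has_integral_circle_holomorphic:
  fixes F :: "complex \<Rightarrow> complex"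
  assumes "continuous_on (cball 0 1) F" "F holomorphic_on ball 0 1"
  shows "((\<lambda>t. F (cis t)) has_integral 2 * pi * F 0) {0..2*pi}"
proof -
  have "((\<lambda>u. F u / (u - 0)) has_contour_integral (2 * of_real pi * \<i> * F 0)) (circlepath 0 1)"
    by (rule Cauchy_integral_circlepath) (use assms in auto)
  then have "((\<lambda>t. F (0 + 1 * cis t) / (0 + 1 * cis t) * 1 * \<i> * cis t)
      has_integral 2 * of_real pi * \<i> * F 0) {0..2*pi}"
    unfolding circlepath_def using has_contour_integral_part_circlepath_iff[of 0 "2*pi"] by simp
  then have "((\<lambda>t. (-\<i>) * (F (0 + 1 * cis t) / (0 + 1 * cis t) * 1 * \<i> * cis t))
      has_integral (-\<i>) * (2 * of_real pi * \<i> * F 0)) {0..2*pi}"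
    by (rule has_integral_mult_right)
  then show ?thesis by (simp add: field_simps)
qed

lemma has_integral_circle_Re_holomorphic:
  fixes F :: "complex \<Rightarrow> complex"
  assumes "F holomorphic_on UNIV"
  shows "((\<lambda>t. Re (F (z + cis t * x))) has_integral 2 * pi * Re (F z)) {0..2*pi}"
proof -
  have hol: "(\<lambda>u. F (z + u * x)) holomorphic_on UNIV"
    by (rule holomorphic_on_compose_gen[of "\<lambda>u. z + u * x" UNIV F UNIV, unfolded o_def, OF _ assms])
       (auto intro!: holomorphic_intros)
  have "((\<lambda>t. F (z + cis t * x)) has_integral 2 * pi * F (z + 0 * x)) {0..2*pi}"
    by (rule has_integral_circle_holomorphic[where F="\<lambda>u. F (z + u * x)"])
       (use hol in \<open>auto intro: holomorphic_on_subset holomorphic_on_imp_continuous_on\<close>)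
  from has_integral_Re[OF this] show ?thesis by simp
qed

lemma has_integral_circle_ln_norm_one_minus:
  assumes "cmod a < 1"
  shows "((\<lambda>t. ln (cmod (1 - a * cis t))) has_integral 0) {0..2*pi}"
proof -
  have pos: "Re (1 - a * u) > 0" if "cmod u \<le> 1" for u
  proof -
    have "Re (a * u) \<le> cmod (a * u)" by (rule complex_Re_le_cmod)
    also have "\<dots> = cmod a * cmod u" by (simp add: norm_mult)
    also have "\<dots> \<le> cmod a" using that by (simp add: mult_left_le)
    finally show ?thesis using assms by simp
  qed
  have nz: "1 - a * u \<notin> \<real>\<^sub>\<le>\<^sub>0" if "cmod u \<le> 1" for u
    using pos[OF that] by (auto simp: complex_nonpos_Reals_iff)
  have "((\<lambda>t. Ln (1 - a * cis t)) has_integral 2 * pi * Ln (1 - a * 0)) {0..2*pi}"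
    by (rule has_integral_circle_holomorphic[where F="\<lambda>u. Ln (1 - a * u)"])
       (auto intro!: continuous_intros holomorphic_intros simp: nz)
  from has_integral_Re[OF this]
  have "((\<lambda>t. Re (Ln (1 - a * cis t))) has_integral 0) {0..2*pi}" by simp
  then show ?thesis
  proof (rule has_integral_eq[rotated])
    fix t
    have "1 - a * cis t \<noteq> 0" using pos[of "cis t"]
      by (metis less_irrefl norm_cis order_refl zero_complex.simps(1))
    then show "Re (Ln (1 - a * cis t)) = ln (cmod (1 - a * cis t))" by (rule Re_Ln)
  qed
qed

lemma has_integral_circle_ln_norm_less:
  assumes "cmod x < cmod z"
  shows "((\<lambda>t. ln (cmod (z - cis t * x))) has_integral 2 * pi * ln (cmod z)) {0..2*pi}"
proof -
  have z: "z \<noteq> 0" using assms by auto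
  have less_1: "cmod (x / z) < 1" using assms z by (simp add: norm_divide divide_less_eq)
  have "((\<lambda>t. ln (cmod z) + ln (cmod (1 - x / z * cis t))) has_integral (2 * pi * ln (cmod z) + 0)) {0..2*pi}"
    using has_integral_const_real[of "ln (cmod z)" 0 "2*pi"]
    by (intro has_integral_add has_integral_circle_ln_norm_one_minus[OF less_1]) simp
  then show ?thesis
  proof (rule has_integral_eq_rhs[OF has_integral_eq[rotated]])
    fix t
    have "cmod (x / z * cis t) < 1" using less_1 by (simp add: norm_mult norm_divide)
    then have "1 - x / z * cis t \<noteq> 0" by auto
    moreover have "z - cis t * x = z * (1 - x / z * cis t)" using z by (simp add: field_simps)
    ultimately show "ln (cmod z) + ln (cmod (1 - x / z * cis t)) = ln (cmod (z - cis t * x))"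
      using z by (simp add: norm_mult ln_mult)
  qed simp
qed

lemma has_integral_circle_ln_norm:
  assumes "cmod z \<noteq> cmod x"
  shows "((\<lambda>t. ln (cmod (z - cis t * x))) has_integral 2 * pi * ln (max (cmod z) (cmod x))) {0..2*pi}"
proof (cases "cmod x < cmod z")
  case True
  then show ?thesis using has_integral_circle_ln_norm_less[OF True] by (simp add: max_def)
next
  case False
  then have less: "cmod z < cmod x" using assms by simp
  have "cmod (z - cis t * x) = cmod (cnj x - cis t * cnj z)" for t
  proof -
    have "cis t * cnj (cis t) = 1" by (simp add: cis_cnj cis_mult)
    then have "cnj x - cis t * cnj z = - cis t * cnj (z - cis t * x)" by (simp add: algebra_simps)
    then show ?thesis by (simp add: norm_mult del: complex_cnj_diff)
  qed
  then show ?thesis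
    using has_integral_circle_ln_norm_less[of "cnj z" "cnj x"] less by (simp add: max_def)
qed

lemma has_integral_circle_norm_square:
  "((\<lambda>t. (cmod (w + cis t * x))\<^sup>2) has_integral 2 * pi * ((cmod w)\<^sup>2 + (cmod x)\<^sup>2)) {0..2*pi}"
proof -
  have "((\<lambda>t. Re (2 * cnj w * (0 + cis t * x))) has_integral 2 * pi * Re (2 * cnj w * 0)) {0..2*pi}"
    by (rule has_integral_circle_Re_holomorphic) (auto intro!: holomorphic_intros)
  then have "((\<lambda>t. ((cmod w)\<^sup>2 + (cmod x)\<^sup>2) + Re (2 * cnj w * (cis t * x))) has_integral
      2 * pi * ((cmod w)\<^sup>2 + (cmod x)\<^sup>2) + 0) {0..2*pi}"
    using has_integral_const_real[of "(cmod w)\<^sup>2 + (cmod x)\<^sup>2" 0 "2*pi"] by (intro has_integral_add) simp_all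
  moreover have "(cmod w)\<^sup>2 + (cmod x)\<^sup>2 + Re (2 * cnj w * (cis t * x)) = (cmod (w + cis t * x))\<^sup>2" for t
  proof -
    have "(cmod (w + cis t * x))\<^sup>2 = (cmod w)\<^sup>2 + 2 * (w \<bullet> (cis t * x)) + (cmod (cis t * x))\<^sup>2"
      unfolding power2_norm_eq_inner by (simp add: inner_add_left inner_add_right inner_commute)
    then show ?thesis by (simp add: inner_complex_def norm_mult algebra_simps)
  qed
  ultimately show ?thesis by simp
qed

lemma circle_mean_continuous:
  assumes cont: "continuous_on UNIV Q"
    and I: "((\<lambda>t. Q (z + cis t * of_real r)) has_integral 2 * pi * J) {0..2*pi}"
  shows "circle_mean (\<lambda>w. ereal (Q w)) z r = ereal J"
proof -
  let ?q = "\<lambda>t. Q (z + of_real r * cis t)"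
  have cont_circle: "continuous_on {0..2*pi} ?q"
    by (rule continuous_on_compose2[OF cont]) (auto intro!: continuous_intros)
  obtain A where A: "((\<lambda>t. max 0 (?q t)) has_integral A) {0..2*pi}"
    using integrable_continuous_real[OF continuous_on_max[OF continuous_on_const cont_circle]] by blast
  obtain B where B: "((\<lambda>t. max 0 (- ?q t)) has_integral B) {0..2*pi}"
    using integrable_continuous_real[OF
        continuous_on_max[OF continuous_on_const continuous_on_minus[OF cont_circle]]]
    by blast
  have "(?q has_integral A - B) {0..2*pi}"
    by (rule has_integral_eq[OF _ has_integral_diff[OF A B]]) (auto simp: max_def)
  moreover have "(?q has_integral 2 * pi * J) {0..2*pi}" using I by (simp add: mult.commute)
  ultimately have AB: "A - B = 2 * pi * J" by (rule has_integral_unique)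
  have "(\<integral>\<^sup>+\<theta>\<in>{0..2*pi}. e2ennreal (ereal (?q \<theta>)) \<partial>lborel) = (\<integral>\<^sup>+\<theta>\<in>{0..2*pi}. ennreal (max 0 (?q \<theta>)) \<partial>lborel)"
    by (intro nn_integral_cong) (simp add: max_def ennreal_neg)
  also have "\<dots> = ennreal A" by (rule set_nn_integral_has_integral[OF _ A]) simp
  finally have pos: "(\<integral>\<^sup>+\<theta>\<in>{0..2*pi}. e2ennreal (ereal (?q \<theta>)) \<partial>lborel) = ennreal A" .
  have "(\<integral>\<^sup>+\<theta>\<in>{0..2*pi}. e2ennreal (- ereal (?q \<theta>)) \<partial>lborel) = (\<integral>\<^sup>+\<theta>\<in>{0..2*pi}. ennreal (max 0 (- ?q \<theta>)) \<partial>lborel)"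
    by (intro nn_integral_cong) (simp add: max_def ennreal_neg)
  also have "\<dots> = ennreal B" by (rule set_nn_integral_has_integral[OF _ B]) simp
  finally have neg: "(\<integral>\<^sup>+\<theta>\<in>{0..2*pi}. e2ennreal (- ereal (?q \<theta>)) \<partial>lborel) = ennreal B" .
  have "0 \<le> A" "0 \<le> B" using has_integral_nonneg[OF A] has_integral_nonneg[OF B] by auto
  then show ?thesis
    unfolding circle_mean_def pos neg using AB by (simp add: enn2ereal_ennreal)
qed

lemma circle_mean_mono:
  assumes "0 < r" "\<And>w. w \<in> sphere z r \<Longrightarrow> \<phi> w \<le> \<psi> w"
  shows "circle_mean \<phi> z r \<le> circle_mean \<psi> z r"
proof -
  have "\<phi> (z + of_real r * cis t) \<le> \<psi> (z + of_real r * cis t)" for t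
    using assms by (simp add: dist_norm norm_mult)
  then show ?thesis
    unfolding circle_mean_def
    by (intro ereal_divide_right_mono ereal_minus_mono)
       (auto simp: less_eq_ennreal.rep_eq[symmetric] intro!: nn_integral_mono mult_right_mono e2ennreal_mono)
qed

lemma usc_ereal_add_continuous:
  assumes "usc_ereal \<phi>" "continuous_on UNIV c"
  shows "usc_ereal (\<lambda>w. \<phi> w + ereal (c w))"
  unfolding usc_ereal_def
proof (intro allI impI)
  fix z d assume "\<phi> z + ereal (c z) < d"
  then have "\<phi> z < d - ereal (c z)" by (simp add: ereal_less_minus_iff)
  then obtain e where e: "\<phi> z < ereal e" "ereal e < d - ereal (c z)" using ereal_dense2 by blast
  have "eventually (\<lambda>w. \<phi> w < ereal e) (at z)" using assms(1) e(1) unfolding usc_ereal_def by blast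
  moreover have "eventually (\<lambda>w. ereal (e + c w) < d) (at z)"
  proof (rule order_tendstoD(2))
    have "(c \<longlongrightarrow> c z) (at z)" using assms(2) by (simp add: continuous_on_def)
    then show "((\<lambda>w. ereal (e + c w)) \<longlongrightarrow> ereal (e + c z)) (at z)" by (intro tendsto_intros)
    show "ereal (e + c z) < d" using e(2) by (simp add: ereal_less_minus_iff)
  qed
  ultimately show "eventually (\<lambda>w. \<phi> w + ereal (c w) < d) (at z)"
  proof eventually_elim
    case (elim w)
    have "\<phi> w + ereal (c w) \<le> ereal e + ereal (c w)" using elim(1) by (intro add_right_mono) auto
    then show ?case using elim(2) by simp
  qed
qed

lemma usc_ereal_open_less:
  assumes "usc_ereal \<phi>"
  shows "open {w. \<phi> w < c}"
proof (subst open_subopen, safe)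
  fix z assume z: "\<phi> z < c"
  then have "eventually (\<lambda>w. \<phi> w < c) (at z)" using assms by (auto simp: usc_ereal_def)
  then have "eventually (\<lambda>w. \<phi> w < c) (nhds z)" using z by (simp add: eventually_nhds_conv_at)
  then show "\<exists>T. open T \<and> z \<in> T \<and> T \<subseteq> {w. \<phi> w < c}" unfolding eventually_nhds by blast
qed

lemma usc_ereal_borel [measurable_dest]:
  assumes "usc_ereal \<phi>"
  shows "\<phi> \<in> borel_measurable borel"
  by (rule borel_measurableI_less) (use usc_ereal_open_less[OF assms] in auto)

lemma usc_ereal_attains_sup:
  assumes "usc_ereal v" "compact K" "K \<noteq> {}"
  shows "\<exists>x\<in>K. \<forall>y\<in>K. v y \<le> v x"
proof (rule ccontr)
  assume "\<not> ?thesis"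
  then have *: "\<And>x. x \<in> K \<Longrightarrow> \<exists>y\<in>K. v x < v y" by (auto simp: not_le)
  obtain C where C: "C \<subseteq> K" "finite C" "K \<subseteq> (\<Union>y\<in>C. {w. v w < v y})"
    by (rule compactE_image[OF assms(2), of K "\<lambda>y. {w. v w < v y}"])
       (use usc_ereal_open_less[OF assms(1)] * in auto)
  then have "C \<noteq> {}" using assms(3) by auto
  then have "Max (v ` C) \<in> v ` C" using C(2) by simp
  then obtain y where y: "y \<in> C" "v y = Max (v ` C)" by auto
  then obtain y' where "y' \<in> C" "v y < v y'" using C by blast
  then have "v y' \<le> Max (v ` C)" using C(2) by simp
  with y \<open>v y < v y'\<close> show False by simp
qed

lemma usc_ereal_bounded_above:
  assumes "usc_ereal v" "compact K" "\<And>z. v z < \<infinity>"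
  obtains M :: real where "\<And>z. z \<in> K \<Longrightarrow> v z \<le> ereal M"
proof (cases "K = {}")
  case False
  then obtain x where x: "x \<in> K" "\<And>y. y \<in> K \<Longrightarrow> v y \<le> v x" using usc_ereal_attains_sup[OF assms(1,2)] by blast
  obtain M where M: "v x < ereal M" using assms(3)[of x] ereal_dense2 by blast
  have "v z \<le> ereal M" if "z \<in> K" for z using x(2)[OF that] M by order
  then show ?thesis by (rule that)
qed (use that in auto)

definition harmonic :: "(complex \<Rightarrow> real) \<Rightarrow> bool" where
  "harmonic q \<longleftrightarrow> continuous_on UNIV q \<and> (\<forall>z x. ((\<lambda>t. q (z + cis t * x)) has_integral 2 * pi * q z) {0..2*pi})"

lemma harmonic_Re_holomorphic:
  assumes "F holomorphic_on UNIV"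
  shows "harmonic (\<lambda>w. Re (F w))"
  unfolding harmonic_def
  using has_integral_circle_Re_holomorphic[OF assms] holomorphic_on_imp_continuous_on[OF assms]
  by (auto intro!: continuous_intros)

lemma harmonic_add_const:
  assumes "harmonic q"
  shows "harmonic (\<lambda>w. q w + c)"
  unfolding harmonic_def
proof (intro conjI allI)
  show "continuous_on UNIV (\<lambda>w. q w + c)" using assms unfolding harmonic_def by (intro continuous_intros) auto
  fix z x
  have "((\<lambda>t. q (z + cis t * x)) has_integral 2 * pi * q z) {0..2*pi}" using assms by (simp add: harmonic_def)
  from has_integral_add[OF this has_integral_const_real[of c 0 "2*pi"]]
  show "((\<lambda>t. q (z + cis t * x) + c) has_integral 2 * pi * (q z + c)) {0..2*pi}" by (simp add: distrib_left)
qed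

text \<open>On small circles around \<open>w\<close>, the mean of \<open>q - \<epsilon> |\<cdot> - z|\<^sup>2\<close> falls short of its value at \<open>w\<close>.\<close>
lemma subharmonic_not_touching:
  assumes sub: "subharmonic \<phi>" and q: "harmonic q" and eps: "0 < \<epsilon>" and d: "0 < d"
    and le: "\<And>u. u \<in> cball w d \<Longrightarrow> \<phi> u \<le> ereal (q u - \<epsilon> * (cmod (u - z))\<^sup>2)"
  shows "\<phi> w \<noteq> ereal (q w - \<epsilon> * (cmod (w - z))\<^sup>2)"
proof
  let ?Q = "\<lambda>u. q u - \<epsilon> * (cmod (u - z))\<^sup>2"
  assume touch: "\<phi> w = ereal (?Q w)"
  obtain R where R: "0 < R" "\<And>s. 0 < s \<Longrightarrow> s < R \<Longrightarrow> \<phi> w \<le> circle_mean \<phi> w s"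
    using sub unfolding subharmonic_def by blast
  define s where "s = min (R / 2) d"
  have s: "0 < s" "s < R" "s \<le> d" using R(1) d by (auto simp: s_def)
  have "\<phi> w \<le> circle_mean \<phi> w s" using R s by blast
  also have "\<dots> \<le> circle_mean (\<lambda>u. ereal (?Q u)) w s"
    using s by (intro circle_mean_mono le) auto
  also have "\<dots> = ereal (?Q w - \<epsilon> * s\<^sup>2)"
  proof (rule circle_mean_continuous)
    show "continuous_on UNIV ?Q" using q by (auto simp: harmonic_def intro!: continuous_intros)
    have "((\<lambda>t. q (w + cis t * of_real s)) has_integral 2 * pi * q w) {0..2*pi}"
      using q by (simp add: harmonic_def)
    from has_integral_diff[OF this
        has_integral_mult_right[OF has_integral_circle_norm_square[of "w - z" "of_real s"], of \<epsilon>]]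
    show "((\<lambda>t. ?Q (w + cis t * of_real s)) has_integral 2 * pi * (?Q w - \<epsilon> * s\<^sup>2)) {0..2*pi}"
      by (simp add: algebra_simps)
  qed
  finally have "\<epsilon> * s\<^sup>2 \<le> 0" unfolding touch by simp
  then show False using eps s(1) by (simp add: mult_le_0_iff)
qed

lemma subharmonic_le_harmonic:
  assumes sub: "subharmonic \<phi>" and q: "harmonic q" and r: "0 < r"
    and boundary: "\<And>w. w \<in> sphere z r \<Longrightarrow> \<phi> w \<le> ereal (q w)" and w: "w \<in> cball z r"
  shows "\<phi> w \<le> ereal (q w)"
proof (rule ccontr)
  assume "\<not> ?thesis"
  then obtain p where p: "q w < p" "ereal p < \<phi> w" using ereal_dense2[of "ereal (q w)" "\<phi> w"]
    by (auto simp: not_le)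
  define \<epsilon> where "\<epsilon> = (p - q w) / r\<^sup>2"
  have eps: "0 < \<epsilon>" "\<epsilon> * r\<^sup>2 = p - q w" using p r by (simp_all add: \<epsilon>_def)
  define v where "v u = \<phi> u + ereal (\<epsilon> * (cmod (u - z))\<^sup>2 - q u)" for u
  have "usc_ereal v" unfolding v_def using sub q
    by (intro usc_ereal_add_continuous) (auto simp: subharmonic_def harmonic_def intro!: continuous_intros)
  then obtain w0 where w0: "w0 \<in> cball z r" "\<And>u. u \<in> cball z r \<Longrightarrow> v u \<le> v w0"
    using usc_ereal_attains_sup[of v "cball z r"] r by fastforce
  have "ereal (p - q w) < \<phi> w + ereal (- q w)" using p(2) by (cases "\<phi> w") auto
  also have "\<dots> \<le> v w" unfolding v_def using eps(1) by (intro add_left_mono) simp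
  also have "\<dots> \<le> v w0" using w0 w by blast
  finally have v_w0: "ereal (\<epsilon> * r\<^sup>2) < v w0" using eps by simp
  have "w0 \<notin> sphere z r"
  proof
    assume "w0 \<in> sphere z r"
    with boundary[OF this] have "v w0 \<le> ereal (q w0) + ereal (\<epsilon> * r\<^sup>2 - q w0)"
      unfolding v_def by (intro add_mono) (auto simp: dist_norm norm_minus_commute)
    then show False using v_w0 by simp
  qed
  then have d: "0 < r - dist z w0" using w0(1) by auto
  obtain m where m: "v w0 = ereal m"
    using v_w0 sub by (cases "\<phi> w0") (auto simp: v_def subharmonic_def)
  have "\<phi> w0 \<noteq> ereal ((q w0 + m) - \<epsilon> * (cmod (w0 - z))\<^sup>2)"
  proof (rule subharmonic_not_touching[OF sub harmonic_add_const[OF q] eps(1) d])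
    fix u assume "u \<in> cball w0 (r - dist z w0)"
    then have "v u \<le> ereal m"
      using w0(2)[of u] dist_triangle[of z u w0] m by (simp add: algebra_simps)
    then show "\<phi> u \<le> ereal ((q u + m) - \<epsilon> * (cmod (u - z))\<^sup>2)"
      unfolding v_def by (cases "\<phi> u") auto
  qed
  then show False using m unfolding v_def by (cases "\<phi> w0") auto
qed

section \<open>The global mean value inequality\<close>

definition circle_Re_poly :: "(complex \<Rightarrow> real) set" where
  "circle_Re_poly = {g. \<exists>s :: complex poly. \<forall>u. cmod u = 1 \<longrightarrow> g u = Re (poly s u)}"

lemma circle_Re_polyI: "(\<And>u. cmod u = 1 \<Longrightarrow> g u = Re (poly s u)) \<Longrightarrow> g \<in> circle_Re_poly"
  unfolding circle_Re_poly_def by blast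

lemma circle_Re_poly_add:
  assumes "g \<in> circle_Re_poly" "h \<in> circle_Re_poly"
  shows "(\<lambda>u. g u + h u) \<in> circle_Re_poly"
proof -
  obtain a b where "\<forall>u. cmod u = 1 \<longrightarrow> g u = Re (poly a u)" "\<forall>u. cmod u = 1 \<longrightarrow> h u = Re (poly b u)"
    using assms unfolding circle_Re_poly_def by blast
  then show ?thesis by (intro circle_Re_polyI[of _ "a + b"]) simp
qed

lemma circle_Re_poly_sum:
  assumes "finite A" "\<And>i. i \<in> A \<Longrightarrow> g i \<in> circle_Re_poly"
  shows "(\<lambda>u. \<Sum>i\<in>A. g i u) \<in> circle_Re_poly"
  using assms
proof (induction A rule: finite_induct)
  case empty
  show ?case by (rule circle_Re_polyI[of _ 0]) simp
qed (simp add: circle_Re_poly_add)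

text \<open>On the unit circle \<open>cnj u = 1 / u\<close>, so the product of two monomials is again a polynomial in \<open>u\<close>.\<close>
lemma circle_Re_poly_monom_mult:
  assumes "i \<le> j"
  shows "(\<lambda>u. Re (a * u ^ i) * Re (b * u ^ j)) \<in> circle_Re_poly"
proof (rule circle_Re_polyI)
  fix u :: complex assume u: "cmod u = 1"
  have "cnj u * u = 1" using u by (metis complex_norm_square mult.commute of_real_1 one_power2)
  then have "cnj u ^ i * u ^ i = 1" by (metis power_mult_distrib power_one)
  moreover have "u ^ j = u ^ i * u ^ (j - i)" using assms by (metis le_add_diff_inverse power_add)
  ultimately have cnj_mult: "cnj (a * u ^ i) * (b * u ^ j) = cnj a * b * u ^ (j - i)" by simp
  have "Re X * Re Y = Re ((X * Y + cnj X * Y) / 2)" for X Y by simp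
  then have "Re (a * u ^ i) * Re (b * u ^ j)
      = Re (((a * u ^ i) * (b * u ^ j) + cnj (a * u ^ i) * (b * u ^ j)) / 2)" .
  also have "((a * u ^ i) * (b * u ^ j) + cnj (a * u ^ i) * (b * u ^ j)) / 2
      = poly (monom (a * b / 2) (i + j) + monom (cnj a * b / 2) (j - i)) u"
    unfolding cnj_mult by (simp add: poly_monom power_add add_divide_distrib)
  finally show "Re (a * u ^ i) * Re (b * u ^ j)
      = Re (poly (monom (a * b / 2) (i + j) + monom (cnj a * b / 2) (j - i)) u)" .
qed

lemma circle_Re_poly_mult:
  assumes "g \<in> circle_Re_poly" "h \<in> circle_Re_poly"
  shows "(\<lambda>u. g u * h u) \<in> circle_Re_poly"
proof -
  obtain p q where p: "\<forall>u. cmod u = 1 \<longrightarrow> g u = Re (poly p u)" and q: "\<forall>u. cmod u = 1 \<longrightarrow> h u = Re (poly q u)"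
    using assms unfolding circle_Re_poly_def by blast
  have monom_mult: "(\<lambda>u. Re (a * u ^ i) * Re (b * u ^ j)) \<in> circle_Re_poly" for a b i j
    using circle_Re_poly_monom_mult[of i j a b] circle_Re_poly_monom_mult[of j i b a]
    by (cases "i \<le> j") (simp_all add: mult.commute)
  have "(\<lambda>u. \<Sum>i\<le>degree p. \<Sum>j\<le>degree q. Re (coeff p i * u ^ i) * Re (coeff q j * u ^ j)) \<in> circle_Re_poly"
    by (intro circle_Re_poly_sum monom_mult) auto
  then obtain s where "\<forall>u. cmod u = 1 \<longrightarrow>
      (\<Sum>i\<le>degree p. \<Sum>j\<le>degree q. Re (coeff p i * u ^ i) * Re (coeff q j * u ^ j)) = Re (poly s u)"
    unfolding circle_Re_poly_def by blast
  then show ?thesis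
    using p q by (intro circle_Re_polyI[of _ s]) (simp add: poly_altdef sum_product)
qed

lemma circle_Re_poly_dense:
  assumes f: "continuous_on (sphere 0 1) f" and e: "0 < e"
  obtains s :: "complex poly" where "\<And>u. cmod u = 1 \<Longrightarrow> \<bar>f u - Re (poly s u)\<bar> < e"
proof -
  have "\<exists>g. g \<in> circle_Re_poly \<and> (\<forall>u\<in>sphere 0 1. \<bar>f u - g u\<bar> < e)"
  proof (rule Stone_Weierstrass_HOL[OF _ _ _ _ _ _ f e])
    show "(\<lambda>x. c) \<in> circle_Re_poly" for c by (rule circle_Re_polyI[of _ "[:of_real c:]"]) simp
    show "continuous_on (sphere 0 1) g" if g: "g \<in> circle_Re_poly" for g
    proof -
      obtain s :: "complex poly" where s: "\<forall>u. cmod u = 1 \<longrightarrow> g u = Re (poly s u)"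
        using g unfolding circle_Re_poly_def by blast
      have "continuous_on (sphere 0 1) (\<lambda>u. Re (poly s u))" by (intro continuous_intros)
      then show ?thesis by (rule continuous_on_eq) (simp add: s)
    qed
    show "\<exists>g. g \<in> circle_Re_poly \<and> g x \<noteq> g y" if xy: "x \<in> sphere 0 1 \<and> y \<in> sphere 0 1 \<and> x \<noteq> y" for x y
    proof -
      have "Re \<in> circle_Re_poly" by (rule circle_Re_polyI[of _ "[:0, 1:]"]) simp
      moreover have "Im \<in> circle_Re_poly" by (rule circle_Re_polyI[of _ "[:0, -\<i>:]"]) simp
      ultimately show ?thesis using xy complex_eqI by blast
    qed
  qed (auto intro: circle_Re_poly_add circle_Re_poly_mult)
  then show ?thesis using that unfolding circle_Re_poly_def by force
qed

lemma circle_harmonic_approximation: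
  fixes f :: "complex \<Rightarrow> real"
  assumes f: "continuous_on (sphere z (cmod x)) f" and x: "x \<noteq> 0" and e: "0 < e"
  obtains q where "harmonic q" "\<And>w. w \<in> sphere z (cmod x) \<Longrightarrow> \<bar>f w - q w\<bar> < e"
proof -
  have "z + u * x \<in> sphere z (cmod x)" if "u \<in> sphere 0 1" for u
    using that by (simp add: dist_norm norm_mult)
  then have "continuous_on (sphere 0 1) (\<lambda>u. f (z + u * x))"
    by (intro continuous_on_compose2[OF f]) (auto intro!: continuous_intros)
  then obtain s :: "complex poly" where s: "\<And>u. cmod u = 1 \<Longrightarrow> \<bar>f (z + u * x) - Re (poly s u)\<bar> < e"
    using circle_Re_poly_dense e by blast
  show ?thesis
  proof
    show "harmonic (\<lambda>w. Re (poly s ((w - z) / x)))"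
      by (rule harmonic_Re_holomorphic) (auto intro!: holomorphic_intros x)
    fix w assume "w \<in> sphere z (cmod x)"
    then have "cmod ((w - z) / x) = 1" using x by (simp add: dist_norm norm_minus_commute norm_divide)
    from s[OF this] show "\<bar>f w - Re (poly s ((w - z) / x))\<bar> < e" using x by simp
  qed
qed

lemma subharmonic_le_continuous_circle_mean:
  assumes sub: "subharmonic \<phi>" and x: "x \<noteq> 0"
    and f: "continuous_on (sphere z (cmod x)) f" and le: "\<And>w. w \<in> sphere z (cmod x) \<Longrightarrow> \<phi> w \<le> ereal (f w)"
    and I: "((\<lambda>t. f (z + cis t * x)) has_integral 2 * pi * J) {0..2*pi}"
  shows "\<phi> z \<le> ereal J"
proof (rule ereal_le_epsilon2)
  fix e :: real assume "0 < e"
  then obtain q where q: "harmonic q" and near: "\<And>w. w \<in> sphere z (cmod x) \<Longrightarrow> \<bar>f w - q w\<bar> < e/2"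
    using circle_harmonic_approximation[OF f x, of "e/2"] by auto
  have "\<phi> z \<le> ereal (q z + e/2)"
  proof (rule subharmonic_le_harmonic[OF sub harmonic_add_const[OF q]])
    fix w assume w: "w \<in> sphere z (cmod x)"
    have "\<phi> w \<le> ereal (f w)" by (rule le[OF w])
    also have "f w \<le> q w + e/2" using near[OF w] by linarith
    finally show "\<phi> w \<le> ereal (q w + e/2)" by simp
  qed (use x in auto)
  also have "q z \<le> J + e/2"
  proof -
    have "((\<lambda>t. q (z + cis t * x)) has_integral 2 * pi * q z) {0..2*pi}"
      using q by (simp add: harmonic_def)
    moreover have "((\<lambda>t. f (z + cis t * x) + e/2) has_integral 2 * pi * (J + e/2)) {0..2*pi}"
      using has_integral_add[OF I has_integral_const_real[of "e/2" 0 "2*pi"]] by (simp add: algebra_simps)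
    moreover have "q (z + cis t * x) \<le> f (z + cis t * x) + e/2" if "t \<in> {0..2*pi}" for t
    proof -
      have "\<bar>f (z + cis t * x) - q (z + cis t * x)\<bar> < e/2"
        by (rule near) (simp add: dist_norm norm_mult)
      then show ?thesis by linarith
    qed
    ultimately have "2 * pi * q z \<le> 2 * pi * (J + e/2)" by (rule has_integral_le)
    then show ?thesis by simp
  qed
  finally show "\<phi> z \<le> ereal J + ereal e" by (simp add: add.commute)
qed

definition lipschitz_envelope :: "real \<Rightarrow> ('a::metric_space \<Rightarrow> real) \<Rightarrow> 'a \<Rightarrow> real" where
  "lipschitz_envelope K m w = (INF v. m v + K * dist w v)"

lemma lipschitz_envelope_lower:
  assumes "\<And>v. 0 \<le> m v" "0 \<le> K"
  shows "lipschitz_envelope K m w \<le> m v + K * dist w v"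
  unfolding lipschitz_envelope_def using assms by (intro cINF_lower bdd_belowI2[of _ 0]) auto

lemma lipschitz_envelope_nonneg: "(\<And>v. 0 \<le> m v) \<Longrightarrow> 0 \<le> K \<Longrightarrow> 0 \<le> lipschitz_envelope K m w"
  unfolding lipschitz_envelope_def by (intro cINF_greatest) auto

lemma lipschitz_on_lipschitz_envelope:
  fixes m :: "'a::metric_space \<Rightarrow> real"
  assumes m: "\<And>v. 0 \<le> m v" and K: "0 \<le> K"
  shows "K-lipschitz_on UNIV (lipschitz_envelope K m)"
proof -
  let ?g = "lipschitz_envelope K m"
  have le: "?g w \<le> ?g w' + K * dist w w'" for w w'
  proof -
    have "?g w - K * dist w w' \<le> ?g w'"
      unfolding lipschitz_envelope_def[of K m w']
    proof (rule cINF_greatest)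
      fix v
      have "?g w \<le> m v + K * dist w v" by (rule lipschitz_envelope_lower[OF m K])
      also have "\<dots> \<le> m v + K * (dist w w' + dist w' v)"
        using K by (intro add_left_mono mult_left_mono dist_triangle)
      finally show "?g w - K * dist w w' \<le> m v + K * dist w' v" by (simp add: algebra_simps)
    qed simp
    then show ?thesis by simp
  qed
  show ?thesis
  proof (rule lipschitz_onI)
    fix x y show "dist (?g x) (?g y) \<le> K * dist x y"
      using le[of x y] le[of y x] by (simp add: dist_real_def dist_commute abs_le_iff)
  qed (rule K)
qed

lemma lipschitz_envelope_ge:
  fixes m :: "'a::metric_space \<Rightarrow> real"
  assumes "\<And>v. 0 \<le> m v" "\<And>v. dist w v < d \<Longrightarrow> c \<le> m v" and K: "c \<le> K * d" "0 \<le> K"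
  shows "c \<le> lipschitz_envelope K m w"
  unfolding lipschitz_envelope_def
proof (rule cINF_greatest)
  fix v
  show "c \<le> m v + K * dist w v"
  proof (cases "dist w v < d")
    case True
    then show ?thesis using assms by (simp add: add_increasing2)
  next
    case False
    then have "K * d \<le> K * dist w v" using K(2) by (intro mult_left_mono) auto
    then show ?thesis using assms(1)[of v] K(1) by linarith
  qed
qed simp

lemma lipschitz_envelope_eventually_ge:
  fixes m :: "nat \<Rightarrow> 'a::metric_space \<Rightarrow> real"
  assumes m: "\<And>n v. 0 \<le> m n v" and d: "0 < d" and ge: "\<And>n v. c \<le> real n \<Longrightarrow> dist w v < d \<Longrightarrow> c \<le> m n v"
  shows "\<forall>\<^sub>F n in sequentially. c \<le> lipschitz_envelope (real n) (m n) w"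
proof -
  have "\<forall>\<^sub>F n in sequentially. max c (c / d) \<le> real n"
    using filterlim_real_sequentially unfolding filterlim_at_top by blast
  then show ?thesis
  proof eventually_elim
    case (elim n)
    then show ?case using d by (intro lipschitz_envelope_ge[OF m, of _ d]) (auto simp: divide_le_eq ge)
  qed
qed

lemma lower_semicontinuous_approximation:
  fixes \<psi> :: "'a::metric_space \<Rightarrow> ennreal"
  assumes lsc: "\<And>c. open {w. c < \<psi> w}"
  obtains g :: "nat \<Rightarrow> 'a \<Rightarrow> real" where "\<And>n. continuous_on UNIV (g n)" "\<And>n w. 0 \<le> g n w"
    "\<And>n w. ennreal (g n w) \<le> \<psi> w" "\<And>w. \<psi> w \<le> liminf (\<lambda>n. ennreal (g n w))"
proof -
  define m where "m n v = enn2real (min (of_nat n) (\<psi> v))" for n v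
  have m: "0 \<le> m n v" "ennreal (m n v) = min (of_nat n) (\<psi> v)" for n v
    unfolding m_def by (simp_all add: ennreal_enn2real_if min_def top_unique)
  let ?g = "\<lambda>n. lipschitz_envelope (real n) (m n)"
  show ?thesis
  proof
    show "continuous_on UNIV (?g n)" for n
      using m(1) by (intro lipschitz_on_continuous_on[OF lipschitz_on_lipschitz_envelope]) auto
    show "0 \<le> ?g n w" for n w
      using m(1) by (intro lipschitz_envelope_nonneg) auto
    show "ennreal (?g n w) \<le> \<psi> w" for n w
    proof -
      have "?g n w \<le> m n w + real n * dist w w" using m(1) by (rule lipschitz_envelope_lower) simp
      then have "ennreal (?g n w) \<le> ennreal (m n w)" by (intro ennreal_leI) simp
      then show ?thesis using m(2)[of n w] by simp
    qed
    show "\<psi> w \<le> liminf (\<lambda>n. ennreal (?g n w))" for w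
      unfolding le_Liminf_iff
    proof (intro allI impI)
      fix y assume "y < \<psi> w"
      then obtain c' where c': "y < c'" "c' < \<psi> w" using dense by blast
      then obtain c where c: "c' = ennreal c" "0 \<le> c" by (cases c') auto
      have "w \<in> {v. c' < \<psi> v}" using c' by simp
      with lsc obtain d where d: "0 < d" "ball w d \<subseteq> {v. c' < \<psi> v}" by (rule openE)
      have "c \<le> m n v" if "c \<le> real n" "dist w v < d" for n v
      proof -
        have "ennreal c \<le> ennreal (real n)" using that(1) by (rule ennreal_leI)
        then have "ennreal c \<le> ennreal (m n v)"
          unfolding m(2) using d(2) c(1) that(2)
          by (auto simp: subset_eq ennreal_of_nat_eq_real_of_nat less_imp_le)
        then show ?thesis using m(1)[of n v] by simp
      qed
      with m(1) d(1) have "\<forall>\<^sub>F n in sequentially. c \<le> ?g n w" by (rule lipschitz_envelope_eventually_ge)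
      then show "\<forall>\<^sub>F n in sequentially. y < ennreal (?g n w)"
        by eventually_elim (use c'(1) c(1) in \<open>auto intro: order.strict_trans2 ennreal_leI\<close>)
    qed
  qed
qed

lemma usc_ereal_open_less_e2ennreal:
  assumes "usc_ereal \<phi>"
  shows "open {w. c < e2ennreal (ereal M - \<phi> w)}"
proof (cases c)
  case (real p)
  have "c < e2ennreal (ereal M - \<phi> w) \<longleftrightarrow> \<phi> w < ereal (M - p)" for w
    using real by (cases "\<phi> w") (auto simp: ennreal_less_iff e2ennreal_neg)
  then show ?thesis using usc_ereal_open_less[OF assms] by simp
qed simp

lemma subharmonic_continuous_circle_nn_integral:
  assumes sub: "subharmonic \<phi>" and x: "x \<noteq> 0" and M: "\<And>w. w \<in> sphere z (cmod x) \<Longrightarrow> \<phi> w \<le> ereal M"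
    and g: "continuous_on UNIV g" "\<And>w. 0 \<le> g w" "\<And>w. ennreal (g w) \<le> e2ennreal (ereal M - \<phi> w)"
  shows "(\<integral>\<^sup>+t\<in>{0..2*pi}. ennreal (g (z + cis t * x)) \<partial>lborel) \<le> ennreal (2 * pi) * e2ennreal (ereal M - \<phi> z)"
proof -
  have "continuous_on {0..2*pi} (\<lambda>t. g (z + cis t * x))"
    by (rule continuous_on_compose2[OF g(1)]) (auto intro!: continuous_intros)
  then obtain I where I: "((\<lambda>t. g (z + cis t * x)) has_integral I) {0..2*pi}"
    using integrable_continuous_real by blast
  have "((\<lambda>t. M - g (z + cis t * x)) has_integral 2 * pi * (M - I / (2 * pi))) {0..2*pi}"
    using has_integral_diff[OF has_integral_const_real[of M 0 "2*pi"] I] by (simp add: algebra_simps)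
  then have "\<phi> z \<le> ereal (M - I / (2 * pi))"
  proof (rule subharmonic_le_continuous_circle_mean[OF sub x, rotated 2])
    show "continuous_on (sphere z (cmod x)) (\<lambda>w. M - g w)"
      using g(1) by (intro continuous_intros) (auto intro: continuous_on_subset)
    fix w assume "w \<in> sphere z (cmod x)"
    then have "0 \<le> ereal M - \<phi> w" using M[of w] by (simp add: ereal_diff_positive)
    then have "ereal (g w) \<le> ereal M - \<phi> w"
      using g(3)[of w] g(2)[of w] by (simp add: less_eq_ennreal.rep_eq enn2ereal_e2ennreal)
    then show "\<phi> w \<le> ereal (M - g w)" by (cases "\<phi> w") auto
  qed
  then have "ereal (I / (2 * pi)) \<le> ereal M - \<phi> z" by (cases "\<phi> z") auto
  then have "ennreal (2 * pi) * ennreal (I / (2 * pi)) \<le> ennreal (2 * pi) * e2ennreal (ereal M - \<phi> z)"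
    by (intro mult_left_mono) (auto dest: e2ennreal_mono)
  moreover have "ennreal I = ennreal (2 * pi) * ennreal (I / (2 * pi))" by (simp add: ennreal_mult'[symmetric])
  ultimately show ?thesis using set_nn_integral_has_integral[OF g(2) I] by simp
qed

lemma subharmonic_circle_nn_integral:
  assumes sub: "subharmonic \<phi>" and M: "\<And>w. w \<in> sphere z (cmod x) \<Longrightarrow> \<phi> w \<le> ereal M"
  shows "(\<integral>\<^sup>+t\<in>{0..2*pi}. e2ennreal (ereal M - \<phi> (z + cis t * x)) \<partial>lborel)
      \<le> ennreal (2 * pi) * e2ennreal (ereal M - \<phi> z)"
proof (cases "x = 0")
  case True
  then show ?thesis by (simp add: nn_integral_cmult_indicator mult.commute)
next
  case x: False
  let ?\<psi> = "\<lambda>w. e2ennreal (ereal M - \<phi> w)"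
  obtain g :: "nat \<Rightarrow> complex \<Rightarrow> real" where g: "\<And>n. continuous_on UNIV (g n)" "\<And>n w. 0 \<le> g n w"
    "\<And>n w. ennreal (g n w) \<le> ?\<psi> w" "\<And>w. ?\<psi> w \<le> liminf (\<lambda>n. ennreal (g n w))"
    using lower_semicontinuous_approximation[of ?\<psi>] usc_ereal_open_less_e2ennreal sub
    unfolding subharmonic_def by blast
  have bound: "(\<integral>\<^sup>+t\<in>{0..2*pi}. ennreal (g n (z + cis t * x)) \<partial>lborel) \<le> ennreal (2 * pi) * ?\<psi> z" for n
    by (rule subharmonic_continuous_circle_nn_integral[OF sub x M g(1,2,3)])
  have "(\<integral>\<^sup>+t\<in>{0..2*pi}. ?\<psi> (z + cis t * x) \<partial>lborel)
     \<le> (\<integral>\<^sup>+t. liminf (\<lambda>n. ennreal (g n (z + cis t * x)) * indicator {0..2*pi} t) \<partial>lborel)"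
    using g(4) by (intro nn_integral_mono) (auto simp: indicator_def)
  also have "\<dots> \<le> liminf (\<lambda>n. \<integral>\<^sup>+t\<in>{0..2*pi}. ennreal (g n (z + cis t * x)) \<partial>lborel)"
  proof (rule nn_integral_liminf)
    fix n
    note [measurable] = borel_measurable_continuous_onI[OF g(1)[of n]]
    show "(\<lambda>t. ennreal (g n (z + cis t * x)) * indicator {0..2*pi} t) \<in> borel_measurable lborel" by measurable
  qed
  also have "\<dots> \<le> liminf (\<lambda>n. ennreal (2 * pi) * ?\<psi> z)"
    by (rule Liminf_mono) (use bound in auto)
  also have "\<dots> = ennreal (2 * pi) * ?\<psi> z" by (simp add: Liminf_const)
  finally show ?thesis .
qed

lemma subharmonic_borel: "subharmonic \<phi> \<Longrightarrow> \<phi> \<in> borel_measurable borel"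
  using usc_ereal_borel by (auto simp: subharmonic_def)

lemma subharmonic_nn_integral_ball_le:
  assumes sub: "subharmonic \<phi>" and M: "\<And>w. w \<in> ball z R \<Longrightarrow> \<phi> w \<le> ereal M" and R: "0 < R"
  shows "(\<integral>\<^sup>+w\<in>ball z R. e2ennreal (ereal M - \<phi> w) \<partial>lborel) \<le> ennreal (pi * R\<^sup>2) * e2ennreal (ereal M - \<phi> z)"
proof -
  note [measurable] = subharmonic_borel[OF sub]
  define F where "F w = e2ennreal (ereal M - \<phi> w) * indicator (ball z R) w" for w
  have [measurable]: "F \<in> borel_measurable borel" unfolding F_def by measurable
  have "ennreal (2 * pi) * (\<integral>\<^sup>+w. F w \<partial>lborel) = ennreal (2 * pi) * (\<integral>\<^sup>+x. F (z + x) \<partial>lborel)"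
    by (simp add: nn_integral_lborel_translation)
  also have "\<dots> = (\<integral>\<^sup>+x. (\<integral>\<^sup>+t\<in>{0..2*pi}. F (z + cis t * x) \<partial>lborel) \<partial>lborel)"
    by (rule nn_integral_circle_average[symmetric]) measurable
  also have "\<dots> \<le> (\<integral>\<^sup>+x. ennreal (2 * pi) * e2ennreal (ereal M - \<phi> z)
      * indicator (ball (0::complex) R) x \<partial>lborel)"
  proof (rule nn_integral_mono)
    fix x :: complex
    show "(\<integral>\<^sup>+t\<in>{0..2*pi}. F (z + cis t * x) \<partial>lborel)
        \<le> ennreal (2 * pi) * e2ennreal (ereal M - \<phi> z) * indicator (ball 0 R) x"
    proof (cases "cmod x < R")
      case True
      have "(\<integral>\<^sup>+t\<in>{0..2*pi}. F (z + cis t * x) \<partial>lborel)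
          = (\<integral>\<^sup>+t\<in>{0..2*pi}. e2ennreal (ereal M - \<phi> (z + cis t * x)) \<partial>lborel)"
        using True unfolding F_def by (intro nn_integral_cong) (simp add: dist_norm norm_mult)
      also have "\<dots> \<le> ennreal (2 * pi) * e2ennreal (ereal M - \<phi> z)"
        by (rule subharmonic_circle_nn_integral[OF sub]) (use M True in auto)
      finally show ?thesis using True by simp
    qed (simp add: F_def dist_norm norm_mult)
  qed
  also have "\<dots> = ennreal (2 * pi) * e2ennreal (ereal M - \<phi> z) * ennreal (pi * R\<^sup>2)"
    using R by (simp add: nn_integral_cmult_indicator emeasure_ball unit_ball_vol_2)
  finally have "ennreal (2 * pi) * (\<integral>\<^sup>+w. F w \<partial>lborel)
      \<le> ennreal (2 * pi) * (ennreal (pi * R\<^sup>2) * e2ennreal (ereal M - \<phi> z))"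
    by (simp add: ac_simps)
  then show ?thesis unfolding F_def by (subst (asm) ennreal_mult_le_mult_iff) auto
qed

section \<open>Convolution with compactly supported kernels\<close>

definition conv :: "('a::euclidean_space \<Rightarrow> real) \<Rightarrow> ('a \<Rightarrow> real) \<Rightarrow> 'a \<Rightarrow> real" where
  "conv k f w = (\<integral>z. k z * f (w - z) \<partial>lborel)"

definition kernel :: "real \<Rightarrow> ('a::euclidean_space \<Rightarrow> real) \<Rightarrow> bool" where
  "kernel R k \<longleftrightarrow> integrable lborel k \<and> (\<forall>z. 0 \<le> k z) \<and> (\<forall>z. R < norm z \<longrightarrow> k z = 0)"

definition locally_integrable :: "('a::euclidean_space \<Rightarrow> real) \<Rightarrow> bool" where
  "locally_integrable f \<longleftrightarrow> f \<in> borel_measurable borel \<and> (\<forall>R. set_integrable lborel (cball 0 R) f)"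

lemma kernelD:
  assumes "kernel R k"
  shows "integrable lborel k" "k \<in> borel_measurable borel" "0 \<le> k z" "R < norm z \<Longrightarrow> k z = 0"
  using assms by (auto simp: kernel_def)

lemma kernel_locally_integrable:
  assumes "kernel R k"
  shows "locally_integrable k"
  unfolding locally_integrable_def set_integrable_def
  using kernelD(2)[OF assms] integrable_mult_indicator[OF _ kernelD(1)[OF assms]] by auto

lemma kernel_linear:
  assumes "kernel R k" "kernel S l" "0 \<le> a" "0 \<le> b"
  shows "kernel (max R S) (\<lambda>z. a * k z + b * l z)"
  using assms by (auto simp: kernel_def)

lemma continuous_bounded_cball:
  fixes f :: "'a::euclidean_space \<Rightarrow> real"
  assumes "continuous_on UNIV f"
  obtains B where "0 \<le> B" "\<And>z. z \<in> cball w R \<Longrightarrow> \<bar>f z\<bar> \<le> B"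
proof -
  have "bounded (f ` cball w R)"
    by (intro compact_imp_bounded compact_continuous_image continuous_on_subset[OF assms]) auto
  then obtain B where "0 < B" "\<And>z. z \<in> cball w R \<Longrightarrow> \<bar>f z\<bar> \<le> B"
    unfolding bounded_pos by auto
  then show ?thesis using that[of B] by simp
qed

lemma conv_const: "conv k (\<lambda>_. c) w = c * (\<integral>z. k z \<partial>lborel)"
  unfolding conv_def by simp

lemma conv_commute:
  assumes [measurable]: "k \<in> borel_measurable borel" "l \<in> borel_measurable borel"
  shows "conv k l w = conv l k w"
  using integral_lborel_reflection[of "\<lambda>z. l z * k (w - z)" w] by (simp add: conv_def mult.commute)

lemma integrable_kernel_mult_continuous:
  assumes k: "kernel R k" and f: "continuous_on UNIV f"
  shows "integrable lborel (\<lambda>z. k z * f (w - z))"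
proof -
  note [measurable] = kernelD(2)[OF k] borel_measurable_continuous_onI[OF f]
  obtain B where B: "0 \<le> B" "\<And>z. z \<in> cball w R \<Longrightarrow> \<bar>f z\<bar> \<le> B" using continuous_bounded_cball[OF f] by blast
  have "norm (k z * f (w - z)) \<le> norm (k z * B)" for z
    using B(1) B(2)[of "w - z"] kernelD(3,4)[OF k, of z]
    by (cases "norm z \<le> R") (auto simp: abs_mult dist_norm intro!: mult_left_mono)
  then show ?thesis
    by (intro Bochner_Integration.integrable_bound[OF integrable_mult_left[OF kernelD(1)[OF k], of B]]) auto
qed

lemma integrable_bounded_kernel_mult:
  assumes k: "kernel R k" and C: "\<And>z. k z \<le> C" and f: "locally_integrable f"
  shows "integrable lborel (\<lambda>z. k z * f (w - z))"
proof -
  note [measurable] = kernelD(2)[OF k]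
  have [measurable]: "f \<in> borel_measurable borel" using f by (simp add: locally_integrable_def)
  have "integrable lborel (\<lambda>z. C * (indicator (cball 0 (norm w + R)) (w - z) * f (w - z)))"
    using f
    by (subst integrable_lborel_reflection_iff[of "\<lambda>z. C * (indicator (cball 0 (norm w + R)) z * f z)" w])
      (measurable, auto simp: locally_integrable_def set_integrable_def)
  then show ?thesis
  proof (rule Bochner_Integration.integrable_bound)
    have "norm (k z * f (w - z)) \<le> norm (C * (indicator (cball 0 (norm w + R)) (w - z) * f (w - z)))" for z
    proof (cases "norm z \<le> R")
      case True
      then have "w - z \<in> cball 0 (norm w + R)" using norm_triangle_ineq4[of w z] by simp
      then show ?thesis using C[of z] kernelD(3)[OF k, of z] by (simp add: abs_mult mult_right_mono)
    qed (use kernelD(4)[OF k, of z] in auto)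
    then show "AE z in lborel. norm (k z * f (w - z))
        \<le> norm (C * (indicator (cball 0 (norm w + R)) (w - z) * f (w - z)))"
      by simp
  qed measurable
qed

lemma conv_diff:
  assumes "kernel R k" "continuous_on UNIV f" "continuous_on UNIV g"
  shows "conv k (\<lambda>w. f w - g w) w = conv k f w - conv k g w"
  unfolding conv_def right_diff_distrib
  by (rule Bochner_Integration.integral_diff) (use assms integrable_kernel_mult_continuous in auto)

lemma conv_ge:
  assumes k: "kernel R k" "(\<integral>z. k z \<partial>lborel) = 1" and f: "continuous_on UNIV f"
    and le: "\<And>z. z \<in> cball w R \<Longrightarrow> a \<le> f z"
  shows "a \<le> conv k f w"
proof -
  have "conv k (\<lambda>_. a) w \<le> conv k f w"
    unfolding conv_def
  proof (rule integral_mono)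
    fix z
    show "k z * a \<le> k z * f (w - z)"
      using le[of "w - z"] kernelD(3,4)[OF k(1), of z]
      by (cases "norm z \<le> R") (auto simp: dist_norm intro!: mult_left_mono)
  qed (use integrable_kernel_mult_continuous[OF k(1) f] kernelD(1)[OF k(1)] in auto)
  then show ?thesis using k(2) by (simp add: conv_const)
qed

lemma conv_le:
  assumes "kernel R k" "(\<integral>z. k z \<partial>lborel) = 1" "continuous_on UNIV f"
    and "\<And>z. z \<in> cball w R \<Longrightarrow> f z \<le> a"
  shows "conv k f w \<le> a"
  using conv_ge[of R k "\<lambda>z. - f z" w "- a"] assms by (auto simp: conv_def intro: continuous_intros)

lemma conv_kernel_linear:
  assumes "kernel R k" "kernel S l" "continuous_on UNIV f"
  shows "conv (\<lambda>z. a * k z + b * l z) f w = a * conv k f w + b * conv l f w"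
proof -
  have "conv (\<lambda>z. a * k z + b * l z) f w = (\<integral>z. a * (k z * f (w - z)) + b * (l z * f (w - z)) \<partial>lborel)"
    by (simp add: conv_def algebra_simps)
  also have "\<dots> = a * conv k f w + b * conv l f w"
    unfolding conv_def using assms integrable_kernel_mult_continuous
    by (subst Bochner_Integration.integral_add) auto
  finally show ?thesis .
qed

lemma conv_kernel_mono:
  assumes "kernel R k" "kernel S l" "continuous_on UNIV f"
    and "AE z in lborel. k z \<le> l z" "\<And>z. 0 \<le> f z"
  shows "conv k f w \<le> conv l f w"
  unfolding conv_def
proof (rule integral_mono_AE)
  show "AE z in lborel. k z * f (w - z) \<le> l z * f (w - z)"
    using assms(4) by eventually_elim (intro mult_right_mono assms(5))
qed (use assms integrable_kernel_mult_continuous in auto)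

lemma integrable_pair_kernels:
  assumes k: "kernel R k" and l: "kernel S l"
  shows "integrable (lborel \<Otimes>\<^sub>M lborel) (\<lambda>(x, z). k x * l (z - x))"
proof (rule lborel_pair.Fubini_integrable)
  note [measurable] = kernelD(2)[OF k] kernelD(2)[OF l]
  show "(\<lambda>(x, z). k x * l (z - x)) \<in> borel_measurable (lborel \<Otimes>\<^sub>M lborel)" by measurable
  have "(\<integral>z. norm (k x * l (z - x)) \<partial>lborel) = k x * (\<integral>z. l z \<partial>lborel)" for x
    using kernelD(3)[OF k, of x] kernelD(3)[OF l] integral_lborel_translation[of l "- x"] by simp
  then show "integrable lborel (\<lambda>x. \<integral>z. norm (case (x, z) of (x, z) \<Rightarrow> k x * l (z - x)) \<partial>lborel)"
    using kernelD(1)[OF k] by simp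
  show "AE x in lborel. integrable lborel (\<lambda>z. case (x, z) of (x, z) \<Rightarrow> k x * l (z - x))"
    using kernelD(1)[OF l] integrable_lborel_translation_iff[of l "- x" for x] by simp
qed

lemma kernel_conv:
  assumes k: "kernel R k" and l: "kernel S l"
  shows "kernel (R + S) (conv k l)"
  unfolding kernel_def
proof (intro conjI allI impI)
  show "integrable lborel (conv k l)"
    using lborel_pair.integrable_snd[OF integrable_pair_kernels[OF k l]] by (simp add: conv_def[abs_def])
  show "0 \<le> conv k l z" for z
    unfolding conv_def using kernelD(3)[OF k] kernelD(3)[OF l] by (intro integral_nonneg_AE) auto
  fix w :: 'a assume w: "R + S < norm w"
  have "k z * l (w - z) = 0" for z
  proof -
    have "R < norm z \<or> S < norm (w - z)"
      using w norm_triangle_ineq[of z "w - z"] by force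
    then show ?thesis using kernelD(4)[OF k] kernelD(4)[OF l] by auto
  qed
  then show "conv k l w = 0" by (simp only: conv_def) simp
qed

lemma conv_assoc:
  assumes int: "integrable (lborel \<Otimes>\<^sub>M lborel) (\<lambda>(x, z). k x * l (z - x) * f (w - z))"
    and [measurable]: "l \<in> borel_measurable borel" "f \<in> borel_measurable borel"
  shows "conv k (conv l f) w = conv (conv k l) f w"
proof -
  have shift: "conv l f (w - x) = (\<integral>z. l (z - x) * f (w - z) \<partial>lborel)" for x
    using integral_lborel_translation[of "\<lambda>z. l z * f (w - x - z)" "- x"]
    by (simp add: conv_def algebra_simps)
  have "conv k (conv l f) w = (\<integral>x. \<integral>z. k x * l (z - x) * f (w - z) \<partial>lborel \<partial>lborel)"
    unfolding conv_def[of k] shift by (simp add: mult.assoc)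
  also have "\<dots> = (\<integral>z. \<integral>x. k x * l (z - x) * f (w - z) \<partial>lborel \<partial>lborel)"
    by (rule lborel_pair.Fubini_integral[symmetric]) (rule int)
  also have "\<dots> = conv (conv k l) f w" by (simp add: conv_def)
  finally show ?thesis .
qed

lemma conv_assoc_continuous:
  assumes k: "kernel R k" and l: "kernel S l" and f: "continuous_on UNIV f"
  shows "conv k (conv l f) w = conv (conv k l) f w"
proof (rule conv_assoc)
  note [measurable] = kernelD(2)[OF k] kernelD(2)[OF l] borel_measurable_continuous_onI[OF f]
  obtain B where B: "0 \<le> B" "\<And>z. z \<in> cball w (R + S) \<Longrightarrow> \<bar>f z\<bar> \<le> B" using continuous_bounded_cball[OF f] by blast
  show "integrable (lborel \<Otimes>\<^sub>M lborel) (\<lambda>(x, z). k x * l (z - x) * f (w - z))"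
  proof (rule Bochner_Integration.integrable_bound[OF
      integrable_mult_left[OF integrable_pair_kernels[OF k l], of B]])
    have "\<bar>k x * l (z - x) * f (w - z)\<bar> \<le> \<bar>k x * l (z - x) * B\<bar>" for x z
    proof (cases "norm x \<le> R \<and> norm (z - x) \<le> S")
      case True
      then have "norm z \<le> R + S" using norm_triangle_ineq[of x "z - x"] by simp
      then have "\<bar>f (w - z)\<bar> \<le> \<bar>B\<bar>" using B by (simp add: dist_norm)
      then show ?thesis by (simp add: abs_mult mult_left_mono)
    qed (use kernelD(4)[OF k] kernelD(4)[OF l] in auto)
    then show "AE p in lborel \<Otimes>\<^sub>M lborel. norm (case p of (x, z) \<Rightarrow> k x * l (z - x) * f (w - z))
        \<le> norm ((case p of (x, z) \<Rightarrow> k x * l (z - x)) * B)"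
      by (auto intro!: AE_I2)
  qed measurable
qed (use kernelD(2)[OF l] borel_measurable_continuous_onI[OF f] in auto)

lemma conv_assoc_bounded:
  assumes k: "kernel R k" and l: "kernel S l" "\<And>z. l z \<le> C" and f: "locally_integrable f"
  shows "conv k (conv l f) w = conv (conv k l) f w"
proof (rule conv_assoc)
  note [measurable] = kernelD(2)[OF k] kernelD(2)[OF l(1)]
  have [measurable]: "f \<in> borel_measurable borel" using f by (simp add: locally_integrable_def)
  have f_abs: "locally_integrable (\<lambda>z. \<bar>f z\<bar>)"
    using f by (auto simp: locally_integrable_def intro: set_integrable_abs)
  let ?b = "\<lambda>z. C * indicator (cball 0 (R + S)) z :: real"
  have "0 \<le> C" using kernelD(3)[OF l(1)] l(2) order_trans by blast
  have "kernel (R + S) ?b"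
    unfolding kernel_def using \<open>0 \<le> C\<close>
    by (auto intro!: integrable_mult_right integrable_real_indicator emeasure_lborel_cball_finite)
  then have bf: "integrable lborel (\<lambda>z. ?b z * \<bar>f (w - z)\<bar>)"
    by (rule integrable_bounded_kernel_mult[OF _ _ f_abs, of _ _ C]) (simp add: indicator_def \<open>0 \<le> C\<close>)
  show "integrable (lborel \<Otimes>\<^sub>M lborel) (\<lambda>(x, z). k x * l (z - x) * f (w - z))"
  proof (rule Bochner_Integration.integrable_bound)
    show "integrable (lborel \<Otimes>\<^sub>M lborel) (\<lambda>(x, z). k x * (?b z * \<bar>f (w - z)\<bar>))"
      using bf kernelD(1)[OF k] by (intro lborel_pair.Fubini_integrable) (auto simp: abs_mult)
    have "\<bar>k x * l (z - x) * f (w - z)\<bar> \<le> \<bar>k x * (?b z * \<bar>f (w - z)\<bar>)\<bar>" for x z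
    proof (cases "norm x \<le> R \<and> norm (z - x) \<le> S")
      case True
      then have "norm z \<le> R + S" using norm_triangle_ineq[of x "z - x"] by simp
      moreover have "\<bar>l (z - x)\<bar> \<le> C" using kernelD(3)[OF l(1)] l(2) by simp
      ultimately show ?thesis using \<open>0 \<le> C\<close> by (simp add: abs_mult mult.assoc mult_left_mono mult_right_mono)
    qed (use kernelD(4)[OF k] kernelD(4)[OF l(1)] in auto)
    then show "AE p in lborel \<Otimes>\<^sub>M lborel. norm (case p of (x, z) \<Rightarrow> k x * l (z - x) * f (w - z))
        \<le> norm (case p of (x, z) \<Rightarrow> k x * (?b z * \<bar>f (w - z)\<bar>))"
      by (auto intro!: AE_I2)
  qed measurable
qed (use kernelD(2)[OF l(1)] f in \<open>auto simp: locally_integrable_def\<close>)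

lemma conv_left_commute_continuous:
  assumes "kernel R k" "kernel S l" "continuous_on UNIV f"
  shows "conv k (conv l f) w = conv l (conv k f) w"
proof -
  have "conv k l = conv l k" using assms kernelD(2) by (intro ext conv_commute) blast+
  then show ?thesis using assms by (simp add: conv_assoc_continuous)
qed

lemma conv_left_commute_bounded:
  assumes "kernel R k" "\<And>z. k z \<le> C" "kernel S l" "\<And>z. l z \<le> D" "locally_integrable f"
  shows "conv k (conv l f) w = conv l (conv k f) w"
proof -
  have "conv k l = conv l k" using assms kernelD(2) by (intro ext conv_commute) blast+
  then show ?thesis using assms by (simp add: conv_assoc_bounded[where C=C] conv_assoc_bounded[where C=D])
qed

lemma conv_continuous:
  assumes k: "kernel R k" and f: "continuous_on UNIV f"
  shows "continuous_on UNIV (conv k f)"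
proof (rule continuous_at_imp_continuous_on, intro ballI)
  fix w :: 'a
  note [measurable] = kernelD(2)[OF k] borel_measurable_continuous_onI[OF f]
  show "isCont (conv k f) w"
    unfolding continuous_at_sequentially o_def
  proof (intro allI impI)
    fix u assume u: "u \<longlonglongrightarrow> w"
    then obtain K where K: "\<And>n. norm (u n) \<le> K"
      using convergent_imp_Bseq[of u] by (metis Bseq_def convergent_def)
    obtain B where B: "0 \<le> B" "\<And>z. z \<in> cball 0 (K + R) \<Longrightarrow> \<bar>f z\<bar> \<le> B"
      using continuous_bounded_cball[OF f] by blast
    show "(\<lambda>n. conv k f (u n)) \<longlonglongrightarrow> conv k f w"
      unfolding conv_def
    proof (rule integral_dominated_convergence[where w="\<lambda>z. k z * B"])
      show "integrable lborel (\<lambda>z. k z * B)" using kernelD(1)[OF k] by simp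
      have "(\<lambda>n. k z * f (u n - z)) \<longlonglongrightarrow> k z * f (w - z)" for z
        using f by (intro tendsto_intros u continuous_on_tendsto_compose[OF f]) auto
      then show "AE z in lborel. (\<lambda>n. k z * f (u n - z)) \<longlonglongrightarrow> k z * f (w - z)" by simp
      have "norm (k z * f (u n - z)) \<le> k z * B" for n z
      proof (cases "norm z \<le> R")
        case True
        have "norm (u n - z) \<le> K + R" using norm_triangle_ineq4[of "u n" z] K[of n] True by linarith
        then have "\<bar>f (u n - z)\<bar> \<le> B" using B(2) by simp
        then show ?thesis using kernelD(3)[OF k, of z] by (simp add: abs_mult mult_left_mono)
      qed (use kernelD(4)[OF k, of z] in auto)
      then show "AE z in lborel. norm (k z * f (u n - z)) \<le> k z * B" for n by simp
    qed measurable
  qed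
qed

lemma conv_bounded_continuous:
  assumes k: "kernel R k" "\<And>z. k z \<le> C" "AE z in lborel. isCont k z" and f: "locally_integrable f"
  shows "continuous_on UNIV (conv k f)"
proof (rule continuous_at_imp_continuous_on, intro ballI)
  fix w :: 'a
  note [measurable] = kernelD(2)[OF k(1)]
  have [measurable]: "f \<in> borel_measurable borel" using f by (simp add: locally_integrable_def)
  have eq: "conv k f v = (\<integral>z. k (v - z) * f z \<partial>lborel)" for v
    unfolding conv_commute[OF kernelD(2)[OF k(1)] \<open>f \<in> borel_measurable borel\<close>]
    by (simp add: conv_def mult.commute)
  show "isCont (conv k f) w"
    unfolding continuous_at_sequentially o_def
  proof (intro allI impI)
    fix u assume u: "u \<longlonglongrightarrow> w"
    then obtain K where K: "\<And>n. norm (u n) \<le> K"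
      using convergent_imp_Bseq[of u] by (metis Bseq_def convergent_def)
    show "(\<lambda>n. conv k f (u n)) \<longlonglongrightarrow> conv k f w"
      unfolding eq
    proof (rule integral_dominated_convergence[where w="\<lambda>z. C * \<bar>indicator (cball 0 (K + R)) z * f z\<bar>"])
      show "integrable lborel (\<lambda>z. C * \<bar>indicator (cball 0 (K + R)) z * f z\<bar>)"
        using f
        by (intro integrable_mult_right integrable_abs) (auto simp: locally_integrable_def set_integrable_def)
      show "AE z in lborel. (\<lambda>n. k (u n - z) * f z) \<longlonglongrightarrow> k (w - z) * f z"
        using AE_lborel_reflection[OF k(3), of w]
        by eventually_elim (intro tendsto_intros isCont_tendsto_compose[of _ k] u)
      have "norm (k (u n - z) * f z) \<le> C * \<bar>indicator (cball 0 (K + R)) z * f z\<bar>" for n z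
      proof (cases "norm (u n - z) \<le> R")
        case True
        have "norm z \<le> K + R" using norm_triangle_ineq4[of "u n" "u n - z"] K[of n] True by simp
        then show ?thesis using k(2) kernelD(3)[OF k(1)] by (simp add: abs_mult mult_right_mono)
      next
        case False
        have "0 \<le> C" using kernelD(3)[OF k(1)] k(2) order_trans by blast
        then show ?thesis using False kernelD(4)[OF k(1)] by simp
      qed
      then show "AE z in lborel. norm (k (u n - z) * f z) \<le> C * \<bar>indicator (cball 0 (K + R)) z * f z\<bar>" for n
        by simp
    qed measurable
  qed
qed

section \<open>Disc means and the logarithmic kernel\<close>

definition disc_kernel :: "real \<Rightarrow> complex \<Rightarrow> real" where
  "disc_kernel r z = indicator (ball 0 r) z / (pi * r\<^sup>2)"

abbreviation disc_mean :: "real \<Rightarrow> (complex \<Rightarrow> real) \<Rightarrow> complex \<Rightarrow> real" where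
  "disc_mean r \<equiv> conv (disc_kernel r)"

definition pos_log_mean :: "real \<Rightarrow> real" where
  "pos_log_mean t = (\<integral>x. disc_kernel 1 x * max 0 (t + ln (cmod x)) \<partial>lborel)"

text \<open>Since \<open>x / 0 = 0\<close> and \<open>ln 0 = 0\<close>, the value at \<open>0\<close> is \<open>0\<close> instead of \<open>\<infinity>\<close>.\<close>
definition green_kernel :: "real \<Rightarrow> complex \<Rightarrow> real" where
  "green_kernel r z = pos_log_mean (ln (r / cmod z))"

lemma disc_kernel_borel [measurable]: "disc_kernel r \<in> borel_measurable borel"
  unfolding disc_kernel_def[abs_def] by measurable

lemma disc_kernel_nonneg: "0 \<le> disc_kernel r z"
  by (simp add: disc_kernel_def)

lemma disc_kernel_le: "disc_kernel r z \<le> 1 / (pi * r\<^sup>2)"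
  by (simp add: disc_kernel_def indicator_def)

lemma measure_ball_complex: "0 \<le> r \<Longrightarrow> measure lborel (ball (c::complex) r) = pi * r\<^sup>2"
  by (simp add: content_ball unit_ball_vol_2)

lemma kernel_indicator_ball: "kernel r (indicator (ball 0 r) :: complex \<Rightarrow> real)"
  unfolding kernel_def by (auto intro: integrable_indicator_ball)

lemma kernel_disc: "kernel r (disc_kernel r)"
  using kernel_linear[OF kernel_indicator_ball[of r] kernel_indicator_ball[of r], of "1 / (pi * r\<^sup>2)" 0]
  by (simp add: disc_kernel_def[abs_def])

lemma disc_kernel_integral: "0 < r \<Longrightarrow> (\<integral>z. disc_kernel r z \<partial>lborel) = 1"
  unfolding disc_kernel_def[abs_def] using measure_ball_complex[of r 0] by simp

lemma AE_isCont_disc_kernel: "AE z in lborel. isCont (disc_kernel r) z"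
  using AE_lborel_norm_neq[of r]
proof eventually_elim
  case (elim z)
  then consider "cmod z < r" | "r < cmod z" by linarith
  then have "\<forall>\<^sub>F v in nhds z. disc_kernel r v = disc_kernel r z"
  proof cases
    case 1
    then have "\<forall>\<^sub>F v in nhds z. v \<in> ball 0 r" by (intro eventually_nhds_in_open) auto
    then show ?thesis by (rule eventually_mono) (use 1 in \<open>simp add: disc_kernel_def\<close>)
  next
    case 2
    then have "\<forall>\<^sub>F v in nhds z. v \<in> - cball 0 r" by (intro eventually_nhds_in_open) auto
    then show ?thesis by (rule eventually_mono) (use 2 in \<open>simp add: disc_kernel_def\<close>)
  qed
  then show ?case by (subst isCont_cong) auto
qed

lemma disc_mean_continuous:
  assumes "locally_integrable f"
  shows "continuous_on UNIV (disc_mean r f)"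
  by (rule conv_bounded_continuous[OF kernel_disc disc_kernel_le AE_isCont_disc_kernel assms])

lemma disc_mean_commute:
  assumes "locally_integrable f"
  shows "disc_mean r (disc_mean s f) w = disc_mean s (disc_mean r f) w"
  by (rule conv_left_commute_bounded[OF kernel_disc disc_kernel_le kernel_disc disc_kernel_le assms])

lemma integral_disc_kernel_scale:
  assumes "0 < r" and [measurable]: "F \<in> borel_measurable borel"
  shows "(\<integral>x. disc_kernel r x * F x \<partial>lborel) = (\<integral>x. disc_kernel 1 x * F (of_real r * x) \<partial>lborel)"
proof -
  have "(\<integral>x. disc_kernel r x * F x \<partial>lborel) = r\<^sup>2 * (\<integral>x. disc_kernel r (r *\<^sub>R x) * F (r *\<^sub>R x) \<partial>lborel)"
    using integral_lborel_scaleR[of "\<lambda>x. disc_kernel r x * F x" r] assms by simp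
  also have "\<dots> = (\<integral>x. r\<^sup>2 * (disc_kernel r (r *\<^sub>R x) * F (r *\<^sub>R x)) \<partial>lborel)" by simp
  also have "\<dots> = (\<integral>x. disc_kernel 1 x * F (of_real r * x) \<partial>lborel)"
    using assms(1)
    by (intro Bochner_Integration.integral_cong)
      (auto simp: disc_kernel_def indicator_def scaleR_conv_of_real norm_mult)
  finally show ?thesis .
qed

lemma pos_log_integrand_le: "disc_kernel 1 x * max 0 (t + ln (cmod x)) \<le> disc_kernel 1 x * max 0 t"
proof (cases "cmod x < 1")
  case True
  then have "ln (cmod x) \<le> 0" by (cases "x = 0") auto
  then show ?thesis by (intro mult_left_mono disc_kernel_nonneg) auto
qed (simp add: disc_kernel_def)

lemma pos_log_integrable: "integrable lborel (\<lambda>x. disc_kernel 1 x * max 0 (t + ln (cmod x)))"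
proof (rule Bochner_Integration.integrable_bound)
  show "integrable lborel (\<lambda>x. disc_kernel 1 x * max 0 t)" using kernelD(1)[OF kernel_disc] by simp
  show "AE x in lborel. norm (disc_kernel 1 x * max 0 (t + ln (cmod x))) \<le> norm (disc_kernel 1 x * max 0 t)"
    using pos_log_integrand_le[of _ t] disc_kernel_nonneg by (auto intro!: AE_I2 simp: abs_mult)
qed measurable

lemma pos_log_mean_nonneg: "0 \<le> pos_log_mean t"
  unfolding pos_log_mean_def by (intro integral_nonneg_AE) (auto simp: disc_kernel_nonneg)

lemma pos_log_mean_le: "pos_log_mean t \<le> max 0 t"
proof -
  have "pos_log_mean t \<le> (\<integral>x. disc_kernel 1 x * max 0 t \<partial>lborel)"
    unfolding pos_log_mean_def
    by (intro integral_mono pos_log_integrable pos_log_integrand_le) (use kernelD(1)[OF kernel_disc] in simp)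
  then show ?thesis using disc_kernel_integral[of 1] by simp
qed

lemma pos_log_mean_mono: "mono pos_log_mean"
  unfolding pos_log_mean_def[abs_def]
  by (intro monoI integral_mono pos_log_integrable mult_left_mono disc_kernel_nonneg) auto

lemma pos_log_mean_convex: "convex_on UNIV pos_log_mean"
proof (rule convex_onI)
  fix t x y :: real assume t: "0 < t" "t < 1"
  let ?F = "\<lambda>s u. disc_kernel 1 u * max 0 (s + ln (cmod u))"
  have "pos_log_mean ((1 - t) * x + t * y) \<le> (\<integral>u. (1 - t) * ?F x u + t * ?F y u \<partial>lborel)"
    unfolding pos_log_mean_def
  proof (rule integral_mono)
    fix u
    have "max 0 ((1 - t) * x + t * y + c) \<le> (1 - t) * max 0 (x + c) + t * max 0 (y + c)" for c
    proof -
      have "(1 - t) * x + t * y + c = (1 - t) * (x + c) + t * (y + c)" by (simp add: algebra_simps)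
      also have "\<dots> \<le> (1 - t) * max 0 (x + c) + t * max 0 (y + c)"
        using t by (intro add_mono mult_left_mono) auto
      finally show ?thesis using t by simp
    qed
    from mult_left_mono[OF this[of "ln (cmod u)"] disc_kernel_nonneg[of 1 u]]
    show "?F ((1 - t) * x + t * y) u \<le> (1 - t) * ?F x u + t * ?F y u"
      by (simp add: distrib_left mult.left_commute)
  qed (intro pos_log_integrable Bochner_Integration.integrable_add integrable_mult_right)+
  also have "\<dots> = (1 - t) * pos_log_mean x + t * pos_log_mean y"
    unfolding pos_log_mean_def
    by (subst Bochner_Integration.integral_add) (auto intro!: integrable_mult_right pos_log_integrable)
  finally show "pos_log_mean ((1 - t) *\<^sub>R x + t *\<^sub>R y) \<le> (1 - t) * pos_log_mean x + t * pos_log_mean y"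
    by simp
qed simp

text \<open>The part of the unit disc outside the disc of radius \<open>exp (- t)\<close> already gives this increment.\<close>
lemma pos_log_mean_increment:
  assumes a: "0 \<le> a" and t: "0 \<le> t"
  shows "a * (1 - exp (- 2 * t)) \<le> pos_log_mean (t + a) - pos_log_mean t"
proof -
  let ?F = "\<lambda>s x. disc_kernel 1 x * max 0 (s + ln (cmod x))"
  let ?h = "\<lambda>x::complex. a * (disc_kernel 1 x - indicator (ball 0 (exp (- t))) x / pi)"
  have h_integrable: "integrable lborel ?h"
    using kernelD(1)[OF kernel_disc] kernelD(1)[OF kernel_indicator_ball]
    by (intro integrable_mult_right Bochner_Integration.integrable_diff integrable_divide)
  have integral_h: "(\<integral>x. ?h x \<partial>lborel) = a * (1 - exp (- 2 * t))"
    using disc_kernel_integral[of 1] measure_ball_complex[of "exp (- t)" 0]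
    by (simp add: kernelD(1)[OF kernel_disc] kernelD(1)[OF kernel_indicator_ball]
        power2_eq_square flip: exp_add)
  have "a * (1 - exp (- 2 * t)) \<le> (\<integral>x. ?F (t + a) x - ?F t x \<partial>lborel)"
    unfolding integral_h[symmetric]
  proof (rule integral_mono[OF h_integrable])
    fix x :: complex
    show "?h x \<le> ?F (t + a) x - ?F t x"
    proof (cases "cmod x < exp (- t)")
      case True
      moreover have "exp (- t) \<le> 1" using t by simp
      ultimately have "?h x = 0" by (simp add: disc_kernel_def order.strict_trans2)
      moreover have "?F t x \<le> ?F (t + a) x" using a by (intro mult_left_mono disc_kernel_nonneg) auto
      ultimately show ?thesis by linarith
    next
      case False
      then have "exp (- t) \<le> cmod x" by simp
      then have "- t \<le> ln (cmod x)" using ln_ge_iff[of "cmod x" "- t"]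
        by (metis exp_gt_zero order_less_le_trans)
      then show ?thesis using False a by (simp add: algebra_simps)
    qed
  qed (intro Bochner_Integration.integrable_diff pos_log_integrable)
  also have "\<dots> = pos_log_mean (t + a) - pos_log_mean t"
    unfolding pos_log_mean_def by (simp add: pos_log_integrable)
  finally show ?thesis .
qed

lemma green_kernel_nonneg: "0 \<le> green_kernel r z"
  by (simp add: green_kernel_def pos_log_mean_nonneg)

lemma green_kernel_borel [measurable]: "green_kernel r \<in> borel_measurable borel"
  unfolding green_kernel_def[abs_def] pos_log_mean_def by measurable

lemma green_kernel_le: "green_kernel r z \<le> max 0 (ln (r / cmod z))"
  unfolding green_kernel_def by (rule pos_log_mean_le)

lemma green_kernel_eq_0:
  assumes "0 < r" "r \<le> cmod z"
  shows "green_kernel r z = 0"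
proof -
  have "0 < r / cmod z" "r / cmod z \<le> 1" using assms by (auto simp: divide_simps)
  then have "ln (r / cmod z) \<le> 0" by simp
  then show ?thesis using green_kernel_le[of r z] green_kernel_nonneg[of r z] by simp
qed

lemma kernel_green:
  assumes "0 < r"
  shows "kernel r (green_kernel r)"
  unfolding kernel_def
proof (intro conjI allI impI)
  show "integrable lborel (green_kernel r)"
    by (rule Bochner_Integration.integrable_bound[OF integrable_max_0_ln_divide_cmod[OF assms]])
       (use green_kernel_le green_kernel_nonneg in auto)
qed (use assms in \<open>auto simp: green_kernel_nonneg green_kernel_eq_0\<close>)

lemma green_kernel_mono:
  assumes "0 < r" "r \<le> s"
  shows "green_kernel r z \<le> green_kernel s z"
proof -
  have "ln (r / cmod z) \<le> ln (s / cmod z)"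
    using assms by (cases "z = 0") (auto simp: ln_div)
  then show ?thesis unfolding green_kernel_def by (rule monoD[OF pos_log_mean_mono])
qed

lemma green_kernel_log_convex: "convex_on UNIV (\<lambda>s. green_kernel (exp s) z)"
proof (cases "z = 0")
  case False
  have "green_kernel (exp s) z = pos_log_mean (s - ln (cmod z))" for s
    using False by (simp add: green_kernel_def ln_div)
  moreover have "(1 - t) * x + t * y - c = (1 - t) * (x - c) + t * (y - c)" for t x y c :: real
    by (simp add: algebra_simps)
  ultimately show ?thesis
    using convex_onD[OF pos_log_mean_convex] by (auto intro!: convex_onI)
qed (simp add: green_kernel_def convex_on_const)

lemma green_kernel_increment:
  assumes r: "0 < r" "r \<le> s" and z: "z \<noteq> 0" "cmod z \<le> d * r" and d: "d \<le> 1"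
  shows "ln (s / r) * (1 - d\<^sup>2) \<le> green_kernel s z - green_kernel r z"
proof -
  let ?t = "ln (r / cmod z)"
  have "d * r \<le> 1 * r" using d r by (intro mult_right_mono) auto
  then have "cmod z \<le> r" using z(2) by linarith
  then have t: "0 \<le> ?t" using z r by simp
  have "exp (- 2 * ?t) = exp (2 * ln (cmod z / r))" using z r by (simp add: ln_div)
  also have "\<dots> = (cmod z / r)\<^sup>2" using z r by (simp add: exp_double)
  also have "\<dots> \<le> d\<^sup>2" using z r by (intro power_mono) (auto simp: divide_le_eq)
  finally have "ln (s / r) * (1 - d\<^sup>2) \<le> ln (s / r) * (1 - exp (- 2 * ?t))"
    using r by (intro mult_left_mono) auto
  also have "\<dots> \<le> pos_log_mean (?t + ln (s / r)) - pos_log_mean ?t"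
    using r t by (intro pos_log_mean_increment) auto
  also have "?t + ln (s / r) = ln (s / cmod z)" using r z by (simp add: ln_div)
  finally show ?thesis by (simp add: green_kernel_def)
qed

lemma green_kernel_integral_pos:
  assumes r: "0 < r"
  shows "0 < (\<integral>z. green_kernel r z \<partial>lborel)"
proof -
  let ?c = "ln 2 * (1 - (1/2)\<^sup>2) :: real"
  have "0 < ?c * (pi * (r/4)\<^sup>2)" using r by (simp add: power2_eq_square)
  also have "\<dots> = (\<integral>z. ?c * indicator (ball 0 (r/4)) (z::complex) \<partial>lborel)"
    using measure_ball_complex[of "r/4" 0] r by simp
  also have "\<dots> \<le> (\<integral>z. green_kernel r z \<partial>lborel)"
  proof (rule integral_mono_AE)
    show "integrable lborel (\<lambda>z. ?c * indicator (ball 0 (r/4)) (z::complex))"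
      using kernelD(1)[OF kernel_indicator_ball] by (rule integrable_mult_right)
    show "integrable lborel (green_kernel r)" by (rule kernelD(1)[OF kernel_green[OF r]])
    show "AE z in lborel. ?c * indicator (ball 0 (r/4)) z \<le> green_kernel r z"
      using AE_lborel_singleton[of "0::complex"]
    proof eventually_elim
      case (elim z)
      show ?case
        using green_kernel_increment[of "r/2" r z "1/2"]
          green_kernel_nonneg[of "r/2" z] green_kernel_nonneg[of r z]
          r elim by (cases "cmod z < r/4") auto
    qed
  qed
  finally show ?thesis .
qed

lemma locally_integrable_ln_cmod: "locally_integrable (\<lambda>z. ln (cmod z))"
  unfolding locally_integrable_def
proof (intro conjI allI)
  fix R :: real
  define S where "S = max 1 R"
  have S: "0 < S" "R \<le> S" "0 \<le> ln S" by (auto simp: S_def)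
  have "integrable lborel (\<lambda>z. indicator (cball 0 R) z * ln (cmod z))"
  proof (rule Bochner_Integration.integrable_bound)
    show "integrable lborel (\<lambda>z. max 0 (ln (S / cmod z)) + ln S * indicator (cball 0 S) z)"
      using S(1)
      by (intro Bochner_Integration.integrable_add integrable_mult_right integrable_max_0_ln_divide_cmod)
        (auto intro!: integrable_real_indicator emeasure_lborel_cball_finite)
    show "AE z in lborel. norm (indicator (cball 0 R) z * ln (cmod z))
        \<le> norm (max 0 (ln (S / cmod z)) + ln S * indicator (cball 0 S) z)"
      using AE_lborel_singleton[of "0::complex"]
    proof eventually_elim
      case (elim z)
      have "\<bar>indicator (cball 0 R) z * ln (cmod z)\<bar> \<le> max 0 (ln (S / cmod z)) + ln S * indicator (cball 0 S) z"
      proof (cases "cmod z \<le> R")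
        case True
        then have "ln (cmod z) \<le> ln S" using elim S by (subst ln_le_cancel_iff) auto
        then have "\<bar>ln (cmod z)\<bar> \<le> (ln S - ln (cmod z)) + ln S" using S(3) by linarith
        then show ?thesis using True elim S(1,2) by (auto simp: ln_div)
      qed (use S(3) in \<open>simp add: indicator_def\<close>)
      then show ?case by (simp add: order_trans[OF _ abs_ge_self])
    qed
  qed measurable
  then show "set_integrable lborel (cball 0 R) (\<lambda>z. ln (cmod z))" by (simp add: set_integrable_def)
qed measurable

lemma circle_integral_ln_norm:
  assumes "cmod w \<noteq> cmod x"
  shows "(LBINT t:{0..2*pi}. ln (cmod (w - cis t * x))) = 2 * pi * ln (max (cmod w) (cmod x))"
proof -
  have "w - cis t * x \<noteq> 0" for t
    using assms by (metis eq_iff_diff_eq_0 mult_1 norm_cis norm_mult)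
  then have cont: "continuous_on {0..2*pi} (\<lambda>t. ln (cmod (w - cis t * x)))"
    by (intro continuous_intros) auto
  show ?thesis
    using set_borel_integral_eq_integral(2)[OF borel_integrable_atLeastAtMost'[OF cont]]
      integral_unique[OF has_integral_circle_ln_norm[OF assms]] by simp
qed

lemma integral_disc_kernel_pos_log:
  assumes r: "0 < r" and w: "w \<noteq> 0"
  shows "integrable lborel (\<lambda>x. disc_kernel r x * max 0 (ln (cmod x / cmod w)))"
    and "(\<integral>x. disc_kernel r x * max 0 (ln (cmod x / cmod w)) \<partial>lborel) = green_kernel r w"
proof -
  let ?M = "max 0 (ln (r / cmod w))"
  show "integrable lborel (\<lambda>x. disc_kernel r x * max 0 (ln (cmod x / cmod w)))"
  proof (rule Bochner_Integration.integrable_bound)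
    show "integrable lborel (\<lambda>x. disc_kernel r x * ?M)" using kernelD(1)[OF kernel_disc] by simp
    have "disc_kernel r x * max 0 (ln (cmod x / cmod w)) \<le> disc_kernel r x * ?M" for x
    proof (cases "cmod x < r \<and> x \<noteq> 0")
      case True
      then have "ln (cmod x / cmod w) \<le> ln (r / cmod w)" using w r by (simp add: ln_div)
      then show ?thesis by (intro mult_left_mono disc_kernel_nonneg) auto
    qed (auto simp: disc_kernel_def)
    then show "AE x in lborel. norm (disc_kernel r x * max 0 (ln (cmod x / cmod w)))
        \<le> norm (disc_kernel r x * ?M)"
      using disc_kernel_nonneg by (auto intro!: AE_I2 simp: abs_mult)
  qed measurable
  have "(\<integral>x. disc_kernel r x * max 0 (ln (cmod x / cmod w)) \<partial>lborel)
      = (\<integral>x. disc_kernel 1 x * max 0 (ln (r * cmod x / cmod w)) \<partial>lborel)"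
    using integral_disc_kernel_scale[OF r, of "\<lambda>x. max 0 (ln (cmod x / cmod w))"] r by (simp add: norm_mult)
  also have "\<dots> = green_kernel r w"
    unfolding green_kernel_def pos_log_mean_def
  proof (rule integral_cong_AE)
    show "AE x in lborel. disc_kernel 1 x * max 0 (ln (r * cmod x / cmod w))
        = disc_kernel 1 x * max 0 (ln (r / cmod w) + ln (cmod x))"
      using AE_lborel_singleton[of "0::complex"]
      by eventually_elim (use r w in \<open>simp add: ln_mult ln_div algebra_simps\<close>)
  qed measurable
  finally show "(\<integral>x. disc_kernel r x * max 0 (ln (cmod x / cmod w)) \<partial>lborel) = green_kernel r w" .
qed

lemma disc_mean_ln_cmod:
  assumes r: "0 < r" and w: "w \<noteq> 0"
  shows "disc_mean r (\<lambda>z. ln (cmod z)) w = ln (cmod w) + green_kernel r w"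
proof -
  let ?F = "\<lambda>x. disc_kernel r x * ln (cmod (w - x))"
  have circle: "(LBINT t:{0..2*pi}. ?F (cis t * x))
      = 2 * pi * (disc_kernel r x * (ln (cmod w) + max 0 (ln (cmod x / cmod w))))"
    if x: "cmod x \<noteq> cmod w" for x
  proof -
    have "disc_kernel r (cis t * x) = disc_kernel r x" for t
      by (simp add: disc_kernel_def indicator_def norm_mult)
    then have "(LBINT t:{0..2*pi}. ?F (cis t * x)) = disc_kernel r x * (2 * pi * ln (max (cmod w) (cmod x)))"
      using circle_integral_ln_norm[of w x] x by simp
    also have "ln (max (cmod w) (cmod x)) = ln (cmod w) + max 0 (ln (cmod x / cmod w))"
      using w x by (cases "x = 0") (auto simp: max_def ln_div)
    finally show ?thesis by simp
  qed
  have "2 * pi * disc_mean r (\<lambda>z. ln (cmod z)) w = (\<integral>x. (LBINT t:{0..2*pi}. ?F (cis t * x)) \<partial>lborel)"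
    unfolding conv_def
    by (rule integral_circle_average[symmetric])
       (rule integrable_bounded_kernel_mult[OF kernel_disc disc_kernel_le locally_integrable_ln_cmod])
  also have "\<dots> = (\<integral>x. 2 * pi * (disc_kernel r x * (ln (cmod w) + max 0 (ln (cmod x / cmod w)))) \<partial>lborel)"
  proof (rule integral_cong_AE)
    show "AE x in lborel. (LBINT t:{0..2*pi}. ?F (cis t * x))
        = 2 * pi * (disc_kernel r x * (ln (cmod w) + max 0 (ln (cmod x / cmod w))))"
      using AE_lborel_norm_neq[of "cmod w"] by eventually_elim (rule circle)
  qed (unfold set_lebesgue_integral_def, measurable)
  also have "\<dots> = 2 * pi * (ln (cmod w) + green_kernel r w)"
    using integral_disc_kernel_pos_log[OF r w] disc_kernel_integral[OF r] kernelD(1)[OF kernel_disc, of r]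
    by (simp add: distrib_left)
  finally show ?thesis by simp
qed

section \<open>Smoothing and the density of the Riesz measure\<close>

lemma green_kernel_conv_disc_identity:
  assumes r: "0 < r" and h: "0 < h" and z: "z \<noteq> 0"
  shows "conv (green_kernel h) (disc_kernel r) z - green_kernel h z
      = conv (green_kernel r) (disc_kernel h) z - green_kernel r z"
proof -
  let ?L = "\<lambda>z. ln (cmod z)"
  have iterated: "disc_mean r (disc_mean h ?L) z
      = ln (cmod z) + green_kernel r z + conv (green_kernel h) (disc_kernel r) z"
    if r: "0 < r" and h: "0 < h" for r h
  proof -
    note [measurable] = borel_measurable_continuous_onI[OF disc_mean_continuous[OF locally_integrable_ln_cmod]]
    have green_integrable: "integrable lborel (\<lambda>x. disc_kernel r x * green_kernel h (z - x))"
      by (rule integrable_bounded_kernel_mult[OF kernel_disc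
          disc_kernel_le kernel_locally_integrable[OF kernel_green[OF h]]])
    have "disc_mean r (disc_mean h ?L) z
        = (\<integral>x. disc_kernel r x * ?L (z - x) + disc_kernel r x * green_kernel h (z - x) \<partial>lborel)"
      unfolding conv_def[of "disc_kernel r"]
    proof (rule integral_cong_AE)
      show "AE x in lborel. disc_kernel r x * disc_mean h ?L (z - x)
          = disc_kernel r x * ?L (z - x) + disc_kernel r x * green_kernel h (z - x)"
        using AE_lborel_singleton[of z] by eventually_elim (simp add: disc_mean_ln_cmod[OF h] distrib_left)
    qed measurable
    also have "\<dots> = disc_mean r ?L z + disc_mean r (green_kernel h) z"
      unfolding conv_def
      by (rule Bochner_Integration.integral_add[OF integrable_bounded_kernel_mult[OF
          kernel_disc disc_kernel_le locally_integrable_ln_cmod] green_integrable])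
    also have "disc_mean r (green_kernel h) z = conv (green_kernel h) (disc_kernel r) z"
      by (rule conv_commute) measurable
    finally show ?thesis using disc_mean_ln_cmod[OF r z] by simp
  qed
  show ?thesis
    using iterated[OF r h] iterated[OF h r] disc_mean_commute[OF locally_integrable_ln_cmod, of r h z] by simp
qed

theorem green_identity:
  assumes f: "continuous_on UNIV f" and r: "0 < r" and h: "0 < h"
  shows "conv (green_kernel h) (\<lambda>x. disc_mean r f x - f x) w
      = conv (green_kernel r) (\<lambda>x. disc_mean h f x - f x) w"
proof -
  have kernel_difference: "conv (green_kernel h) (\<lambda>x. disc_mean r f x - f x) w
      = (\<integral>y. (conv (green_kernel h) (disc_kernel r) y - green_kernel h y) * f (w - y) \<partial>lborel)"
    if h: "0 < h" for h r
  proof -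
    note green = kernel_green[OF h]
    have "conv (green_kernel h) (\<lambda>x. disc_mean r f x - f x) w
       = conv (conv (green_kernel h) (disc_kernel r)) f w - conv (green_kernel h) f w"
      using conv_diff[OF green conv_continuous[OF kernel_disc f] f]
        conv_assoc_continuous[OF green kernel_disc f] by simp
    also have "\<dots> = (\<integral>y. (conv (green_kernel h) (disc_kernel r) y - green_kernel h y) * f (w - y) \<partial>lborel)"
      unfolding conv_def[of "green_kernel h" f] conv_def[of _ f] left_diff_distrib
      by (rule Bochner_Integration.integral_diff[symmetric])
         (rule integrable_kernel_mult_continuous[OF kernel_conv[OF green kernel_disc] f]
               integrable_kernel_mult_continuous[OF green f])+
    finally show ?thesis .
  qed
  note [measurable] = borel_measurable_continuous_onI[OF f]
    kernelD(2)[OF kernel_conv[OF kernel_green[OF h] kernel_disc]]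
    kernelD(2)[OF kernel_conv[OF kernel_green[OF r] kernel_disc]]
  show ?thesis
    unfolding kernel_difference[OF h] kernel_difference[OF r]
  proof (rule integral_cong_AE)
    show "AE y in lborel. (conv (green_kernel h) (disc_kernel r) y - green_kernel h y) * f (w - y)
        = (conv (green_kernel r) (disc_kernel h) y - green_kernel r y) * f (w - y)"
      using AE_lborel_singleton[of "0::complex"]
      by eventually_elim (simp add: green_kernel_conv_disc_identity[OF r h])
  qed measurable
qed

definition green_mass :: "real \<Rightarrow> real" where
  "green_mass h = (\<integral>z. green_kernel h z \<partial>lborel)"

definition smoothing_kernel :: "real \<Rightarrow> complex \<Rightarrow> real" where
  "smoothing_kernel h z = green_kernel h z / green_mass h"

abbreviation smoothing :: "real \<Rightarrow> (complex \<Rightarrow> real) \<Rightarrow> complex \<Rightarrow> real" where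
  "smoothing h \<equiv> conv (smoothing_kernel h)"

definition riesz_density :: "real \<Rightarrow> (complex \<Rightarrow> real) \<Rightarrow> complex \<Rightarrow> real" where
  "riesz_density h f w = (disc_mean h f w - f w) / green_mass h"

lemma green_mass_pos: "0 < h \<Longrightarrow> 0 < green_mass h"
  unfolding green_mass_def by (rule green_kernel_integral_pos)

lemma kernel_smoothing:
  assumes "0 < h"
  shows "kernel h (smoothing_kernel h)"
  using kernel_green[OF assms] green_mass_pos[OF assms] by (auto simp: kernel_def smoothing_kernel_def[abs_def])

lemma smoothing_kernel_integral: "0 < h \<Longrightarrow> (\<integral>z. smoothing_kernel h z \<partial>lborel) = 1"
  using green_mass_pos[of h] unfolding smoothing_kernel_def[abs_def] by (simp add: green_mass_def)

lemma smoothing_disc_mean_ge: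
  assumes f: "continuous_on UNIV f" and h: "0 < h" and ge: "\<And>z. z \<in> cball w (2 * h) \<Longrightarrow> a \<le> f z"
  shows "a \<le> smoothing h (disc_mean h f) w"
proof (rule conv_ge[OF kernel_smoothing[OF h]
    smoothing_kernel_integral[OF h] conv_continuous[OF kernel_disc f]])
  fix v assume v: "v \<in> cball w h"
  show "a \<le> disc_mean h f v"
  proof (rule conv_ge[OF kernel_disc disc_kernel_integral[OF h] f ge])
    fix z assume "z \<in> cball v h"
    then show "z \<in> cball w (2 * h)" using v dist_triangle[of w z v] by simp
  qed
qed

lemma smoothing_disc_mean_le:
  assumes "continuous_on UNIV f" "0 < h" "\<And>z. z \<in> cball w (2 * h) \<Longrightarrow> f z \<le> a"
  shows "smoothing h (disc_mean h f) w \<le> a"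
proof -
  have "conv k (\<lambda>z. - g z) = (\<lambda>z. - conv k g z)" for k g :: "complex \<Rightarrow> real"
    by (simp add: conv_def[abs_def])
  then show ?thesis
    using smoothing_disc_mean_ge[of "\<lambda>z. - f z" h w "- a"] assms by (simp add: continuous_on_minus)
qed

lemma smoothing_disc_mean_tendsto:
  assumes f: "continuous_on UNIV f"
  shows "((\<lambda>h. smoothing h (disc_mean h f) w) \<longlongrightarrow> f w) (at_right 0)"
proof (rule tendstoI)
  fix e :: real assume e: "0 < e"
  obtain d where d: "0 < d" "\<And>z. dist z w < d \<Longrightarrow> dist (f z) (f w) < e/2"
    using f e unfolding continuous_on_iff by (metis UNIV_I half_gt_zero)
  have "\<forall>\<^sub>F h in at_right 0. 0 < h \<and> h < d/2"
    using d(1) by (intro eventually_at_rightI[of _ "d/2"]) auto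
  then show "\<forall>\<^sub>F h in at_right 0. dist (smoothing h (disc_mean h f) w) (f w) < e"
  proof eventually_elim
    case (elim h)
    have dist: "dist (f z) (f w) < e/2" if "z \<in> cball w (2 * h)" for z
      using that elim by (intro d(2)) (simp add: dist_commute)
    have near: "f w - e/2 \<le> f z" "f z \<le> f w + e/2" if "z \<in> cball w (2 * h)" for z
      using dist[OF that] unfolding dist_real_def by linarith+
    have "f w - e/2 \<le> smoothing h (disc_mean h f) w"
      by (rule smoothing_disc_mean_ge[OF f _ near(1)]) (use elim in auto)
    moreover have "smoothing h (disc_mean h f) w \<le> f w + e/2"
      by (rule smoothing_disc_mean_le[OF f _ near(2)]) (use elim in auto)
    ultimately show ?case using e by (simp add: dist_real_def abs_less_iff)
  qed
qed

lemma riesz_density_continuous: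
  assumes "continuous_on UNIV f" "0 < h"
  shows "continuous_on UNIV (riesz_density h f)"
  unfolding riesz_density_def[abs_def] using green_mass_pos[OF assms(2)]
  by (intro continuous_intros conv_continuous[OF kernel_disc] assms) auto

theorem smoothing_riesz_representation:
  assumes f: "continuous_on UNIV f" and r: "0 < r" and h: "0 < h"
  shows "disc_mean r (smoothing h f) w = smoothing h f w + conv (green_kernel r) (riesz_density h f) w"
proof -
  have "disc_mean r (smoothing h f) w - smoothing h f w = smoothing h (\<lambda>x. disc_mean r f x - f x) w"
    using conv_left_commute_continuous[OF kernel_disc kernel_smoothing[OF h] f]
      conv_diff[OF kernel_smoothing[OF h] conv_continuous[OF kernel_disc f] f] by simp
  also have "\<dots> = conv (green_kernel h) (\<lambda>x. disc_mean r f x - f x) w / green_mass h"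
    by (simp add: conv_def smoothing_kernel_def)
  also have "\<dots> = conv (green_kernel r) (riesz_density h f) w"
    unfolding green_identity[OF f r h] by (simp add: conv_def riesz_density_def)
  finally show ?thesis by simp
qed

section \<open>Exponential integrability of logarithmic potentials along graphs\<close>

lemma ennreal_integral_le_nn_integral:
  assumes "integrable M g" "\<And>x. g x \<le> h x"
  shows "ennreal (\<integral>x. g x \<partial>M) \<le> (\<integral>\<^sup>+x. ennreal (h x) \<partial>M)"
proof -
  have pos_part: "integrable M (\<lambda>x. max 0 (g x))" using assms(1) by (intro integrable_max) auto
  have "ennreal (\<integral>x. g x \<partial>M) \<le> ennreal (\<integral>x. max 0 (g x) \<partial>M)"
    by (intro ennreal_leI integral_mono assms pos_part) auto
  also have "\<dots> = (\<integral>\<^sup>+x. ennreal (max 0 (g x)) \<partial>M)"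
    by (rule nn_integral_eq_integral[symmetric, OF pos_part]) auto
  also have "\<dots> \<le> (\<integral>\<^sup>+x. ennreal (h x) \<partial>M)"
    by (intro nn_integral_mono) (metis assms(2) ennreal_leI ennreal_max_0)
  finally show ?thesis .
qed

text \<open>Jensen's inequality for the probability measure \<open>M / k\<close>, by integrating the tangent line of \<open>exp\<close> at \<open>c\<close>.\<close>
lemma (in finite_measure) exp_integral_le:
  fixes F :: "'a \<Rightarrow> real"
  assumes F: "integrable M F"
  shows "ennreal (measure M (space M) * exp (\<integral>x. F x \<partial>M)) \<le> (\<integral>\<^sup>+x. ennreal (exp (measure M (space M) * F x)) \<partial>M)"
proof -
  define k c where "k = measure M (space M)" and "c = (\<integral>x. F x \<partial>M)"
  let ?g = "\<lambda>x. exp c * ((1 - c) + k * F x)"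
  have "k * exp c = (\<integral>x. ?g x \<partial>M)" using F by (simp add: k_def c_def algebra_simps)
  also have "ennreal \<dots> \<le> (\<integral>\<^sup>+x. ennreal (exp (k * F x)) \<partial>M)"
  proof (rule ennreal_integral_le_nn_integral)
    show "integrable M ?g" using F by simp
    fix x
    have "exp c * (1 + (k * F x - c)) \<le> exp c * exp (k * F x - c)"
      by (intro mult_left_mono exp_ge_add_one_self) simp
    then show "?g x \<le> exp (k * F x)" by (simp add: exp_diff algebra_simps)
  qed
  finally show ?thesis unfolding k_def c_def .
qed

definition graph_exp_bound :: "real \<Rightarrow> real \<Rightarrow> ennreal \<Rightarrow> ennreal" where
  "graph_exp_bound m r a = a + ennreal (r powr m) * ((\<integral>\<^sup>+s\<in>{-1..1}. ennreal (\<bar>s\<bar> powr (- m)) \<partial>lborel) + a)"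

lemma graph_exp_bound_finite: "m < 1 \<Longrightarrow> a < \<infinity> \<Longrightarrow> graph_exp_bound m r a < \<infinity>"
  unfolding graph_exp_bound_def using nn_integral_abs_powr_finite[of "- m" 1]
  by (auto simp: ennreal_mult_less_top)

lemma nn_integral_abs_powr_le_graph_exp_bound:
  assumes m: "0 \<le> m" and I [measurable]: "I \<in> sets borel"
  shows "(\<integral>\<^sup>+s\<in>I. ennreal (1 + r powr m * \<bar>s - a\<bar> powr (- m)) \<partial>lborel) \<le> graph_exp_bound m r (emeasure lborel I)"
proof -
  let ?p = "\<lambda>s. ennreal (\<bar>s\<bar> powr (- m)) * indicator {-1..1} s"
  have "(\<integral>\<^sup>+s\<in>I. ennreal (1 + r powr m * \<bar>s - a\<bar> powr (- m)) \<partial>lborel)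
      \<le> (\<integral>\<^sup>+s. indicator I s + ennreal (r powr m) * (?p (s - a) + indicator I s) \<partial>lborel)"
  proof (rule nn_integral_mono)
    fix s :: real
    have "ennreal (\<bar>s - a\<bar> powr (- m)) \<le> ?p (s - a) + 1"
    proof (cases "\<bar>s - a\<bar> \<le> 1")
      case True
      then have "s - a \<in> {-1..1}" by auto
      then show ?thesis by simp
    next
      case False
      then have "ennreal (\<bar>s - a\<bar> powr (- m)) \<le> ennreal 1"
        using m powr_mono2'[of "- m" 1 "\<bar>s - a\<bar>"] by (intro ennreal_leI) simp
      then show ?thesis by (simp add: add_increasing)
    qed
    then have "ennreal (r powr m) * ennreal (\<bar>s - a\<bar> powr (- m)) \<le> ennreal (r powr m) * (?p (s - a) + 1)"
      by (rule mult_left_mono) simp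
    then show "ennreal (1 + r powr m * \<bar>s - a\<bar> powr (- m)) * indicator I s
        \<le> indicator I s + ennreal (r powr m) * (?p (s - a) + indicator I s)"
      by (cases "s \<in> I") (auto simp: ennreal_mult')
  qed
  also have "\<dots> = emeasure lborel I + ennreal (r powr m) * ((\<integral>\<^sup>+s. ?p (s - a) \<partial>lborel) + emeasure lborel I)"
    by (simp add: nn_integral_add nn_integral_cmult)
  also have "(\<integral>\<^sup>+s. ?p (s - a) \<partial>lborel) = (\<integral>\<^sup>+s. ?p s \<partial>lborel)"
    using nn_integral_lborel_translation[of ?p "- a"] by simp
  finally show ?thesis unfolding graph_exp_bound_def .
qed

lemma exp_pos_log_le_powr:
  fixes a b r k m :: real
  assumes "0 < b" "b \<le> a" "0 < r" "0 \<le> k" "k \<le> m"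
  shows "exp (k * max 0 (ln (r / a))) \<le> 1 + r powr m * b powr (- m)"
proof -
  have "k * max 0 (ln (r / a)) \<le> m * max 0 (ln (r / b))"
    using assms by (intro mult_mono max.mono) (auto simp: ln_div)
  then have "exp (k * max 0 (ln (r / a))) \<le> exp (m * max 0 (ln (r / b)))" by simp
  also have "\<dots> \<le> 1 + exp (m * ln (r / b))" by (auto simp: max_def)
  also have "exp (m * ln (r / b)) = r powr m * b powr (- m)"
    using assms by (simp add: powr_def ln_div right_diff_distrib flip: exp_add)
  finally show ?thesis .
qed

lemma nn_integral_graph_exp_log_le:
  assumes k: "0 \<le> k" "k \<le> m" and r: "0 < r" and I: "I \<in> sets borel" and \<gamma>: "\<And>s. Re (\<gamma> s) = s"
  shows "(\<integral>\<^sup>+s\<in>I. ennreal (exp (k * max 0 (ln (r / cmod (\<gamma> s - \<zeta>))))) \<partial>lborel)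
      \<le> graph_exp_bound m r (emeasure lborel I)"
proof -
  have "(\<integral>\<^sup>+s\<in>I. ennreal (exp (k * max 0 (ln (r / cmod (\<gamma> s - \<zeta>))))) \<partial>lborel)
      \<le> (\<integral>\<^sup>+s\<in>I. ennreal (1 + r powr m * \<bar>s - Re \<zeta>\<bar> powr (- m)) \<partial>lborel)"
  proof (rule nn_integral_mono_AE)
    show "AE s in lborel. ennreal (exp (k * max 0 (ln (r / cmod (\<gamma> s - \<zeta>))))) * indicator I s
        \<le> ennreal (1 + r powr m * \<bar>s - Re \<zeta>\<bar> powr (- m)) * indicator I s"
      using AE_lborel_singleton[of "Re \<zeta>"]
    proof eventually_elim
      case (elim s)
      have "\<bar>s - Re \<zeta>\<bar> \<le> cmod (\<gamma> s - \<zeta>)" using abs_Re_le_cmod[of "\<gamma> s - \<zeta>"] \<gamma> by simp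
      then show ?case using elim k r by (intro mult_right_mono ennreal_leI exp_pos_log_le_powr) auto
    qed
  qed
  also have "\<dots> \<le> graph_exp_bound m r (emeasure lborel I)"
    using k by (intro nn_integral_abs_powr_le_graph_exp_bound I) simp
  finally show ?thesis .
qed

lemma exp_log_potential_along_graph_le:
  fixes N :: "complex measure"
  assumes N: "finite_measure N" "sets N = sets borel" "measure N (space N) \<le> m"
    and r: "0 < r" and I [measurable]: "I \<in> sets borel"
    and \<gamma>: "\<gamma> \<in> borel_measurable borel" "\<And>s. Re (\<gamma> s) = s"
    and log_integrable: "\<And>s. s \<in> I \<Longrightarrow> integrable N (\<lambda>\<zeta>. max 0 (ln (r / cmod (\<gamma> s - \<zeta>))))"
  shows "(\<integral>\<^sup>+s\<in>I. ennreal (exp (\<integral>\<zeta>. max 0 (ln (r / cmod (\<gamma> s - \<zeta>))) \<partial>N)) \<partial>lborel)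
      \<le> graph_exp_bound m r (emeasure lborel I)"
proof -
  interpret finite_measure N by (rule N(1))
  interpret pair_sigma_finite lborel N ..
  note [measurable_cong] = N(2) and [measurable] = \<gamma>(1)
  define k where "k = measure N (space N)"
  have k: "0 \<le> k" "k \<le> m" using N(3) by (auto simp: k_def)
  let ?p = "\<lambda>s. \<integral>\<zeta>. max 0 (ln (r / cmod (\<gamma> s - \<zeta>))) \<partial>N"
  let ?B = "graph_exp_bound m r (emeasure lborel I)"
  show ?thesis
  proof (cases "k = 0")
    case True
    then have "emeasure N (space N) = 0" by (simp add: k_def emeasure_eq_measure)
    then have "AE \<zeta> in N. False" by (simp add: AE_iff_measurable[of "space N"])
    then have "?p s = 0" for s by (intro integral_eq_zero_AE) auto
    then have "(\<integral>\<^sup>+s\<in>I. ennreal (exp (?p s)) \<partial>lborel) = emeasure lborel I" by simp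
    also have "\<dots> \<le> ?B" by (simp add: graph_exp_bound_def)
    finally show ?thesis .
  next
    case False
    have "ennreal k * (\<integral>\<^sup>+s\<in>I. ennreal (exp (?p s)) \<partial>lborel) = (\<integral>\<^sup>+s\<in>I. ennreal (k * exp (?p s)) \<partial>lborel)"
      using k(1) by (subst nn_integral_cmult[symmetric]) (auto simp: ennreal_mult' mult.assoc)
    also have "\<dots> \<le> (\<integral>\<^sup>+s. (\<integral>\<^sup>+\<zeta>. ennreal (exp (k * max 0 (ln (r / cmod (\<gamma> s - \<zeta>))))) * indicator I s \<partial>N) \<partial>lborel)"
      using exp_integral_le[OF log_integrable] by (intro nn_integral_mono) (auto simp: k_def indicator_def)
    also have "\<dots> = (\<integral>\<^sup>+\<zeta>. (\<integral>\<^sup>+s\<in>I. ennreal (exp (k * max 0 (ln (r / cmod (\<gamma> s - \<zeta>))))) \<partial>lborel) \<partial>N)"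
      by (rule Fubini'[symmetric]) measurable
    also have "\<dots> \<le> (\<integral>\<^sup>+\<zeta>. ?B \<partial>N)"
      by (intro nn_integral_mono nn_integral_graph_exp_log_le k r I \<gamma>(2))
    also have "\<dots> = ennreal k * ?B"
      by (simp add: k_def emeasure_eq_measure mult.commute)
    finally show ?thesis
      using k(1) False by (subst (asm) ennreal_mult_le_mult_iff) auto
  qed
qed

definition density_on_ball :: "complex \<Rightarrow> real \<Rightarrow> (complex \<Rightarrow> real) \<Rightarrow> complex measure" where
  "density_on_ball z0 R \<mu> = density lborel (\<lambda>\<zeta>. ennreal (indicator (ball z0 R) \<zeta> * \<mu> \<zeta>))"

context
  fixes \<mu> :: "complex \<Rightarrow> real"
  assumes continuous_density: "continuous_on UNIV \<mu>" and density_nonneg: "\<And>\<zeta>. 0 \<le> \<mu> \<zeta>"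
begin

lemma density_borel [measurable]: "\<mu> \<in> borel_measurable borel"
  by (rule borel_measurable_continuous_onI[OF continuous_density])

lemma conv_indicator_ball_eq: "conv (indicator (ball 0 R)) \<mu> z0 = (\<integral>\<zeta>. indicator (ball z0 R) \<zeta> * \<mu> \<zeta> \<partial>lborel)"
proof -
  have "conv (indicator (ball 0 R)) \<mu> z0 = conv \<mu> (indicator (ball 0 R)) z0"
    by (rule conv_commute) measurable
  then show ?thesis
    by (simp add: conv_def indicator_def dist_norm norm_minus_commute mult.commute)
qed

lemma integrable_indicator_ball_density: "integrable lborel (\<lambda>\<zeta>. indicator (ball z0 R) \<zeta> * \<mu> \<zeta>)"
proof -
  have "integrable lborel (\<lambda>z. indicator (ball 0 R) z * \<mu> (z0 - z))"
    by (rule integrable_kernel_mult_continuous[OF kernel_indicator_ball continuous_density])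
  then have "integrable lborel (\<lambda>z. indicator (ball z0 R) (z0 - z) * \<mu> (z0 - z))"
    by (simp add: indicator_def dist_norm)
  then show ?thesis by (subst (asm) integrable_lborel_reflection_iff) auto
qed

lemma emeasure_density_on_ball:
  "emeasure (density_on_ball z0 R \<mu>) UNIV = ennreal (conv (indicator (ball 0 R)) \<mu> z0)"
  unfolding density_on_ball_def conv_indicator_ball_eq
  using density_nonneg
  by (subst emeasure_density) (auto intro!: nn_integral_eq_integral integrable_indicator_ball_density)

lemma finite_measure_density_on_ball: "finite_measure (density_on_ball z0 R \<mu>)"
  by (rule finite_measureI)
    (simp add: density_on_ball_def emeasure_density_on_ball[unfolded density_on_ball_def])

lemma measure_density_on_ball:
  "measure (density_on_ball z0 R \<mu>) (space (density_on_ball z0 R \<mu>)) = conv (indicator (ball 0 R)) \<mu> z0"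
proof -
  have "0 \<le> conv (indicator (ball 0 R)) \<mu> z0"
    unfolding conv_def using density_nonneg by (intro integral_nonneg_AE) auto
  moreover have "space (density_on_ball z0 R \<mu>) = UNIV" by (simp add: density_on_ball_def)
  ultimately show ?thesis by (simp add: measure_def emeasure_density_on_ball)
qed

lemma integrable_density_on_ball_iff:
  fixes F :: "complex \<Rightarrow> real"
  assumes [measurable]: "F \<in> borel_measurable borel"
  shows "integrable (density_on_ball z0 R \<mu>) F \<longleftrightarrow> integrable lborel (\<lambda>\<zeta>. indicator (ball z0 R) \<zeta> * \<mu> \<zeta> * F \<zeta>)"
  unfolding density_on_ball_def using density_nonneg by (subst integrable_density) auto

lemma integrable_density_on_ball_log:
  assumes r: "0 < r"
  shows "integrable (density_on_ball z0 R \<mu>) (\<lambda>\<zeta>. max 0 (ln (r / cmod (w - \<zeta>))))"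
proof (subst integrable_density_on_ball_iff)
  obtain B where B: "0 \<le> B" "\<And>\<zeta>. \<zeta> \<in> cball z0 R \<Longrightarrow> \<bar>\<mu> \<zeta>\<bar> \<le> B"
    using continuous_bounded_cball[OF continuous_density] by blast
  have "integrable lborel (\<lambda>\<zeta>. B * max 0 (ln (r / cmod (w - \<zeta>))))"
    using integrable_max_0_ln_divide_cmod[OF r]
    by (intro integrable_mult_right) (subst integrable_lborel_reflection_iff, auto)
  then show "integrable lborel (\<lambda>\<zeta>. indicator (ball z0 R) \<zeta> * \<mu> \<zeta> * max 0 (ln (r / cmod (w - \<zeta>))))"
  proof (rule Bochner_Integration.integrable_bound)
    have "indicator (ball z0 R) \<zeta> * \<bar>\<mu> \<zeta>\<bar> \<le> B" for \<zeta>
      using B by (auto simp: indicator_def)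
    then show "AE \<zeta> in lborel. norm (indicator (ball z0 R) \<zeta> * \<mu> \<zeta> * max 0 (ln (r / cmod (w - \<zeta>))))
        \<le> norm (B * max 0 (ln (r / cmod (w - \<zeta>))))"
      using B(1) by (auto intro!: AE_I2 mult_right_mono simp: abs_mult)
  qed measurable
qed measurable

lemma conv_green_le_log_potential:
  assumes r: "0 < r" and near: "dist z0 w + r \<le> R"
  shows "conv (green_kernel r) \<mu> w \<le> (\<integral>\<zeta>. max 0 (ln (r / cmod (w - \<zeta>))) \<partial>density_on_ball z0 R \<mu>)"
proof -
  have "conv (green_kernel r) \<mu> w = (\<integral>\<zeta>. \<mu> \<zeta> * green_kernel r (w - \<zeta>) \<partial>lborel)"
    unfolding conv_commute[OF green_kernel_borel density_borel] by (simp add: conv_def)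
  also have "\<dots> \<le> (\<integral>\<zeta>. indicator (ball z0 R) \<zeta> * \<mu> \<zeta> * max 0 (ln (r / cmod (w - \<zeta>))) \<partial>lborel)"
  proof (rule integral_mono)
    have "integrable lborel (\<lambda>z. green_kernel r z * \<mu> (w - z))"
      by (rule integrable_kernel_mult_continuous[OF kernel_green[OF r] continuous_density])
    then have "integrable lborel (\<lambda>z. (\<lambda>\<zeta>. \<mu> \<zeta> * green_kernel r (w - \<zeta>)) (w - z))"
      by (simp add: mult.commute)
    then show "integrable lborel (\<lambda>\<zeta>. \<mu> \<zeta> * green_kernel r (w - \<zeta>))"
      by (subst (asm) integrable_lborel_reflection_iff) auto
    show "integrable lborel (\<lambda>\<zeta>. indicator (ball z0 R) \<zeta> * \<mu> \<zeta> * max 0 (ln (r / cmod (w - \<zeta>))))"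
      using integrable_density_on_ball_log[OF r] by (subst (asm) integrable_density_on_ball_iff) auto
    fix \<zeta>
    show "\<mu> \<zeta> * green_kernel r (w - \<zeta>) \<le> indicator (ball z0 R) \<zeta> * \<mu> \<zeta> * max 0 (ln (r / cmod (w - \<zeta>)))"
    proof (cases "cmod (w - \<zeta>) < r")
      case True
      then have "\<zeta> \<in> ball z0 R" using near dist_triangle[of z0 \<zeta> w] by (simp add: dist_norm)
      then show ?thesis using green_kernel_le[of r "w - \<zeta>"] density_nonneg by (simp add: mult_left_mono)
    next
      case False
      then show ?thesis using green_kernel_eq_0[OF r, of "w - \<zeta>"] density_nonneg by simp
    qed
  qed
  also have "\<dots> = (\<integral>\<zeta>. max 0 (ln (r / cmod (w - \<zeta>))) \<partial>density_on_ball z0 R \<mu>)"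
    unfolding density_on_ball_def using density_nonneg by (subst integral_density) auto
  finally show ?thesis .
qed

end

section \<open>Disc means of a subharmonic function\<close>

lemma subharmonic_bounded_above:
  assumes "subharmonic \<phi>"
  obtains M :: real where "\<And>w. w \<in> cball z R \<Longrightarrow> \<phi> w \<le> ereal M"
  using usc_ereal_bounded_above[of \<phi> "cball z R"] assms by (auto simp: subharmonic_def)

lemma disc_mean_eq_set_integral:
  assumes [measurable]: "f \<in> borel_measurable borel"
  shows "disc_mean r f w = (LBINT z:ball w r. f z) / (pi * r\<^sup>2)"
proof -
  have "disc_mean r f w = conv f (disc_kernel r) w" by (rule conv_commute) measurable
  also have "\<dots> = (\<integral>z. (indicator (ball w r) z * f z) / (pi * r\<^sup>2) \<partial>lborel)"
    unfolding conv_def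
    by (intro Bochner_Integration.integral_cong)
      (auto simp: disc_kernel_def indicator_def dist_norm norm_minus_commute)
  finally show ?thesis by (simp add: set_lebesgue_integral_def)
qed

lemma locally_integrable_set_integrable_ball:
  assumes "locally_integrable f"
  shows "set_integrable lborel (ball w r) f"
proof (rule set_integrable_subset)
  show "set_integrable lborel (cball 0 (norm w + r)) f" using assms by (simp add: locally_integrable_def)
  show "ball w r \<subseteq> cball 0 (norm w + r)" by (simp add: ball_subset_cball_iff)
qed simp

locale subharmonic_function =
  fixes \<phi> :: "complex \<Rightarrow> ereal"
  assumes sub: "subharmonic \<phi>" and proper: "\<exists>z. \<phi> z \<noteq> - \<infinity>"
begin

definition real_phi :: "complex \<Rightarrow> real" where
  "real_phi z = real_of_ereal (\<phi> z)"

abbreviation mean :: "real \<Rightarrow> complex \<Rightarrow> real" where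
  "mean r \<equiv> disc_mean r real_phi"

lemma phi_borel [measurable]: "\<phi> \<in> borel_measurable borel"
  by (rule subharmonic_borel[OF sub])

lemma real_phi_borel [measurable]: "real_phi \<in> borel_measurable borel"
  unfolding real_phi_def[abs_def] by measurable

lemma phi_less_infinity: "\<phi> z < \<infinity>"
  using sub by (simp add: subharmonic_def)

lemma phi_eq_real_phi: "\<phi> z \<noteq> -\<infinity> \<Longrightarrow> \<phi> z = ereal (real_phi z)"
  unfolding real_phi_def using phi_less_infinity[of z] by (cases "\<phi> z") auto

lemma nn_integral_ball_finite:
  assumes z: "\<phi> z \<noteq> -\<infinity>" and R: "0 < R" and M: "\<And>w. w \<in> ball z R \<Longrightarrow> \<phi> w \<le> ereal M"
  shows "(\<integral>\<^sup>+w\<in>ball z R. e2ennreal (ereal M - \<phi> w) \<partial>lborel) < \<infinity>"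
proof -
  have "e2ennreal (ereal M - \<phi> z) < \<infinity>" using phi_eq_real_phi[OF z] by simp
  then have "ennreal (pi * R\<^sup>2) * e2ennreal (ereal M - \<phi> z) < \<infinity>"
    by (auto simp: ennreal_mult_less_top)
  then show ?thesis using subharmonic_nn_integral_ball_le[OF sub M R] by (rule order.strict_trans1[rotated])
qed

lemma AE_ball_phi_eq_real_phi:
  assumes "\<phi> z \<noteq> -\<infinity>" "0 < R"
  shows "AE w in lborel. w \<in> ball z R \<longrightarrow> \<phi> w = ereal (real_phi w)"
proof -
  obtain M where M: "\<And>w. w \<in> cball z R \<Longrightarrow> \<phi> w \<le> ereal M" using subharmonic_bounded_above[OF sub] by blast
  have "AE w in lborel. e2ennreal (ereal M - \<phi> w) * indicator (ball z R) w \<noteq> \<infinity>"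
    using nn_integral_ball_finite[OF assms, of M] M by (intro nn_integral_PInf_AE) auto
  then show ?thesis
    by eventually_elim (use phi_eq_real_phi in force)
qed

lemma AE_phi_eq_real_phi: "AE z in lborel. \<phi> z = ereal (real_phi z)"
proof -
  obtain z1 where z1: "\<phi> z1 \<noteq> -\<infinity>" using proper by blast
  have "AE z in lborel. \<forall>n. z \<in> ball z1 (real (Suc n)) \<longrightarrow> \<phi> z = ereal (real_phi z)"
    unfolding AE_all_countable using AE_ball_phi_eq_real_phi[OF z1] by auto
  then show ?thesis
  proof eventually_elim
    case (elim z)
    obtain n where "dist z1 z < real n" using reals_Archimedean2 by blast
    then show ?case using elim[rule_format, of n] by simp
  qed
qed

lemma AE_phi_eq_real_phi_reflection: "AE z in lborel. \<phi> (w - z) = ereal (real_phi (w - z))"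
  by (rule AE_lborel_reflection[OF AE_phi_eq_real_phi])

lemma real_phi_locally_integrable: "locally_integrable real_phi"
  unfolding locally_integrable_def
proof (intro conjI allI real_phi_borel)
  fix R
  obtain z1 where z1: "\<phi> z1 \<noteq> -\<infinity>" using proper by blast
  define R' where "R' = \<bar>R\<bar> + cmod z1 + 1"
  have R': "0 < R'" unfolding R'_def using norm_ge_zero[of z1] abs_ge_zero[of R] by linarith
  obtain M where M: "\<And>w. w \<in> cball z1 R' \<Longrightarrow> \<phi> w \<le> ereal M" using subharmonic_bounded_above[OF sub] by blast
  have "integrable lborel (\<lambda>z. indicator (ball z1 R') z * (M - real_phi z))"
  proof (rule integrableI_bounded)
    have "AE z in lborel. ennreal (norm (indicator (ball z1 R') z * (M - real_phi z)))
        = e2ennreal (ereal M - \<phi> z) * indicator (ball z1 R') z"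
      using AE_phi_eq_real_phi
    proof eventually_elim
      case (elim z)
      then show ?case using M[of z] by (cases "z \<in> ball z1 R'") auto
    qed
    then have "(\<integral>\<^sup>+z. ennreal (norm (indicator (ball z1 R') z * (M - real_phi z))) \<partial>lborel)
        = (\<integral>\<^sup>+z\<in>ball z1 R'. e2ennreal (ereal M - \<phi> z) \<partial>lborel)"
      by (rule nn_integral_cong_AE)
    also have "\<dots> < \<infinity>" using M by (intro nn_integral_ball_finite[OF z1 R']) auto
    finally show "(\<integral>\<^sup>+z. ennreal (norm (indicator (ball z1 R') z * (M - real_phi z))) \<partial>lborel) < \<infinity>" .
  qed measurable
  then have "integrable lborel (\<lambda>z. M * indicator (ball z1 R') z - indicator (ball z1 R') z * (M - real_phi z))"
    by (intro Bochner_Integration.integrable_diff integrable_mult_right integrable_indicator_ball)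
  then have "set_integrable lborel (ball z1 R') real_phi"
    by (simp add: set_integrable_def algebra_simps)
  then show "set_integrable lborel (cball 0 R) real_phi"
    by (rule set_integrable_subset) (auto simp: cball_subset_ball_iff R'_def)
qed

lemma mean_continuous: "continuous_on UNIV (mean r)"
  by (rule disc_mean_continuous[OF real_phi_locally_integrable])

lemma mean_commute: "disc_mean r (mean s) = disc_mean s (mean r)"
  by (rule ext, rule disc_mean_commute[OF real_phi_locally_integrable])

lemma set_integrable_ball_const_minus: "set_integrable lborel (ball w r) (\<lambda>z. M - real_phi z)"
  using locally_integrable_set_integrable_ball[OF real_phi_locally_integrable] integrable_indicator_ball
  by (intro set_integral_diff) (auto simp: set_integrable_def)

lemma set_integral_ball_const_minus:
  assumes r: "0 < r"
  shows "(LBINT z:ball w r. M - real_phi z) = pi * r\<^sup>2 * (M - mean r w)"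
proof -
  have "(LBINT z:ball w r. M - real_phi z) = (LBINT z:ball w r. M) - (LBINT z:ball w r. real_phi z)"
    using locally_integrable_set_integrable_ball[OF real_phi_locally_integrable] integrable_indicator_ball
    by (intro set_integral_diff) (auto simp: set_integrable_def)
  also have "(LBINT z:ball w r. M) = pi * r\<^sup>2 * M"
    using measure_ball_complex[of r w] r by (simp add: set_lebesgue_integral_def)
  finally show ?thesis using r by (simp add: disc_mean_eq_set_integral right_diff_distrib)
qed

lemma phi_le_mean:
  assumes r: "0 < r"
  shows "\<phi> w \<le> ereal (mean r w)"
proof (cases "\<phi> w = -\<infinity>")
  case False
  obtain M where M: "\<And>u. u \<in> cball w r \<Longrightarrow> \<phi> u \<le> ereal M" using subharmonic_bounded_above[OF sub] by blast
  have integrable: "integrable lborel (\<lambda>z. indicator (ball w r) z * (M - real_phi z))"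
    using set_integrable_ball_const_minus by (simp add: set_integrable_def)
  have "ennreal (pi * r\<^sup>2 * (M - mean r w)) \<le> (\<integral>\<^sup>+z. ennreal (indicator (ball w r) z * (M - real_phi z)) \<partial>lborel)"
    using ennreal_integral_le_nn_integral[OF integrable order_refl] set_integral_ball_const_minus[OF r, of w M]
    by (simp add: set_lebesgue_integral_def)
  also have "\<dots> = (\<integral>\<^sup>+z\<in>ball w r. e2ennreal (ereal M - \<phi> z) \<partial>lborel)"
  proof (rule nn_integral_cong_AE)
    show "AE z in lborel. ennreal (indicator (ball w r) z * (M - real_phi z))
        = e2ennreal (ereal M - \<phi> z) * indicator (ball w r) z"
      using AE_phi_eq_real_phi by eventually_elim (auto simp: indicator_def)
  qed
  also have "\<dots> \<le> ennreal (pi * r\<^sup>2) * e2ennreal (ereal M - \<phi> w)"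
    using M by (intro subharmonic_nn_integral_ball_le[OF sub _ r]) auto
  also have "\<dots> = ennreal (pi * r\<^sup>2 * (M - real_phi w))"
    using phi_eq_real_phi[OF False] by (simp add: ennreal_mult')
  finally have "M - mean r w \<le> M - real_phi w"
    using M[of w] r phi_eq_real_phi[OF False] by (simp add: ennreal_le_iff)
  then show ?thesis using phi_eq_real_phi[OF False] by simp
qed simp

lemma mean_le:
  assumes s: "0 < s" and le: "\<And>z. z \<in> ball w s \<Longrightarrow> \<phi> z \<le> ereal c"
  shows "mean s w \<le> c"
proof -
  have "mean s w \<le> conv (disc_kernel s) (\<lambda>_. c) w"
    unfolding conv_def
  proof (rule integral_mono_AE[OF
      integrable_bounded_kernel_mult[OF kernel_disc disc_kernel_le real_phi_locally_integrable]])
    show "integrable lborel (\<lambda>z. disc_kernel s z * c)" using kernelD(1)[OF kernel_disc] by simp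
    show "AE z in lborel. disc_kernel s z * real_phi (w - z) \<le> disc_kernel s z * c"
      using AE_phi_eq_real_phi_reflection[of w]
    proof eventually_elim
      case (elim z)
      show ?case
      proof (cases "cmod z < s")
        case True
        then have "real_phi (w - z) \<le> c" using le[of "w - z"] elim by (simp add: dist_norm)
        then show ?thesis by (intro mult_left_mono disc_kernel_nonneg)
      qed (simp add: disc_kernel_def)
    qed
  qed
  then show ?thesis using disc_kernel_integral[OF s] by (simp add: conv_const)
qed

lemma mean_le_disc_mean:
  assumes r: "0 < r"
  shows "mean s w \<le> disc_mean r (mean s) w"
proof -
  have "mean s w \<le> disc_mean s (mean r) w"
    unfolding conv_def[of "disc_kernel s"]
  proof (rule integral_mono_AE)
    show "integrable lborel (\<lambda>z. disc_kernel s z * real_phi (w - z))"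
      by (rule integrable_bounded_kernel_mult[OF kernel_disc disc_kernel_le real_phi_locally_integrable])
    show "integrable lborel (\<lambda>z. disc_kernel s z * mean r (w - z))"
      by (rule integrable_kernel_mult_continuous[OF kernel_disc mean_continuous])
    show "AE z in lborel. disc_kernel s z * real_phi (w - z) \<le> disc_kernel s z * mean r (w - z)"
      using AE_phi_eq_real_phi_reflection[of w]
    proof eventually_elim
      case (elim z)
      then have "real_phi (w - z) \<le> mean r (w - z)" using phi_le_mean[OF r, of "w - z"] by simp
      then show ?case by (intro mult_left_mono disc_kernel_nonneg)
    qed
  qed
  then show ?thesis by (simp add: mean_commute)
qed

definition regularized :: "real \<Rightarrow> complex \<Rightarrow> real" where
  "regularized h = smoothing h (mean h)"

definition riesz :: "real \<Rightarrow> complex \<Rightarrow> real" where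
  "riesz h = riesz_density h (mean h)"

lemma regularized_continuous: "0 < h \<Longrightarrow> continuous_on UNIV (regularized h)"
  unfolding regularized_def by (intro conv_continuous[OF kernel_smoothing] mean_continuous)

lemma riesz_continuous: "0 < h \<Longrightarrow> continuous_on UNIV (riesz h)"
  unfolding riesz_def by (intro riesz_density_continuous mean_continuous)

lemma riesz_nonneg: "0 < h \<Longrightarrow> 0 \<le> riesz h w"
  unfolding riesz_def riesz_density_def
  using mean_le_disc_mean[of h h w] green_mass_pos[of h] by (intro divide_nonneg_pos) auto

lemma disc_mean_regularized:
  assumes "0 < h"
  shows "disc_mean r (regularized h) w = smoothing h (disc_mean h (mean r)) w"
  unfolding regularized_def mean_commute[of h r]
  by (rule conv_left_commute_continuous[OF kernel_disc kernel_smoothing[OF assms] mean_continuous])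

lemma disc_mean_regularized_eq:
  assumes "0 < r" "0 < h"
  shows "disc_mean r (regularized h) w = regularized h w + conv (green_kernel r) (riesz h) w"
  unfolding regularized_def riesz_def by (rule smoothing_riesz_representation[OF mean_continuous assms])

lemma disc_mean_regularized_tendsto: "((\<lambda>h. disc_mean r (regularized h) w) \<longlongrightarrow> mean r w) (at_right 0)"
proof (rule Lim_transform_eventually[OF smoothing_disc_mean_tendsto[OF mean_continuous]])
  show "\<forall>\<^sub>F h in at_right 0. smoothing h (disc_mean h (mean r)) w = disc_mean r (regularized h) w"
    using eventually_at_right_less[of 0] by eventually_elim (simp add: disc_mean_regularized)
qed

lemma regularized_limsup:
  assumes "\<phi> w < ereal c"
  shows "\<forall>\<^sub>F h in at_right 0. regularized h w \<le> c"
proof -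
  have "open {v. \<phi> v < ereal c}" using usc_ereal_open_less sub by (auto simp: subharmonic_def)
  moreover have "w \<in> {v. \<phi> v < ereal c}" using assms by simp
  ultimately obtain d where d: "0 < d" "ball w d \<subseteq> {v. \<phi> v < ereal c}" by (rule openE)
  have "\<forall>\<^sub>F h in at_right 0. 0 < h \<and> h < d/2" using d(1) by (intro eventually_at_rightI[of _ "d/2"]) auto
  then show ?thesis
  proof eventually_elim
    case (elim h)
    show ?case
      unfolding regularized_def
    proof (rule conv_le[OF kernel_smoothing smoothing_kernel_integral mean_continuous])
      fix v assume v: "v \<in> cball w h"
      show "mean h v \<le> c"
      proof (rule mean_le)
        fix z assume "z \<in> ball v h"
        then have "z \<in> ball w d" using v elim dist_triangle[of w z v] by simp
        then show "\<phi> z \<le> ereal c" using d(2) by (auto simp: subset_eq less_imp_le)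
      qed (use elim in simp)
    qed (use elim in auto)
  qed
qed

lemma mean_mono:
  assumes r: "0 < r" "r \<le> s"
  shows "mean r w \<le> mean s w"
proof (rule tendsto_le[OF _ disc_mean_regularized_tendsto disc_mean_regularized_tendsto])
  show "\<forall>\<^sub>F h in at_right 0. disc_mean r (regularized h) w \<le> disc_mean s (regularized h) w"
    using eventually_at_right_less[of 0]
  proof eventually_elim
    case (elim h)
    have "conv (green_kernel r) (riesz h) w \<le> conv (green_kernel s) (riesz h) w"
      using r elim
      by (intro conv_kernel_mono[OF kernel_green kernel_green riesz_continuous]
          green_kernel_mono riesz_nonneg AE_I2) auto
    then show ?case using r elim by (simp add: disc_mean_regularized_eq)
  qed
qed simp

lemma mean_log_convex: "convex_on UNIV (\<lambda>x. mean (exp x) w)"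
proof (rule convex_onI)
  fix t x y :: real assume t: "0 < t" "t < 1"
  let ?z = "(1 - t) *\<^sub>R x + t *\<^sub>R y"
  let ?k = "\<lambda>z. (1 - t) * green_kernel (exp x) z + t * green_kernel (exp y) z"
  show "mean (exp ?z) w \<le> (1 - t) * mean (exp x) w + t * mean (exp y) w"
  proof (rule tendsto_le[OF _ tendsto_add[OF tendsto_mult_left tendsto_mult_left], OF _
      disc_mean_regularized_tendsto disc_mean_regularized_tendsto disc_mean_regularized_tendsto])
    show "\<forall>\<^sub>F h in at_right 0. disc_mean (exp ?z) (regularized h) w
        \<le> (1 - t) * disc_mean (exp x) (regularized h) w + t * disc_mean (exp y) (regularized h) w"
      using eventually_at_right_less[of 0]
    proof eventually_elim
      case (elim h)
      note continuous = riesz_continuous[OF elim]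
      have "conv (green_kernel (exp ?z)) (riesz h) w \<le> conv ?k (riesz h) w"
      proof (rule conv_kernel_mono[OF kernel_green kernel_linear[OF kernel_green kernel_green] continuous])
        show "AE z in lborel. green_kernel (exp ?z) z \<le> ?k z"
          using convex_onD[OF green_kernel_log_convex] t by (intro AE_I2) simp
      qed (use t riesz_nonneg[OF elim] in auto)
      also have "\<dots> = (1 - t) * conv (green_kernel (exp x)) (riesz h) w
          + t * conv (green_kernel (exp y)) (riesz h) w"
        by (rule conv_kernel_linear[OF kernel_green kernel_green continuous]) auto
      finally show ?case using elim by (simp add: disc_mean_regularized_eq algebra_simps)
    qed
  qed simp
qed simp

lemma riesz_mass_le:
  assumes h: "0 < h" and r: "0 < r" "r \<le> s" and d: "0 < d" "d \<le> 1"
  shows "ln (s / r) * (1 - d\<^sup>2) * conv (indicator (ball 0 (d * r))) (riesz h) w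
    \<le> disc_mean s (regularized h) w - disc_mean r (regularized h) w"
proof -
  define c where "c = ln (s / r) * (1 - d\<^sup>2)"
  let ?ball = "indicator (ball 0 (d * r)) :: complex \<Rightarrow> real"
  have c: "0 \<le> c" unfolding c_def using r d by (auto simp: power_le_one)
  note green = kernel_green[OF r(1)] and continuous = riesz_continuous[OF h]
  have "c * conv ?ball (riesz h) w + conv (green_kernel r) (riesz h) w
      = conv (\<lambda>z. c * ?ball z + 1 * green_kernel r z) (riesz h) w"
    using conv_kernel_linear[OF kernel_indicator_ball green continuous, of c _ 1] by simp
  also have "\<dots> \<le> conv (green_kernel s) (riesz h) w"
  proof (rule conv_kernel_mono[OF kernel_linear[OF kernel_indicator_ball green]
      kernel_green continuous _ riesz_nonneg[OF h]])
    show "AE z in lborel. c * ?ball z + 1 * green_kernel r z \<le> green_kernel s z"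
      using AE_lborel_singleton[of "0::complex"]
    proof eventually_elim
      case (elim z)
      show ?case
        using green_kernel_increment[of r s z d] green_kernel_mono[of r s z] r d elim
        by (cases "cmod z < d * r") (auto simp: c_def)
    qed
  qed (use c r in auto)
  finally show ?thesis unfolding c_def[symmetric] using r h by (simp add: disc_mean_regularized_eq)
qed

lemma phi_le_concentric:
  assumes M: "\<And>u. u \<in> cball z0 R \<Longrightarrow> \<phi> u \<le> ereal M"
    and s: "0 < s" "dist z0 w + s \<le> r" "dist z0 w + r \<le> R"
  shows "\<phi> w \<le> ereal (M + (s / r)\<^sup>2 * (mean s z0 - M))"
proof -
  have r: "0 < r" using s(1,2) zero_le_dist[of z0 w] by linarith
  have subsets: "ball z0 s \<subseteq> ball w r" "ball w r \<subseteq> cball z0 R"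
    using s(2,3) by (simp_all add: ball_subset_ball_iff ball_subset_cball_iff dist_commute)
  have "AE z in lborel. indicator (ball z0 s) z * (M - real_phi z) \<le> indicator (ball w r) z * (M - real_phi z)"
    using AE_phi_eq_real_phi
  proof eventually_elim
    case (elim z)
    then have "real_phi z \<le> M" if "z \<in> cball z0 R" using M[OF that] by simp
    then show ?case using subsets by (auto simp: indicator_def)
  qed
  moreover have "integrable lborel (\<lambda>z. indicator (ball v t) z * (M - real_phi z))" for v t
    using set_integrable_ball_const_minus by (simp add: set_integrable_def)
  ultimately have "(LBINT z:ball z0 s. M - real_phi z) \<le> (LBINT z:ball w r. M - real_phi z)"
    unfolding set_lebesgue_integral_def real_scaleR_def by (intro integral_mono_AE)
  then have "pi * s\<^sup>2 * (M - mean s z0) \<le> pi * r\<^sup>2 * (M - mean r w)"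
    unfolding set_integral_ball_const_minus[OF s(1)] set_integral_ball_const_minus[OF r] .
  then have "s\<^sup>2 * (M - mean s z0) \<le> r\<^sup>2 * (M - mean r w)"
    by (simp only: mult.assoc mult_le_cancel_left_pos[OF pi_gt_zero])
  then have "mean r w \<le> M + (s / r)\<^sup>2 * (mean s z0 - M)"
    using r by (simp add: power_divide field_simps)
  then show ?thesis using phi_le_mean[OF r, of w] by (meson ereal_less_eq(3) order.trans)
qed

lemma mean_le_Sup_sphere:
  assumes r: "0 < r"
  shows "ereal (mean r z0) \<le> (SUP \<zeta>\<in>sphere z0 r. \<phi> \<zeta>)"
proof (rule ccontr)
  assume "\<not> ?thesis"
  then obtain c where c: "(SUP \<zeta>\<in>sphere z0 r. \<phi> \<zeta>) < ereal c" "c < mean r z0"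
    using ereal_dense2[of "SUP \<zeta>\<in>sphere z0 r. \<phi> \<zeta>" "ereal (mean r z0)"] by (auto simp: not_le)
  have const_harmonic: "harmonic (\<lambda>_. c)" using harmonic_Re_holomorphic[of "\<lambda>_. of_real c"] by simp
  have "mean r z0 \<le> c"
  proof (rule mean_le[OF r])
    fix z assume z: "z \<in> ball z0 r"
    show "\<phi> z \<le> ereal c"
    proof (rule subharmonic_le_harmonic[OF sub const_harmonic r])
      fix v assume "v \<in> sphere z0 r"
      then have "\<phi> v \<le> (SUP \<zeta>\<in>sphere z0 r. \<phi> \<zeta>)" by (rule SUP_upper)
      then show "\<phi> v \<le> ereal c" using c(1) by order
    qed (use z in auto)
  qed
  then show False using c(2) by simp
qed

definition mean_slope :: "complex \<Rightarrow> real \<Rightarrow> real" where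
  "mean_slope z r = (mean r z - mean 1 z) / ln r"

definition growth :: "complex \<Rightarrow> real" where
  "growth z = (INF r\<in>{0<..<1}. mean_slope z r)"

lemma mean_slope_nonneg: "0 < r \<Longrightarrow> r < 1 \<Longrightarrow> 0 \<le> mean_slope z r"
  unfolding mean_slope_def using mean_mono[of r 1 z] by (intro divide_nonpos_neg) auto

lemma mean_slope_mono:
  assumes r: "0 < r" "r \<le> s" "s < 1"
  shows "mean_slope z r \<le> mean_slope z s"
proof (cases "r = s")
  case False
  then show ?thesis
    using convex_on_slope_le(2)[OF mean_log_convex, of "ln r" 0 "ln s" z] r by (simp add: mean_slope_def)
qed simp

lemma bdd_below_mean_slope: "bdd_below (mean_slope z ` {0<..<1})"
  using mean_slope_nonneg by (intro bdd_belowI2[of _ 0]) auto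

lemma growth_le_mean_slope: "0 < r \<Longrightarrow> r < 1 \<Longrightarrow> growth z \<le> mean_slope z r"
  unfolding growth_def by (rule cINF_lower[OF bdd_below_mean_slope]) simp

lemma growth_nonneg: "0 \<le> growth z"
  unfolding growth_def by (rule cINF_greatest) (auto simp: mean_slope_nonneg)

lemma mean_slope_less:
  assumes "growth z < c"
  obtains r where "0 < r" "r < 1" "mean_slope z r < c"
  using assms unfolding growth_def by (subst (asm) cINF_less_iff[OF _ bdd_below_mean_slope]) auto

lemma mean_slope_tendsto: "(mean_slope z \<longlongrightarrow> growth z) (at_right 0)"
proof (rule order_tendstoI)
  have near_0: "\<forall>\<^sub>F r::real in at_right 0. 0 < r \<and> r < d" if "0 < d" for d
    using that by (intro eventually_at_rightI[of _ d]) auto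
  fix c assume "c < growth z"
  then show "\<forall>\<^sub>F r in at_right 0. c < mean_slope z r"
    using near_0[of 1] growth_le_mean_slope[of _ z] by (auto elim!: eventually_mono intro: order.strict_trans2)
next
  fix c assume "growth z < c"
  then obtain s where s: "0 < s" "s < 1" "mean_slope z s < c" by (rule mean_slope_less)
  have "\<forall>\<^sub>F r in at_right 0. 0 < r \<and> r < s" using s by (intro eventually_at_rightI[of _ s]) auto
  then show "\<forall>\<^sub>F r in at_right 0. mean_slope z r < c"
    by eventually_elim (use mean_slope_mono[of _ s z] s in force)
qed

lemma mean_le_growth:
  assumes "0 < r" "r \<le> 1"
  shows "mean r z \<le> mean 1 z + growth z * ln r"
proof (cases "r = 1")
  case False
  then have "ln r < 0" using assms by simp
  then show ?thesis using growth_le_mean_slope[of r z] False assms by (simp add: mean_slope_def field_simps)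
qed simp

end

section \<open>Integrability where the growth is less than 1\<close>

lemma exp_neg_ereal [simp]: "exp_neg (ereal v) = ennreal (exp (- v))"
  by (simp add: exp_neg_def)

lemma exp_neg_MInf [simp]: "exp_neg (-\<infinity>) = \<infinity>"
  by (simp add: exp_neg_def flip: MInfty_eq_minfinity)

lemma exp_neg_PInf [simp]: "exp_neg \<infinity> = 0"
  by (simp add: exp_neg_def flip: PInfty_eq_infinity)

lemma exp_neg_antimono: "x \<le> y \<Longrightarrow> exp_neg y \<le> exp_neg x"
  by (cases x; cases y) (auto intro!: ennreal_leI)

lemma exp_neg_borel [measurable]: "exp_neg \<in> borel_measurable borel"
proof -
  have eq: "exp_neg = (\<lambda>x. if x = \<infinity> then 0 else if x = -\<infinity> then \<infinity> else ennreal (exp (- real_of_ereal x)))"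
  proof
    fix x show "exp_neg x = (if x = \<infinity> then 0 else if x = -\<infinity> then \<infinity> else ennreal (exp (- real_of_ereal x)))"
      by (cases x) auto
  qed
  show ?thesis unfolding eq by measurable
qed

lemma less_exp_neg_imp:
  assumes "y < exp_neg x" "x < \<infinity>"
  obtains c where "x < ereal c" "y < ennreal (exp (- c))"
proof -
  obtain p where p: "y = ennreal p" "0 \<le> p" using assms(1) by (cases y) auto
  show ?thesis
  proof (cases x)
    case (real v)
    then have "p < exp (- v)" using assms(1) p by (simp add: ennreal_less_iff)
    then obtain q where q: "p < q" "q < exp (- v)" using dense by blast
    then have "ln q < - v" using p(2) by (metis exp_less_cancel_iff exp_ln order_le_less_trans)
    then show ?thesis using that[of "- ln q"] real p q by (simp add: ennreal_less_iff)
  next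
    case MInf
    have "p < exp (p + 1)" using exp_ge_add_one_self[of "p + 1"] by simp
    then show ?thesis using that[of "- (p + 1)"] MInf p by (simp add: ennreal_less_iff add.commute)
  qed (use assms(2) in simp)
qed

lemma nn_integral_le_Liminf_at_right_0:
  fixes F :: "real \<Rightarrow> 'a \<Rightarrow> ennreal"
  assumes meas: "\<And>h. 0 < h \<Longrightarrow> F h \<in> borel_measurable M"
    and le: "\<And>x. f x \<le> Liminf (at_right 0) (\<lambda>h. F h x)"
    and bound: "\<forall>\<^sub>F h in at_right 0. (\<integral>\<^sup>+x. F h x \<partial>M) \<le> B"
  shows "(\<integral>\<^sup>+x. f x \<partial>M) \<le> B"
proof -
  define h where "h n = 1 / real (Suc n)" for n
  have h: "filterlim h (at_right 0) sequentially"
    unfolding filterlim_at h_def using LIMSEQ_inverse_real_of_nat by (auto simp: divide_inverse)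
  have "f x \<le> liminf (\<lambda>n. F (h n) x)" for x
    using le[of x] eventually_compose_filterlim[OF _ h] unfolding le_Liminf_iff by blast
  then have "(\<integral>\<^sup>+x. f x \<partial>M) \<le> (\<integral>\<^sup>+x. liminf (\<lambda>n. F (h n) x) \<partial>M)" by (rule nn_integral_mono)
  also have "\<dots> \<le> liminf (\<lambda>n. \<integral>\<^sup>+x. F (h n) x \<partial>M)"
    by (rule nn_integral_liminf) (simp add: meas h_def)
  also have "\<dots> \<le> liminf (\<lambda>n::nat. B)"
    by (rule Liminf_mono[OF eventually_compose_filterlim[OF bound h]])
  finally show ?thesis by (simp add: Liminf_const)
qed

context subharmonic_function
begin

lemma exp_neg_le_Liminf_regularized:
  "exp_neg (\<phi> w) \<le> Liminf (at_right 0) (\<lambda>h. ennreal (exp (- regularized h w)))"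
  unfolding le_Liminf_iff
proof (intro allI impI)
  fix y assume "y < exp_neg (\<phi> w)"
  then obtain c where c: "\<phi> w < ereal c" "y < ennreal (exp (- c))"
    using phi_less_infinity by (rule less_exp_neg_imp)
  show "\<forall>\<^sub>F h in at_right 0. y < ennreal (exp (- regularized h w))"
    using regularized_limsup[OF c(1)]
    by eventually_elim (use c(2) in \<open>auto intro: order.strict_trans2 ennreal_leI\<close>)
qed

lemma exp_regularized_along_graph_le:
  assumes h: "0 < h" and r: "0 < r" and mass: "conv (indicator (ball 0 (2 * r))) (riesz h) z0 \<le> m"
    and lower: "\<And>w. w \<in> cball z0 r \<Longrightarrow> - C \<le> disc_mean r (regularized h) w"
    and I [measurable]: "I \<in> sets borel"
    and \<gamma> [measurable]: "\<gamma> \<in> borel_measurable borel" and Re_\<gamma>: "\<And>s. Re (\<gamma> s) = s"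
    and near: "\<And>s. s \<in> I \<Longrightarrow> \<gamma> s \<in> cball z0 r"
  shows "(\<integral>\<^sup>+s\<in>I. ennreal (exp (- regularized h (\<gamma> s))) \<partial>lborel)
      \<le> ennreal (exp C) * graph_exp_bound m r (emeasure lborel I)"
proof -
  let ?N = "density_on_ball z0 (2 * r) (riesz h)"
  let ?p = "\<lambda>w. \<integral>\<zeta>. max 0 (ln (r / cmod (w - \<zeta>))) \<partial>?N"
  note density = riesz_continuous[OF h] riesz_nonneg[OF h]
  interpret N: finite_measure ?N by (rule finite_measure_density_on_ball[OF density])
  have [measurable_cong]: "sets ?N = sets borel" by (simp add: density_on_ball_def)
  have potential: "- regularized h w \<le> C + ?p w" if "w \<in> cball z0 r" for w
  proof -
    have "conv (green_kernel r) (riesz h) w \<le> ?p w"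
      by (rule conv_green_le_log_potential[OF density r]) (use that in simp)
    then show ?thesis using lower[OF that] disc_mean_regularized_eq[OF r h, of w] by linarith
  qed
  have "(\<integral>\<^sup>+s\<in>I. ennreal (exp (- regularized h (\<gamma> s))) \<partial>lborel)
      \<le> (\<integral>\<^sup>+s. ennreal (exp C) * (ennreal (exp (?p (\<gamma> s))) * indicator I s) \<partial>lborel)"
  proof (rule nn_integral_mono)
    fix s
    show "ennreal (exp (- regularized h (\<gamma> s))) * indicator I s
        \<le> ennreal (exp C) * (ennreal (exp (?p (\<gamma> s))) * indicator I s)"
      using potential[OF near, of s]
      by (cases "s \<in> I") (auto simp: ennreal_mult'[symmetric] exp_add[symmetric] intro!: ennreal_leI)
  qed
  also have "\<dots> = ennreal (exp C) * (\<integral>\<^sup>+s\<in>I. ennreal (exp (?p (\<gamma> s))) \<partial>lborel)"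
    by (rule nn_integral_cmult) measurable
  also have "\<dots> \<le> ennreal (exp C) * graph_exp_bound m r (emeasure lborel I)"
    using measure_density_on_ball[OF density] mass integrable_density_on_ball_log[OF density r]
    by (intro mult_left_mono exp_log_potential_along_graph_le N.finite_measure_axioms r I \<gamma> Re_\<gamma>)
      (auto simp: density_on_ball_def)
  finally show ?thesis .
qed

lemma disc_mean_regularized_ge:
  assumes h: "0 < h" "h < r" and r: "0 < r" and w: "w \<in> cball z0 r"
    and lower: "\<And>z. z \<in> cball z0 (3 * r) \<Longrightarrow> c \<le> mean r z"
  shows "c \<le> disc_mean r (regularized h) w"
  unfolding disc_mean_regularized[OF h(1)]
proof (rule smoothing_disc_mean_ge[OF mean_continuous])
  fix z assume "z \<in> cball w (2 * h)"
  then have "z \<in> cball z0 (3 * r)" using w h dist_triangle[of z0 z w] by simp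
  then show "c \<le> mean r z" by (rule lower)
qed (rule h(1))

text \<open>The Riesz mass of a small disc is controlled by the slope of the means at a larger radius.\<close>
lemma riesz_mass_less_1:
  assumes "growth z0 < 1"
  obtains m \<rho> where "0 < m" "m < 1" "0 < \<rho>" "\<forall>\<^sub>F h in at_right 0. conv (indicator (ball 0 \<rho>)) (riesz h) z0 \<le> m"
proof -
  obtain m where m: "growth z0 < m" "m < 1" using assms dense by blast
  have "((\<lambda>d. m * (1 - d\<^sup>2)) \<longlongrightarrow> m * (1 - 0\<^sup>2)) (at_right 0)" by (intro tendsto_intros)
  then have "\<forall>\<^sub>F d in at_right 0. growth z0 < m * (1 - d\<^sup>2)" using m(1) by (intro order_tendstoD) auto
  moreover have "\<forall>\<^sub>F d::real in at_right 0. 0 < d \<and> d < 1" by (intro eventually_at_rightI[of _ 1]) auto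
  ultimately obtain d where d: "growth z0 < m * (1 - d\<^sup>2)" "0 < d" "d < 1"
    using eventually_happens'[OF trivial_limit_at_right_real eventually_conj] by blast
  obtain R where R: "0 < R" "R < 1" "mean_slope z0 R < m * (1 - d\<^sup>2)" using mean_slope_less[OF d(1)] .
  define c where "c = ln (1 / R) * (1 - d\<^sup>2)"
  have c: "0 < c" unfolding c_def using R d by (auto simp: abs_square_less_1 intro!: mult_pos_pos)
  have "m * (1 - d\<^sup>2) * ln R < mean R z0 - mean 1 z0"
    using R by (simp add: mean_slope_def neg_divide_less_eq)
  then have "mean 1 z0 - mean R z0 < c * m"
    using R unfolding c_def by (simp add: ln_div algebra_simps)
  moreover have "((\<lambda>h. disc_mean 1 (regularized h) z0 - disc_mean R (regularized h) z0)
      \<longlongrightarrow> mean 1 z0 - mean R z0) (at_right 0)"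
    by (intro tendsto_diff disc_mean_regularized_tendsto)
  ultimately have "\<forall>\<^sub>F h in at_right 0. disc_mean 1 (regularized h) z0 - disc_mean R (regularized h) z0 < c * m"
    by (rule order_tendstoD(2)[rotated])
  then have "\<forall>\<^sub>F h in at_right 0. conv (indicator (ball 0 (d * R))) (riesz h) z0 \<le> m"
    using eventually_at_right_less[of 0]
  proof eventually_elim
    case (elim h)
    have "c * conv (indicator (ball 0 (d * R))) (riesz h) z0
        \<le> disc_mean 1 (regularized h) z0 - disc_mean R (regularized h) z0"
      unfolding c_def by (rule riesz_mass_le) (use elim(2) R d in auto)
    also have "\<dots> \<le> c * m" using elim(1) by simp
    finally have "c * conv (indicator (ball 0 (d * R))) (riesz h) z0 \<le> c * m" .
    then show ?case using c by simp
  qed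
  moreover have "0 < m" using m(1) growth_nonneg[of z0] by simp
  ultimately show ?thesis using that[of m "d * R"] m d R by simp
qed

lemma exp_neg_along_graph_le:
  assumes r: "0 < r" and mass: "\<forall>\<^sub>F h in at_right 0. conv (indicator (ball 0 (2 * r))) (riesz h) z0 \<le> m"
    and lower: "\<And>z. z \<in> cball z0 (3 * r) \<Longrightarrow> - C \<le> mean r z"
    and I [measurable]: "I \<in> sets borel"
    and \<gamma> [measurable]: "\<gamma> \<in> borel_measurable borel" and Re_\<gamma>: "\<And>s. Re (\<gamma> s) = s"
    and near: "\<And>s. s \<in> I \<Longrightarrow> \<gamma> s \<in> cball z0 r"
  shows "(\<integral>\<^sup>+s\<in>I. exp_neg (\<phi> (\<gamma> s)) \<partial>lborel) \<le> ennreal (exp C) * graph_exp_bound m r (emeasure lborel I)"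
proof (rule nn_integral_le_Liminf_at_right_0[where
    F="\<lambda>h s. ennreal (exp (- regularized h (\<gamma> s))) * indicator I s"])
  fix h :: real assume "0 < h"
  note [measurable] = borel_measurable_continuous_onI[OF regularized_continuous[OF this]]
  show "(\<lambda>s. ennreal (exp (- regularized h (\<gamma> s))) * indicator I s) \<in> borel_measurable lborel" by measurable
next
  fix s
  show "exp_neg (\<phi> (\<gamma> s)) * indicator I s
      \<le> Liminf (at_right 0) (\<lambda>h. ennreal (exp (- regularized h (\<gamma> s))) * indicator I s)"
    using exp_neg_le_Liminf_regularized[of "\<gamma> s"] by (cases "s \<in> I") auto
next
  have "\<forall>\<^sub>F h in at_right 0. 0 < h \<and> h < r" using r by (intro eventually_at_rightI[of _ r]) auto
  then show "\<forall>\<^sub>F h in at_right 0. (\<integral>\<^sup>+s\<in>I. ennreal (exp (- regularized h (\<gamma> s))) \<partial>lborel)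
      \<le> ennreal (exp C) * graph_exp_bound m r (emeasure lborel I)"
    using mass
  proof eventually_elim
    case (elim h)
    then have "- C \<le> disc_mean r (regularized h) w" if "w \<in> cball z0 r" for w
      using disc_mean_regularized_ge[OF _ _ r that lower] by blast
    then show ?case using elim by (intro exp_regularized_along_graph_le[OF _ r _ _ I \<gamma> Re_\<gamma> near]) auto
  qed
qed

lemma exp_neg_integrable_along_graph:
  assumes growth: "growth z0 < 1" and \<gamma>: "\<gamma> \<in> borel_measurable borel" and Re_\<gamma>: "\<And>s. Re (\<gamma> s) = s"
  obtains \<epsilon> where "0 < \<epsilon>" "\<And>I. I \<in> sets borel \<Longrightarrow> emeasure lborel I < \<infinity> \<Longrightarrow> (\<And>s. s \<in> I \<Longrightarrow> dist (\<gamma> s) z0 < \<epsilon>)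
    \<Longrightarrow> (\<integral>\<^sup>+s\<in>I. exp_neg (\<phi> (\<gamma> s)) \<partial>lborel) < \<infinity>"
proof -
  obtain m \<rho> where m: "0 < m" "m < 1" and \<rho>: "0 < \<rho>"
    and mass: "\<forall>\<^sub>F h in at_right 0. conv (indicator (ball 0 \<rho>)) (riesz h) z0 \<le> m"
    using riesz_mass_less_1[OF growth] .
  define r where "r = \<rho> / 2"
  have r: "0 < r" "2 * r = \<rho>" using \<rho> by (simp_all add: r_def)
  obtain C where "\<And>z. z \<in> cball z0 (3 * r) \<Longrightarrow> \<bar>mean r z\<bar> \<le> C"
    using continuous_bounded_cball[OF mean_continuous] by blast
  then have C: "\<And>z. z \<in> cball z0 (3 * r) \<Longrightarrow> - C \<le> mean r z" by (force simp: abs_le_iff)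
  show ?thesis
  proof
    show "0 < r" by (rule r)
    fix I assume I: "I \<in> sets borel" and finite: "emeasure lborel I < \<infinity>"
      and near: "\<And>s. s \<in> I \<Longrightarrow> dist (\<gamma> s) z0 < r"
    have "(\<integral>\<^sup>+s\<in>I. exp_neg (\<phi> (\<gamma> s)) \<partial>lborel) \<le> ennreal (exp C) * graph_exp_bound m r (emeasure lborel I)"
      using mass near unfolding r(2)[symmetric]
      by (intro exp_neg_along_graph_le r(1) C I \<gamma> Re_\<gamma>) (auto simp: dist_commute less_imp_le)
    also have "\<dots> < \<infinity>" using graph_exp_bound_finite[OF m(2) finite] by (auto simp: ennreal_mult_less_top)
    finally show "(\<integral>\<^sup>+s\<in>I. exp_neg (\<phi> (\<gamma> s)) \<partial>lborel) < \<infinity>" .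
  qed
qed

end

section \<open>The Lelong number\<close>

lemma ereal_divide_antimono_neg:
  fixes p q :: ereal
  assumes "p \<le> q" "l < 0"
  shows "q / ereal l \<le> p / ereal l"
  using assms by (cases p; cases q) (auto simp: divide_ereal_def mult_right_mono_neg ereal_mult_le_0_iff)

definition log_bound :: "real \<Rightarrow> real \<Rightarrow> real \<Rightarrow> real \<Rightarrow> real" where
  "log_bound M A g l = M + (1 - 1 / l)\<^sup>2 * (A + g * (ln (l - 1) - l) - M)"

lemma log_bound_asymptotic: "((\<lambda>r. log_bound M A g (- ln r) / ln r) \<longlongrightarrow> g) (at_right 0)"
proof -
  have "((\<lambda>r::real. 1 / ln r) \<longlongrightarrow> 0) (at_right 0)" "((\<lambda>r::real. (1 - 1 / (- ln r))\<^sup>2) \<longlongrightarrow> 1) (at_right 0)"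
    "((\<lambda>r::real. (ln (- ln r - 1) - (- ln r)) / ln r) \<longlongrightarrow> 1) (at_right 0)" by real_asymp+
  then have "((\<lambda>r. M * (1 / ln r) + (1 - 1 / (- ln r))\<^sup>2 * ((A - M) * (1 / ln r)
      + g * ((ln (- ln r - 1) - (- ln r)) / ln r))) \<longlongrightarrow> M * 0 + 1 * ((A - M) * 0 + g * 1)) (at_right 0)"
    by (intro tendsto_intros)
  moreover have "log_bound M A g (- ln r) / ln r = M * (1 / ln r) + (1 - 1 / (- ln r))\<^sup>2 * ((A - M) * (1 / ln r)
      + g * ((ln (- ln r - 1) - (- ln r)) / ln r))" for r
    by (simp only: log_bound_def add_divide_distrib diff_divide_distrib distrib_left right_diff_distrib
        left_diff_distrib times_divide_eq_right times_divide_eq_left mult_1_right)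
  ultimately show ?thesis by simp
qed

lemma log_bound_le:
  assumes g: "1 \<le> g" and A: "A \<le> M" and l: "2 < l"
  shows "log_bound M A g l \<le> (M + 2) - l + ln l"
proof -
  have ln_l: "0 \<le> ln l" "ln l \<le> l" using l ln_le_minus_one[of l] by auto
  have "g * (ln (l - 1) - l) \<le> 1 * (ln (l - 1) - l)"
    using g l ln_le_minus_one[of "l - 1"] by (intro mult_right_mono_neg) auto
  also have "\<dots> \<le> - (l - ln l)" using l by simp
  finally have "A + g * (ln (l - 1) - l) - M \<le> - (l - ln l)" using A by simp
  then have "(1 - 1 / l)\<^sup>2 * (A + g * (ln (l - 1) - l) - M) \<le> (1 - 1 / l)\<^sup>2 * - (l - ln l)"
    by (rule mult_left_mono) simp
  also have "\<dots> \<le> (1 - 2 / l) * - (l - ln l)"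
  proof (rule mult_right_mono_neg)
    have "(1 - 1 / l)\<^sup>2 = (1 - 2 / l) + (1 / l)\<^sup>2" by (simp add: power2_eq_square algebra_simps)
    then show "1 - 2 / l \<le> (1 - 1 / l)\<^sup>2" by simp
  qed (use ln_l in simp)
  also have "\<dots> = - (l - ln l) + 2 - 2 * ln l / l" using l by (simp add: field_simps)
  also have "\<dots> \<le> 2 - l + ln l" using ln_l l by simp
  finally show ?thesis by (simp add: log_bound_def)
qed

context subharmonic_function
begin

text \<open>With \<open>l = ln (1 / r)\<close>, the radius \<open>(l - 1) r\<close> balances the two errors of the concentric estimate.\<close>
lemma phi_le_log:
  assumes M: "\<And>u. u \<in> cball z0 1 \<Longrightarrow> \<phi> u \<le> ereal M"
    and r: "dist z0 w = r" "0 < r" "r < exp (- 2)"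
  shows "\<phi> w \<le> ereal (log_bound M (mean 1 z0) (growth z0) (- ln r))"
proof -
  define l where "l = - ln r"
  have "ln r < ln (exp (- 2))" using r by (subst ln_less_cancel_iff) auto
  then have l: "2 < l" by (simp add: l_def)
  have "l \<le> 1 / r - 1" using ln_le_minus_one[of "1 / r"] r by (simp add: l_def ln_div)
  then have radius: "(l + 1) * r \<le> 1" using r by (simp add: field_simps)
  define s where "s = (l - 1) * r"
  have s: "0 < s" "s \<le> 1" using l r radius unfolding s_def by (auto simp: algebra_simps)
  have "\<phi> w \<le> ereal (M + (s / (l * r))\<^sup>2 * (mean s z0 - M))"
    by (rule phi_le_concentric[OF M s(1)]) (use radius r in \<open>auto simp: s_def algebra_simps\<close>)
  also have "s / (l * r) = 1 - 1 / l" unfolding s_def using r l by (simp add: field_simps)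
  also have "mean s z0 \<le> mean 1 z0 + growth z0 * (ln (l - 1) - l)"
    using mean_le_growth[OF s, of z0] l r by (simp add: s_def l_def ln_mult)
  finally show ?thesis by (simp add: log_bound_def mult_left_mono flip: l_def)
qed

theorem lelong_tendsto: "((\<lambda>r. (SUP \<zeta>\<in>sphere z0 r. \<phi> \<zeta>) / ereal (ln r)) \<longlongrightarrow> ereal (growth z0)) (at_right 0)"
proof -
  obtain M where M: "\<And>u. u \<in> cball z0 1 \<Longrightarrow> \<phi> u \<le> ereal M" using subharmonic_bounded_above[OF sub] by blast
  define upper where "upper r = log_bound M (mean 1 z0) (growth z0) (- ln r)" for r
  have small: "\<forall>\<^sub>F r::real in at_right 0. 0 < r \<and> r < exp (- 2)"
    by (intro eventually_at_rightI[of _ "exp (- 2)"]) auto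
  show ?thesis
  proof (rule tendsto_sandwich)
    show "\<forall>\<^sub>F r in at_right 0. ereal (upper r / ln r) \<le> (SUP \<zeta>\<in>sphere z0 r. \<phi> \<zeta>) / ereal (ln r)"
      using small
    proof eventually_elim
      case (elim r)
      then have "r < 1" using order.strict_trans[of r "exp (- 2)" 1] by simp
      have "(SUP \<zeta>\<in>sphere z0 r. \<phi> \<zeta>) \<le> ereal (upper r)"
        unfolding upper_def by (intro SUP_least phi_le_log[OF M]) (use elim in auto)
      then have "ereal (upper r) / ereal (ln r) \<le> (SUP \<zeta>\<in>sphere z0 r. \<phi> \<zeta>) / ereal (ln r)"
        by (rule ereal_divide_antimono_neg) (use elim \<open>r < 1\<close> in simp)
      then show ?case using elim \<open>r < 1\<close> by simp
    qed
    show "\<forall>\<^sub>F r in at_right 0. (SUP \<zeta>\<in>sphere z0 r. \<phi> \<zeta>) / ereal (ln r)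
        \<le> ereal (mean_slope z0 r + mean 1 z0 / ln r)"
      using small
    proof eventually_elim
      case (elim r)
      then have "r < 1" using order.strict_trans[of r "exp (- 2)" 1] by simp
      have "(SUP \<zeta>\<in>sphere z0 r. \<phi> \<zeta>) / ereal (ln r) \<le> ereal (mean r z0) / ereal (ln r)"
        using elim \<open>r < 1\<close> by (intro ereal_divide_antimono_neg mean_le_Sup_sphere) auto
      then show ?case using elim \<open>r < 1\<close> by (simp add: mean_slope_def diff_divide_distrib)
    qed
    have inv_ln: "((\<lambda>r::real. 1 / ln r) \<longlongrightarrow> 0) (at_right 0)" by real_asymp
    have "((\<lambda>r. mean_slope z0 r + mean 1 z0 * (1 / ln r)) \<longlongrightarrow> growth z0 + mean 1 z0 * 0) (at_right 0)"
      by (intro tendsto_intros mean_slope_tendsto inv_ln)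
    then show "((\<lambda>r. ereal (mean_slope z0 r + mean 1 z0 / ln r)) \<longlongrightarrow> ereal (growth z0)) (at_right 0)"
      by simp
    show "((\<lambda>r. ereal (upper r / ln r)) \<longlongrightarrow> ereal (growth z0)) (at_right 0)"
      unfolding upper_def by (intro tendsto_ereal log_bound_asymptotic)
  qed
qed

corollary lelong_eq_growth: "lelong \<phi> z0 = ereal (growth z0)"
  unfolding lelong_def by (rule tendsto_Lim[OF trivial_limit_at_right_real lelong_tendsto])

section \<open>Divergence where the growth is at least 1\<close>

lemma exp_neg_lower_bound:
  assumes growth: "1 \<le> growth z0"
  obtains c where "0 < c" "\<And>w. 0 < dist z0 w \<Longrightarrow> dist z0 w < exp (- 2) \<Longrightarrow>
    ennreal (c / (dist z0 w * ln (1 / dist z0 w))) \<le> exp_neg (\<phi> w)"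
proof -
  obtain M0 where M0: "\<And>u. u \<in> cball z0 1 \<Longrightarrow> \<phi> u \<le> ereal M0" using subharmonic_bounded_above[OF sub] by blast
  define M where "M = max M0 (mean 1 z0)"
  have M: "\<phi> u \<le> ereal M" if "u \<in> cball z0 1" for u
    using M0[OF that] by (rule order_trans) (simp add: M_def)
  show ?thesis
  proof
    fix w assume w: "0 < dist z0 w" "dist z0 w < exp (- 2)"
    define r l where "r = dist z0 w" and "l = - ln r"
    have r: "0 < r" "r < exp (- 2)" using w by (auto simp: r_def)
    have "ln r < ln (exp (- 2))" using r by (subst ln_less_cancel_iff) auto
    then have l: "2 < l" by (simp add: l_def)
    have "\<phi> w \<le> ereal (log_bound M (mean 1 z0) (growth z0) l)"
      unfolding l_def by (rule phi_le_log[OF M r_def[symmetric] r])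
    also have "log_bound M (mean 1 z0) (growth z0) l \<le> (M + 2) - l + ln l"
      by (rule log_bound_le[OF growth _ l]) (simp add: M_def)
    finally have phi_le: "\<phi> w \<le> ereal ((M + 2) - l + ln l)" by simp
    have "exp l = 1 / r" using r by (simp add: l_def exp_minus divide_inverse)
    then have "exp (- (M + 2)) / (r * l) = exp (- (M + 2)) * (exp l / exp (ln l))" using l by simp
    also have "\<dots> = exp (- ((M + 2) - l + ln l))" by (simp add: algebra_simps flip: exp_add exp_diff)
    finally have "ennreal (exp (- (M + 2)) / (r * l)) = exp_neg (ereal ((M + 2) - l + ln l))" by simp
    also have "\<dots> \<le> exp_neg (\<phi> w)" by (rule exp_neg_antimono[OF phi_le])
    finally show "ennreal (exp (- (M + 2)) / (dist z0 w * ln (1 / dist z0 w))) \<le> exp_neg (\<phi> w)"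
      using r by (simp add: r_def l_def ln_div)
  qed simp
qed

end

lemma DERIV_neg_ln_neg_ln:
  fixes x :: real
  assumes "0 < x" "x < 1"
  shows "((\<lambda>x. - ln (- ln x)) has_real_derivative 1 / (x * ln (1 / x))) (at x)"
  using assms by (auto intro!: derivative_eq_intros simp: ln_div field_simps)

lemma nn_integral_log_divergent:
  assumes \<eta>: "0 < \<eta>" "\<eta> < 1"
  shows "(\<integral>\<^sup>+x\<in>{0<..<\<eta>}. ennreal (1 / (x * ln (1 / x))) \<partial>lborel) = \<infinity>"
proof -
  let ?F = "\<lambda>x::real. - ln (- ln x)"
  have ge: "ennreal (?F (\<eta> / 2) - ?F \<delta>) \<le> (\<integral>\<^sup>+x\<in>{0<..<\<eta>}. ennreal (1 / (x * ln (1 / x))) \<partial>lborel)"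
    if \<delta>: "0 < \<delta>" "\<delta> \<le> \<eta> / 2" for \<delta>
  proof -
    have "ennreal (?F (\<eta> / 2) - ?F \<delta>) = (\<integral>\<^sup>+x\<in>{\<delta>..\<eta>/2}. ennreal (1 / (x * ln (1 / x))) \<partial>lborel)"
    proof (rule nn_integral_FTC_Icc[symmetric])
      fix x assume x: "x \<in> {\<delta>..\<eta>/2}"
      then show "DERIV ?F x :> 1 / (x * ln (1 / x))" using \<delta> \<eta> by (intro DERIV_neg_ln_neg_ln) auto
      have "0 \<le> ln (1 / x)" using x \<delta> \<eta> by simp
      then show "0 \<le> 1 / (x * ln (1 / x))" using x \<delta> by simp
    qed (use \<delta> in auto)
    also have "\<dots> \<le> (\<integral>\<^sup>+x\<in>{0<..<\<eta>}. ennreal (1 / (x * ln (1 / x))) \<partial>lborel)"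
      using \<delta> \<eta> by (intro nn_integral_mono) (auto simp: indicator_def)
    finally show ?thesis .
  qed
  have "filterlim (\<lambda>\<delta>. ?F (\<eta> / 2) - ?F \<delta>) at_top (at_right 0)" by real_asymp
  then have unbounded: "\<forall>\<^sub>F \<delta> in at_right 0. real n \<le> ?F (\<eta> / 2) - ?F \<delta>" for n
    by (simp add: filterlim_at_top)
  have "of_nat n \<le> (\<integral>\<^sup>+x\<in>{0<..<\<eta>}. ennreal (1 / (x * ln (1 / x))) \<partial>lborel)" for n
  proof -
    have "\<forall>\<^sub>F \<delta> in at_right 0. 0 < \<delta> \<and> \<delta> < \<eta> / 2" using \<eta> by (intro eventually_at_rightI[of _ "\<eta> / 2"]) auto
    with unbounded obtain \<delta> where \<delta>: "real n \<le> ?F (\<eta> / 2) - ?F \<delta>" "0 < \<delta>" "\<delta> < \<eta> / 2"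
      using eventually_happens'[OF trivial_limit_at_right_real eventually_conj] by blast
    have "of_nat n \<le> ennreal (?F (\<eta> / 2) - ?F \<delta>)"
      using \<delta>(1) by (subst ennreal_of_nat_eq_real_of_nat) (rule ennreal_leI)
    then show ?thesis using ge[of \<delta>] \<delta>(2,3) by (meson less_imp_le order_trans)
  qed
  then show ?thesis
    by (metis ennreal_Ex_less_of_nat infinity_ennreal_def leD top.not_eq_extremum)
qed

lemma nn_integral_log_divergent_near:
  fixes a b t \<eta> :: real
  assumes ab: "a < b" and t: "t \<in> {a..b}" and \<eta>: "0 < \<eta>"
  shows "(\<integral>\<^sup>+s\<in>{a..b} \<inter> ball t \<eta> - {t}. ennreal (1 / (dist t s * ln (1 / dist t s))) \<partial>lborel) = \<infinity>"
proof -
  define \<sigma> where "\<sigma> = (if t < b then 1 else -1 :: real)"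
  define \<eta>' where "\<eta>' = min (1/2) (min \<eta> (if t < b then b - t else b - a))"
  have \<eta>': "0 < \<eta>'" "\<eta>' < 1" using \<eta> ab by (auto simp: \<eta>'_def)
  let ?S = "{a..b} \<inter> ball t \<eta> - {t}"
  let ?f = "\<lambda>s. ennreal (1 / (dist t s * ln (1 / dist t s))) * indicator ?S s"
  have "\<infinity> = (\<integral>\<^sup>+x\<in>{0<..<\<eta>'}. ennreal (1 / (x * ln (1 / x))) \<partial>lborel)"
    by (rule nn_integral_log_divergent[OF \<eta>', symmetric])
  also have "\<dots> \<le> (\<integral>\<^sup>+x. ?f (t + \<sigma> * x) \<partial>lborel)"
  proof (rule nn_integral_mono)
    fix x
    show "ennreal (1 / (x * ln (1 / x))) * indicator {0<..<\<eta>'} x \<le> ?f (t + \<sigma> * x)"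
    proof (cases "x \<in> {0<..<\<eta>'}")
      case True
      then have "dist t (t + \<sigma> * x) = x" "t + \<sigma> * x \<in> ?S"
        using t by (auto simp: \<sigma>_def \<eta>'_def dist_real_def split: if_splits)
      then show ?thesis using True by simp
    qed simp
  qed
  also have "\<dots> = (\<integral>\<^sup>+s. ?f s \<partial>lborel)"
    by (subst (2) nn_integral_real_affine[where c=\<sigma> and t=t]) (auto simp: \<sigma>_def)
  finally show ?thesis by (simp add: top_unique)
qed

section \<open>Arc length along a Lipschitz graph\<close>

lemma lipschitz_derivative_bound:
  fixes f :: "real \<Rightarrow> real"
  assumes lip: "L-lipschitz_on UNIV f" and D: "(f has_real_derivative D) (at x)"
  shows "\<bar>D\<bar> \<le> L"
proof (rule tendsto_upperbound)
  show "((\<lambda>y. \<bar>(f y - f x) / (y - x)\<bar>) \<longlongrightarrow> \<bar>D\<bar>) (at x)"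
    using D unfolding has_field_derivative_iff by (rule tendsto_rabs)
  have "\<bar>(f y - f x) / (y - x)\<bar> \<le> L" if "y \<noteq> x" for y
    using lipschitz_onD[OF lip, of y x] that by (simp add: dist_real_def divide_le_eq)
  then show "\<forall>\<^sub>F y in at x. \<bar>(f y - f x) / (y - x)\<bar> \<le> L"
    by (simp add: eventually_at_filter)
qed simp

lemma lipschitz_on_clamp:
  fixes f :: "'a::euclidean_space \<Rightarrow> 'b::metric_space"
  assumes lip: "L-lipschitz_on (cbox a b) f" and ne: "cbox a b \<noteq> {}"
  shows "L-lipschitz_on UNIV (\<lambda>x. f (clamp a b x))"
proof (rule lipschitz_onI)
  fix x y
  have "dist (f (clamp a b x)) (f (clamp a b y)) \<le> L * dist (clamp a b x) (clamp a b y)"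
    by (rule lipschitz_onD[OF lip]) (use ne in \<open>auto simp: box_ne_empty intro!: clamp_in_interval\<close>)
  also have "\<dots> \<le> L * dist x y"
    by (intro mult_left_mono dist_clamps_le_dist_args lipschitz_on_nonneg[OF lip])
  finally show "dist (f (clamp a b x)) (f (clamp a b y)) \<le> L * dist x y" .
qed (rule lipschitz_on_nonneg[OF lip])

text \<open>Where the derivative of the graph does not exist, \<open>vector_derivative\<close> is an unspecified value.\<close>
lemma AE_graph_speed:
  fixes y :: "real \<Rightarrow> real"
  assumes lip: "L-lipschitz_on {a..b} y" and ab: "a < b"
  defines "v \<equiv> \<lambda>s. norm (vector_derivative (\<lambda>s. Complex s (y s)) (at s))"
  shows "AE s in lborel. s \<in> {a..b} \<longrightarrow> 1 \<le> v s \<and> v s \<le> 1 + L"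
proof -
  let ?y = "\<lambda>s. y (clamp a b s)"
  have lip_clamp: "L-lipschitz_on UNIV ?y" using lipschitz_on_clamp[of L a b y] lip ab by simp
  have "AE s in lebesgue. s \<notin> {s. \<not> ?y differentiable (at s)}"
    using lipschitz_differentiable_AE[OF lip_clamp] by (intro AE_not_in) (simp add: negligible_iff_null_sets)
  then have "AE s in lborel. ?y differentiable (at s)" by (simp add: AE_completion_iff)
  moreover have "AE s in lborel. s \<noteq> a" "AE s in lborel. s \<noteq> b" by (rule AE_lborel_singleton)+
  ultimately show ?thesis
  proof eventually_elim
    case (elim s)
    show ?case
    proof
      assume "s \<in> {a..b}"
      then have s: "s \<in> {a<..<b}" using elim by auto
      obtain D where D: "(?y has_real_derivative D) (at s)" using elim(1) real_differentiable_def by blast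
      have "(y has_real_derivative D) (at s)"
        by (rule has_field_derivative_transform_within_open[OF D open_greaterThanLessThan s]) simp
      then have "((\<lambda>s. Complex s (y s)) has_vector_derivative Complex 1 D) (at s)"
        unfolding has_vector_derivative_complex_iff by (auto intro!: derivative_eq_intros)
      then have "v s = cmod (Complex 1 D)" unfolding v_def by (simp add: vector_derivative_at)
      moreover have "1 \<le> cmod (Complex 1 D)" "cmod (Complex 1 D) \<le> 1 + \<bar>D\<bar>"
        using abs_Re_le_cmod[of "Complex 1 D"] cmod_le[of "Complex 1 D"] by simp_all
      moreover have "\<bar>D\<bar> \<le> L" by (rule lipschitz_derivative_bound[OF lip_clamp D])
      ultimately show "1 \<le> v s \<and> v s \<le> 1 + L" by linarith
    qed
  qed
qed

lemma arclength_integral_graph_finite_iff: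
  fixes y :: "real \<Rightarrow> real" and f :: "complex \<Rightarrow> ennreal"
  assumes lip: "L-lipschitz_on {a..b} y" and ab: "a < b"
    and S [measurable]: "S \<in> sets borel" and sub: "S \<subseteq> {a..b}" and f [measurable]: "f \<in> borel_measurable borel"
  shows "arclength_integral (\<lambda>s. Complex s (y s)) S f < \<infinity>
      \<longleftrightarrow> (\<integral>\<^sup>+s\<in>S. f (Complex s (y (clamp a b s))) \<partial>lborel) < \<infinity>"
proof -
  let ?\<gamma> = "\<lambda>s. Complex s (y (clamp a b s))"
  define v where "v s = norm (vector_derivative (\<lambda>s. Complex s (y s)) (at s))" for s
  have v: "AE s in lborel. s \<in> {a..b} \<longrightarrow> 1 \<le> v s \<and> v s \<le> 1 + L"
    unfolding v_def by (rule AE_graph_speed[OF lip ab])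
  have "L-lipschitz_on UNIV (\<lambda>s. y (clamp a b s))" using lipschitz_on_clamp[of L a b y] lip ab by simp
  note [measurable] = borel_measurable_continuous_onI[OF lipschitz_on_continuous_on[OF this]]
  have arclength: "arclength_integral (\<lambda>s. Complex s (y s)) S f = (\<integral>\<^sup>+s\<in>S. f (?\<gamma> s) * ennreal (v s) \<partial>lborel)"
    unfolding arclength_integral_def v_def using sub by (intro nn_integral_cong) (auto simp: indicator_def)
  have "(\<integral>\<^sup>+s\<in>S. f (?\<gamma> s) \<partial>lborel) \<le> (\<integral>\<^sup>+s\<in>S. f (?\<gamma> s) * ennreal (v s) \<partial>lborel)"
  proof (rule nn_integral_mono_AE)
    show "AE s in lborel. f (?\<gamma> s) * indicator S s \<le> f (?\<gamma> s) * ennreal (v s) * indicator S s"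
      using v
    proof eventually_elim
      case (elim s)
      have "f (?\<gamma> s) * 1 \<le> f (?\<gamma> s) * ennreal (v s)" if "s \<in> S"
        using ennreal_leI[of 1 "v s"] elim that sub by (intro mult_left_mono) auto
      then show ?case by (simp add: indicator_def)
    qed
  qed
  moreover have "(\<integral>\<^sup>+s\<in>S. f (?\<gamma> s) * ennreal (v s) \<partial>lborel) \<le> ennreal (1 + L) * (\<integral>\<^sup>+s\<in>S. f (?\<gamma> s) \<partial>lborel)"
  proof -
    have "AE s in lborel. f (?\<gamma> s) * ennreal (v s) * indicator S s
        \<le> ennreal (1 + L) * (f (?\<gamma> s) * indicator S s)"
      using v
    proof eventually_elim
      case (elim s)
      have "f (?\<gamma> s) * ennreal (v s) \<le> f (?\<gamma> s) * ennreal (1 + L)" if "s \<in> S"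
        using elim that sub by (intro mult_left_mono ennreal_leI) auto
      then show ?case by (simp add: indicator_def mult.commute)
    qed
    then show ?thesis by (subst nn_integral_cmult[symmetric]) (auto intro: nn_integral_mono_AE)
  qed
  ultimately show ?thesis
    unfolding arclength by (auto simp: ennreal_mult_less_top intro: order.strict_trans1)
qed

lemma dist_graph_ge: "dist s t \<le> dist (Complex s u) (Complex t v)"
  using abs_Re_le_cmod[of "Complex s u - Complex t v"] by (simp add: dist_real_def dist_norm)

lemma dist_lipschitz_graph_le:
  assumes "L-lipschitz_on UNIV y"
  shows "dist (Complex s (y s)) (Complex t (y t)) \<le> (1 + L) * dist s t"
  using cmod_le[of "Complex s (y s) - Complex t (y t)"] lipschitz_onD[OF assms, of s t]
  by (simp add: dist_real_def dist_norm algebra_simps)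

lemma divide_mult_ln_antimono:
  fixes x r :: real
  assumes "0 < x" "x \<le> r" "r \<le> K * x" "r < 1" "0 \<le> c"
  shows "c / (K * x * ln (1 / x)) \<le> c / (r * ln (1 / r))"
proof -
  have "0 < ln (1 / r)" using assms by simp
  moreover have "ln (1 / r) \<le> ln (1 / x)" using assms by (simp add: ln_div)
  ultimately have "r * ln (1 / r) \<le> K * x * ln (1 / x)" "0 < r * ln (1 / r)"
    using assms by (auto intro!: mult_mono)
  then show ?thesis using assms(5) by (intro frac_le) auto
qed

lemma (in subharmonic_function) exp_neg_graph_lower_bound:
  assumes growth: "1 \<le> growth (Complex t (y t))" and lip: "L-lipschitz_on UNIV y"
  obtains c \<delta> where "0 < c" "0 < \<delta>" "\<And>s. 0 < dist t s \<Longrightarrow> dist t s < \<delta> \<Longrightarrow>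
    ennreal c * ennreal (1 / (dist t s * ln (1 / dist t s))) \<le> exp_neg (\<phi> (Complex s (y s)))"
proof -
  let ?\<gamma> = "\<lambda>s. Complex s (y s)"
  obtain c where c: "0 < c" and lower: "\<And>w. 0 < dist (?\<gamma> t) w \<Longrightarrow> dist (?\<gamma> t) w < exp (- 2) \<Longrightarrow>
      ennreal (c / (dist (?\<gamma> t) w * ln (1 / dist (?\<gamma> t) w))) \<le> exp_neg (\<phi> w)"
    using that by (rule exp_neg_lower_bound[OF growth])
  define K where "K = 1 + L"
  have K: "1 \<le> K" using lipschitz_on_nonneg[OF lip] by (simp add: K_def)
  show ?thesis
  proof
    show "0 < c / K" "0 < exp (- 2) / K" using c K by simp_all
    fix s assume s: "0 < dist t s" "dist t s < exp (- 2) / K"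
    define x r where "x = dist t s" and "r = dist (?\<gamma> t) (?\<gamma> s)"
    have r: "x \<le> r" "r \<le> K * x"
      unfolding x_def r_def K_def by (rule dist_graph_ge, rule dist_lipschitz_graph_le[OF lip])
    have "K * x < exp (- 2)" using s(2) K by (simp add: x_def less_divide_eq mult.commute)
    then have near: "r < exp (- 2)" using r(2) by linarith
    then have "r < 1" using order.strict_trans[of r "exp (- 2)" 1] by simp
    then have "c / (K * x * ln (1 / x)) \<le> c / (r * ln (1 / r))"
      using r s(1) c by (intro divide_mult_ln_antimono) (auto simp: x_def)
    then have "ennreal (c / K * (1 / (x * ln (1 / x)))) \<le> ennreal (c / (r * ln (1 / r)))"
      by (intro ennreal_leI) (simp add: mult.assoc)
    also have "\<dots> \<le> exp_neg (\<phi> (?\<gamma> s))"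
      by (rule lower[of "?\<gamma> s", folded r_def, OF _ near]) (use r(1) s(1) in \<open>unfold x_def, linarith\<close>)
    also have "ennreal (c / K * (1 / (x * ln (1 / x)))) = ennreal (c / K) * ennreal (1 / (x * ln (1 / x)))"
      using c K by (intro ennreal_mult') simp
    finally show "ennreal (c / K) * ennreal (1 / (dist t s * ln (1 / dist t s))) \<le> exp_neg (\<phi> (?\<gamma> s))"
      unfolding x_def .
  qed
qed

lemma (in subharmonic_function) exp_neg_not_integrable_along_graph:
  assumes growth: "1 \<le> growth (Complex t (y t))" and lip: "L-lipschitz_on UNIV y"
    and ab: "a < b" and t: "t \<in> {a..b}" and \<epsilon>: "0 < \<epsilon>"
  shows "(\<integral>\<^sup>+s\<in>{s\<in>{a..b}. dist (Complex s (y s)) (Complex t (y t)) < \<epsilon>}.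
      exp_neg (\<phi> (Complex s (y s))) \<partial>lborel) = \<infinity>"
proof -
  let ?\<gamma> = "\<lambda>s. Complex s (y s)" and ?h = "\<lambda>x::real. 1 / (x * ln (1 / x))"
  obtain c \<delta> where c: "0 < c" and \<delta>: "0 < \<delta>" and lower: "\<And>s. 0 < dist t s \<Longrightarrow> dist t s < \<delta> \<Longrightarrow>
      ennreal c * ennreal (?h (dist t s)) \<le> exp_neg (\<phi> (?\<gamma> s))"
    using exp_neg_graph_lower_bound[OF growth lip] by blast
  have L: "0 < 1 + L" using lipschitz_on_nonneg[OF lip] by simp
  define \<eta> where "\<eta> = min \<delta> (\<epsilon> / (1 + L))"
  have \<eta>: "0 < \<eta>" using \<delta> \<epsilon> L by (simp add: \<eta>_def)
  let ?S = "{a..b} \<inter> ball t \<eta> - {t}"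
  have near: "dist (?\<gamma> s) (?\<gamma> t) < \<epsilon>" if "dist t s < \<eta>" for s
  proof -
    have "(1 + L) * dist s t < \<epsilon>"
      using that L by (simp add: \<eta>_def pos_less_divide_eq mult.commute dist_commute)
    then show ?thesis using dist_lipschitz_graph_le[OF lip, of s t] by simp
  qed
  have "\<infinity> = ennreal c * (\<integral>\<^sup>+s\<in>?S. ennreal (?h (dist t s)) \<partial>lborel)"
    using nn_integral_log_divergent_near[OF ab t \<eta>] c by (simp add: ennreal_mult_top)
  also have "\<dots> = (\<integral>\<^sup>+s. ennreal c * (ennreal (?h (dist t s)) * indicator ?S s) \<partial>lborel)"
    by (rule nn_integral_cmult[symmetric]) measurable
  also have "\<dots> \<le> (\<integral>\<^sup>+s\<in>{s\<in>{a..b}. dist (?\<gamma> s) (?\<gamma> t) < \<epsilon>}. exp_neg (\<phi> (?\<gamma> s)) \<partial>lborel)"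
  proof (rule nn_integral_mono)
    fix s
    show "ennreal c * (ennreal (?h (dist t s)) * indicator ?S s)
        \<le> exp_neg (\<phi> (?\<gamma> s)) * indicator {s\<in>{a..b}. dist (?\<gamma> s) (?\<gamma> t) < \<epsilon>} s"
      using lower[of s] near[of s] by (cases "s \<in> ?S") (auto simp: \<eta>_def)
  qed
  finally show ?thesis by (simp add: top_unique)
qed

lemma (in subharmonic_function) growth_less_1_iff_integrable_along_graph:
  assumes lip: "L-lipschitz_on UNIV y" and ab: "a < b" and t: "t \<in> {a..b}"
  defines "\<gamma> \<equiv> \<lambda>s. Complex s (y s)"
  shows "growth (\<gamma> t) < 1 \<longleftrightarrow> (\<exists>\<epsilon>>0. (\<integral>\<^sup>+s\<in>{s\<in>{a..b}. dist (\<gamma> s) (\<gamma> t) < \<epsilon>}. exp_neg (\<phi> (\<gamma> s)) \<partial>lborel) < \<infinity>)"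
proof
  note [measurable] = borel_measurable_continuous_onI[OF lipschitz_on_continuous_on[OF lip]]
  have \<gamma> [measurable]: "\<gamma> \<in> borel_measurable borel" unfolding \<gamma>_def by measurable
  have Re_\<gamma>: "Re (\<gamma> s) = s" for s by (simp add: \<gamma>_def)
  assume "growth (\<gamma> t) < 1"
  then obtain \<epsilon> where \<epsilon>: "0 < \<epsilon>" and integrable: "\<And>I. I \<in> sets borel \<Longrightarrow> emeasure lborel I < \<infinity> \<Longrightarrow>
      (\<And>s. s \<in> I \<Longrightarrow> dist (\<gamma> s) (\<gamma> t) < \<epsilon>) \<Longrightarrow> (\<integral>\<^sup>+s\<in>I. exp_neg (\<phi> (\<gamma> s)) \<partial>lborel) < \<infinity>"
    using exp_neg_integrable_along_graph[OF _ \<gamma> Re_\<gamma>] by blast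
  let ?S = "{s\<in>{a..b}. dist (\<gamma> s) (\<gamma> t) < \<epsilon>}"
  have "emeasure lborel ?S \<le> emeasure lborel {a..b}" by (rule emeasure_mono) auto
  also have "\<dots> < \<infinity>" using ab by simp
  finally have "(\<integral>\<^sup>+s\<in>?S. exp_neg (\<phi> (\<gamma> s)) \<partial>lborel) < \<infinity>" by (intro integrable) auto
  then show "\<exists>\<epsilon>>0. (\<integral>\<^sup>+s\<in>{s\<in>{a..b}. dist (\<gamma> s) (\<gamma> t) < \<epsilon>}. exp_neg (\<phi> (\<gamma> s)) \<partial>lborel) < \<infinity>"
    using \<epsilon> by blast
next
  assume "\<exists>\<epsilon>>0. (\<integral>\<^sup>+s\<in>{s\<in>{a..b}. dist (\<gamma> s) (\<gamma> t) < \<epsilon>}. exp_neg (\<phi> (\<gamma> s)) \<partial>lborel) < \<infinity>"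
  then show "growth (\<gamma> t) < 1"
    using exp_neg_not_integrable_along_graph[OF _ lip ab t] unfolding \<gamma>_def by (force simp: not_less)
qed

theorem theorem2p12:
  fixes a b L t :: real and y :: "real \<Rightarrow> real" and \<phi> :: "complex \<Rightarrow> ereal"
  assumes "a < b"
    and "L-lipschitz_on {a..b} y"
    and "subharmonic \<phi>"
    and "\<exists>z. \<phi> z \<noteq> - \<infinity>"
    and "t \<in> {a..b}"
  shows "lelong \<phi> (Complex t (y t)) < 1 \<longleftrightarrow>
         (\<exists>\<epsilon>>0. arclength_integral (\<lambda>s. Complex s (y s))
                   {s\<in>{a..b}. dist (Complex s (y s)) (Complex t (y t)) < \<epsilon>}
                   (\<lambda>w. exp_neg (\<phi> w)) < \<infinity>)"
proof -
  interpret subharmonic_function \<phi> using assms(3,4) by unfold_locales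
  let ?\<gamma> = "\<lambda>s. Complex s (y (clamp a b s))"
  let ?S = "\<lambda>\<epsilon>. {s\<in>{a..b}. dist (?\<gamma> s) (?\<gamma> t) < \<epsilon>}"
  have lip: "L-lipschitz_on UNIV (\<lambda>s. y (clamp a b s))"
    using lipschitz_on_clamp[of L a b y] assms(1,2) by simp
  note [measurable] = borel_measurable_continuous_onI[OF lipschitz_on_continuous_on[OF lip]]
  have "{s\<in>{a..b}. dist (Complex s (y s)) (Complex t (y t)) < \<epsilon>} = ?S \<epsilon>" for \<epsilon>
    using assms(5) by auto
  moreover have "arclength_integral (\<lambda>s. Complex s (y s)) (?S \<epsilon>) (\<lambda>w. exp_neg (\<phi> w)) < \<infinity> \<longleftrightarrow>
      (\<integral>\<^sup>+s\<in>?S \<epsilon>. exp_neg (\<phi> (?\<gamma> s)) \<partial>lborel) < \<infinity>" for \<epsilon>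
    by (rule arclength_integral_graph_finite_iff[OF assms(2,1)]) auto
  ultimately show ?thesis
    using growth_less_1_iff_integrable_along_graph[OF lip assms(1,5)] assms(5) by (simp add: lelong_eq_growth)
qed

end
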